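(* Let $M$ be a (smooth) manifold over $\mathbb{K}$. The group commutator in the group $\mathfrak{X}^2(M)$ and the Lie bracket in $\mathfrak{X}(M)$ are related via $$[\varepsilon_1X,\varepsilon_2Y]_{\mathfrak{X}^2(M)}=\varepsilon_1\varepsilon_2[X,Y]\qquad\text{for all }X,Y\in\mathfrak{X}(M).$$ Equivalently, the group commutator in the group $\mathrm{Diff}(TTM)$ and the Lie bracket in $\mathfrak{X}(M)$ are related via $$[\widetilde{\varepsilon_1X},\widetilde{\varepsilon_2Y}]=\widetilde{\varepsilon_1\varepsilon_2[X,Y]}.$$
   Context: $\mathbb{K}$ is a commutative unital Hausdorff topological ring with open dense unit group and continuous inversion; topological modules are Hausdorff. A map $f:V\supset U\to W$ ($U$ open, $V,W$ topological $\mathbb{K}$-modules) is $C^1$ if there is a continuous $f^{[1]}$ on $U^{[1]}=\{(x,v,t)\in U\times V\times\mathbb{K}:x+tv\in U\}$ with $f(x+tv)-f(x)=tf^{[1]}(x,v,t)$; $df(x)v=f^{[1]}(x,v,0)$; $f$ is $C^{j+1}$ if it is $C^1$ and $f^{[1]}$ is $C^j$; smooth means $C^j$ for all $j$. Manifolds are modelled on a topological $\mathbb{K}$-module $V$, with smooth transition maps; tangent bundles and tangent maps are defined by $Tf(x,v)=(f(x),df(x)v)$ in charts. $\mathfrak{X}(M)$ is the space of smooth vector fields, with Lie bracket given in every chart by $[X,Y](x)=dX(x)Y(x)-dY(x)X(x)$. The group commutator is $[g,h]=ghg^{-1}h^{-1}$. Over a chart domain $U\subset V$ points of $TTM=T(TM)$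 are written $x+\varepsilon_1v_1+\varepsilon_2v_2+\varepsilon_1\varepsilon_2v_{12}$ ($x\in U$, $v_1,v_2,v_{12}\in V$). $\mathfrak{X}^2(M)$ is the space of smooth sections of $TTM\to M$, written in charts $X(x)=x+\varepsilon_1X_1(x)+\varepsilon_2X_2(x)+\varepsilon_1\varepsilon_2X_{12}(x)$; it is a group under the chart-independent product $(X\cdot Y)(x)=x+\varepsilon_1(X_1(x)+Y_1(x))+\varepsilon_2(X_2(x)+Y_2(x))+\varepsilon_1\varepsilon_2(X_{12}(x)+Y_{12}(x)+dX_1(x)Y_2(x)+dX_2(x)Y_1(x))$. Each $X\in\mathfrak{X}^2(M)$ defines a diffeomorphism $\tilde X$ of $TTM$ given in charts by $\tilde X(x+\varepsilon_1v_1+\varepsilon_2v_2+\varepsilon_1\varepsilon_2v_{12})=x+\varepsilon_1(v_1+X_1(x))+\varepsilon_2(v_2+X_2(x))+\varepsilon_1\varepsilon_2(v_{12}+X_{12}(x)+dX_1(x)v_2+dX_2(x)v_1)$. For $Y\in\mathfrak{X}(M)$, $\varepsilon_1Y,\varepsilon_2Y,\varepsilon_1\varepsilon_2Y\in\mathfrak{X}^2(M)$ are the sections given in charts by $x+\varepsilon_1Y(x)$, $x+\varepsilon_2Y(x)$, $x+\varepsilon_1\varepsilon_2Y(x)$. *)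

theory Defs
  imports "HOL-Analysis.Analysis" "HOL-Algebra.Bij"
begin

section \<open>Base rings and topological modules\<close>

class dense_unit_ring = comm_ring_1 + topological_ab_group_add + topological_semigroup_mult + t2_space +
  assumes open_units: "open {x. x dvd 1}"
    and dense_units: "open S \<Longrightarrow> S \<noteq> {} \<Longrightarrow> \<exists>x\<in>S. x dvd 1"
    and tendsto_unit_inverse: "x dvd 1 \<Longrightarrow>
      ((\<lambda>y. THE z. y * z = 1) \<longlongrightarrow> (THE z. x * z = 1)) (at x within {y. y dvd 1})"

locale topological_module = module scale
  for scale :: "'k::dense_unit_ring \<Rightarrow> 'v::{topological_ab_group_add,t2_space} \<Rightarrow> 'v" +
  assumes continuous_on_scale: "continuous_on UNIV (\<lambda>(t, v). scale t v)"

definition pscale :: "('k \<Rightarrow> 'v \<Rightarrow> 'v) \<Rightarrow> 'k \<Rightarrow> 'v \<times> 'v \<Rightarrow> 'v \<times> 'v" where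
  "pscale s t = (\<lambda>(v, w). (s t v, s t w))"


section \<open>Differential calculus over a topological ring\<close>

text \<open>
  The definition of the class \<open>C\<^sup>k\<close> is recursive in \<open>k\<close>, but it replaces the domain module
  \<open>E\<close> by \<open>E \<times> E \<times> K\<close> and hence changes its type.  The following type contains
  the whole tower: level \<open>0\<close> consists of the elements \<open>Base v\<close> and is a copy of \<open>V\<close>; level
  \<open>n + 1\<close> consists of the elements \<open>Step x v t\<close> with \<open>x\<close>, \<open>v\<close> in level \<open>n\<close>, and is a copy of
  (level \<open>n\<close>) \<open>\<times>\<close> (level \<open>n\<close>) \<open>\<times>\<close> \<open>K\<close>.  Elements of unbalanced shape belong to no level and
  are never used.
\<close>

datatype ('v, 'k) tower = Base (unBase: 'v) | Step "('v, 'k) tower" "('v, 'k) tower" 'k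

fun unStep :: "('v, 'k) tower \<Rightarrow> ('v, 'k) tower \<times> ('v, 'k) tower \<times> 'k" where
  "unStep (Step x v t) = (x, v, t)"
| "unStep (Base _) = undefined"

text \<open>The topology of level \<open>n\<close>; its underlying set is the set of all elements of that level.\<close>

primrec tower_top :: "nat \<Rightarrow> ('v::topological_space, 'k::topological_space) tower topology" where
  "tower_top 0 = pullback_topology (range Base) unBase euclidean"
| "tower_top (Suc n) =
    pullback_topology (range (\<lambda>(x, v, t). Step x v t)) unStep
      (prod_topology (tower_top n) (prod_topology (tower_top n) euclidean))"

fun tower_add :: "('v::plus, 'k::plus) tower \<Rightarrow> ('v, 'k) tower \<Rightarrow> ('v, 'k) tower" where
  "tower_add (Base v) (Base w) = Base (v + w)"
| "tower_add (Step x v t) (Step x' v' t') = Step (tower_add x x') (tower_add v v') (t + t')"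
| "tower_add _ _ = undefined"

primrec tower_scale :: "('k::times \<Rightarrow> 'v \<Rightarrow> 'v) \<Rightarrow> 'k \<Rightarrow> ('v, 'k) tower \<Rightarrow> ('v, 'k) tower" where
  "tower_scale s r (Base v) = Base (s r v)"
| "tower_scale s r (Step x v t) = Step (tower_scale s r x) (tower_scale s r v) (r * t)"

text \<open>The domain \<open>U\<^sup>[\<^sup>1\<^sup>]\<close> for a subset \<open>U\<close> of level \<open>n\<close>.\<close>

definition dq_dom ::
  "('k::dense_unit_ring \<Rightarrow> 'v::{topological_ab_group_add,t2_space} \<Rightarrow> 'v) \<Rightarrow> nat \<Rightarrow>
    ('v, 'k) tower set \<Rightarrow> ('v, 'k) tower set" where
  "dq_dom s n U = {Step x v t | x v t.
     x \<in> U \<and> v \<in> topspace (tower_top n) \<and> tower_add x (tower_scale s t v) \<in> U}"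

text \<open>\<open>g\<close> is a continuous extended difference quotient \<open>f\<^sup>[\<^sup>1\<^sup>]\<close> of \<open>f\<close>, defined on the subset \<open>U\<close>
  of level \<open>n\<close>.\<close>

definition is_dq ::
  "('k::dense_unit_ring \<Rightarrow> 'v::{topological_ab_group_add,t2_space} \<Rightarrow> 'v) \<Rightarrow>
    ('k \<Rightarrow> 'w::{topological_ab_group_add,t2_space} \<Rightarrow> 'w) \<Rightarrow> nat \<Rightarrow>
    ('v, 'k) tower set \<Rightarrow> (('v, 'k) tower \<Rightarrow> 'w) \<Rightarrow> (('v, 'k) tower \<Rightarrow> 'w) \<Rightarrow> bool" where
  "is_dq s s' n U f g \<longleftrightarrow>
     continuous_map (subtopology (tower_top (Suc n)) (dq_dom s n U)) euclidean g \<and>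
     (\<forall>x v t. Step x v t \<in> dq_dom s n U \<longrightarrow>
        f (tower_add x (tower_scale s t v)) - f x = s' t (g (Step x v t)))"

primrec Ck_on ::
  "nat \<Rightarrow> ('k::dense_unit_ring \<Rightarrow> 'v::{topological_ab_group_add,t2_space} \<Rightarrow> 'v) \<Rightarrow>
    ('k \<Rightarrow> 'w::{topological_ab_group_add,t2_space} \<Rightarrow> 'w) \<Rightarrow> nat \<Rightarrow>
    ('v, 'k) tower set \<Rightarrow> (('v, 'k) tower \<Rightarrow> 'w) \<Rightarrow> bool" where
  "Ck_on 0 s s' n U f \<longleftrightarrow> continuous_map (subtopology (tower_top n) U) euclidean f"
| "Ck_on (Suc k) s s' n U f \<longleftrightarrow>
     (\<exists>g. is_dq s s' n U f g \<and> Ck_on k s s' (Suc n) (dq_dom s n U) g)"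

definition smooth_on ::
  "('k::dense_unit_ring \<Rightarrow> 'v::{topological_ab_group_add,t2_space} \<Rightarrow> 'v) \<Rightarrow>
    ('k \<Rightarrow> 'w::{topological_ab_group_add,t2_space} \<Rightarrow> 'w) \<Rightarrow>
    'v set \<Rightarrow> ('v \<Rightarrow> 'w) \<Rightarrow> bool" where
  "smooth_on s s' U f \<longleftrightarrow> (\<forall>k. Ck_on k s s' 0 (Base ` U) (f \<circ> unBase))"

text \<open>\<open>df(x)v = f\<^sup>[\<^sup>1\<^sup>](x, v, 0)\<close>.  On an open set \<open>U\<close> the map \<open>f\<^sup>[\<^sup>1\<^sup>]\<close> is unique, because the units
  are dense and modules are Hausdorff, so the choice is immaterial.\<close>

definition diff_at ::
  "('k::dense_unit_ring \<Rightarrow> 'v::{topological_ab_group_add,t2_space} \<Rightarrow> 'v) \<Rightarrow>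
    ('k \<Rightarrow> 'w::{topological_ab_group_add,t2_space} \<Rightarrow> 'w) \<Rightarrow>
    'v set \<Rightarrow> ('v \<Rightarrow> 'w) \<Rightarrow> 'v \<Rightarrow> 'v \<Rightarrow> 'w" where
  "diff_at s s' U f x v =
     (SOME g. is_dq s s' 0 (Base ` U) (f \<circ> unBase) g) (Step (Base x) (Base v) 0)"

instance prod :: (topological_monoid_add, topological_monoid_add) topological_monoid_add
proof
  fix a b :: "'a \<times> 'b"
  have 1: "(fst \<longlongrightarrow> a) (nhds a \<times>\<^sub>F nhds b)" "(snd \<longlongrightarrow> b) (nhds a \<times>\<^sub>F nhds b)"
    by (rule filterlim_fst filterlim_snd)+
  have "((\<lambda>x. (fst (fst x) + fst (snd x), snd (fst x) + snd (snd x))) \<longlongrightarrow>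
      (fst a + fst b, snd a + snd b)) (nhds a \<times>\<^sub>F nhds b)"
    by (intro tendsto_Pair tendsto_add tendsto_fst tendsto_snd 1)
  then show "((\<lambda>x. fst x + snd x) \<longlongrightarrow> a + b) (nhds a \<times>\<^sub>F nhds b)"
    by (simp add: plus_prod_def)
qed

instance prod :: (topological_comm_monoid_add, topological_comm_monoid_add) topological_comm_monoid_add ..

instance prod :: (topological_group_add, topological_group_add) topological_group_add
proof
  fix a :: "'a \<times> 'b"
  have "((\<lambda>x. (- fst x, - snd x)) \<longlongrightarrow> (- fst a, - snd a)) (nhds a)"
    by (intro tendsto_Pair tendsto_minus tendsto_fst tendsto_snd filterlim_ident)
  then show "(uminus \<longlongrightarrow> - a) (nhds a)"
    by (simp add: uminus_prod_def [abs_def])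
qed

instance prod :: (topological_ab_group_add, topological_ab_group_add) topological_ab_group_add ..


section \<open>Manifolds\<close>

text \<open>A chart is a pair of its domain and its coordinate map; the values of the latter outside the
  domain are irrelevant.  Atlases need not be maximal.\<close>

type_synonym ('m, 'v) chart = "'m set \<times> ('m \<Rightarrow> 'v)"

record ('m, 'v) mfd =
  mtop :: "'m topology"
  atlas :: "('m, 'v) chart set"

abbreviation chart_img :: "('m, 'v) chart \<Rightarrow> 'v set" where
  "chart_img c \<equiv> snd c ` fst c"

abbreviation chart_inv :: "('m, 'v) chart \<Rightarrow> 'v \<Rightarrow> 'm" where
  "chart_inv c \<equiv> inv_into (fst c) (snd c)"

definition smooth_manifold ::
  "('k::dense_unit_ring \<Rightarrow> 'v::{topological_ab_group_add,t2_space} \<Rightarrow> 'v) \<Rightarrow> ('m, 'v) mfd \<Rightarrow> bool"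
  where
  "smooth_manifold s M \<longleftrightarrow>
     (\<Union>c\<in>atlas M. fst c) = topspace (mtop M) \<and>
     (\<forall>c\<in>atlas M. openin (mtop M) (fst c) \<and> open (chart_img c) \<and>
        homeomorphic_map (subtopology (mtop M) (fst c)) (top_of_set (chart_img c)) (snd c)) \<and>
     (\<forall>c\<in>atlas M. \<forall>c'\<in>atlas M.
        smooth_on s s (snd c ` (fst c \<inter> fst c')) (snd c' \<circ> chart_inv c))"

definition smooth_map ::
  "('k::dense_unit_ring \<Rightarrow> 'v::{topological_ab_group_add,t2_space} \<Rightarrow> 'v) \<Rightarrow> ('m, 'v) mfd \<Rightarrow>
    ('k \<Rightarrow> 'w::{topological_ab_group_add,t2_space} \<Rightarrow> 'w) \<Rightarrow> ('n, 'w) mfd \<Rightarrow>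
    ('m \<Rightarrow> 'n) \<Rightarrow> bool" where
  "smooth_map s M s' N f \<longleftrightarrow>
     continuous_map (mtop M) (mtop N) f \<and>
     (\<forall>c\<in>atlas M. \<forall>c'\<in>atlas N.
        smooth_on s s' (snd c ` (fst c \<inter> f -` fst c')) (snd c' \<circ> f \<circ> chart_inv c))"

text \<open>Diffeomorphisms are represented by extensional functions, as in the library's group of all
  bijections of a set; multiplication is composition.\<close>

definition Diff ::
  "('k::dense_unit_ring \<Rightarrow> 'v::{topological_ab_group_add,t2_space} \<Rightarrow> 'v) \<Rightarrow> ('m, 'v) mfd \<Rightarrow>
    ('m \<Rightarrow> 'm) monoid" where
  "Diff s M = (BijGroup (topspace (mtop M)))
     \<lparr>carrier := {f \<in> Bij (topspace (mtop M)).
        smooth_map s M s M f \<and> smooth_map s M s M (inv_into (topspace (mtop M)) f)}\<rparr>"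


section \<open>The tangent bundle\<close>

text \<open>A tangent vector at \<open>p\<close> is an equivalence class of pairs (chart \<open>c\<close> at \<open>p\<close>, vector \<open>v\<close>), where
  \<open>(c, v)\<close> and \<open>(c', v')\<close> are equivalent if the differential of the change of charts maps \<open>v\<close> to
  \<open>v'\<close>.  Such a class contains exactly one pair for each chart \<open>c\<close> at \<open>p\<close>; it is represented here
  by the function assigning \<open>v\<close> to \<open>c\<close>.\<close>

type_synonym ('m, 'v) tvec = "'m \<times> (('m, 'v) chart \<Rightarrow> 'v)"

definition tangent_vectors ::
  "('k::dense_unit_ring \<Rightarrow> 'v::{topological_ab_group_add,t2_space} \<Rightarrow> 'v) \<Rightarrow> ('m, 'v) mfd \<Rightarrow>
    ('m, 'v) tvec set" where
  "tangent_vectors s M = {(p, \<xi>). p \<in> topspace (mtop M) \<and>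
     \<xi> \<in> extensional {c \<in> atlas M. p \<in> fst c} \<and>
     (\<forall>c\<in>atlas M. \<forall>c'\<in>atlas M. p \<in> fst c \<longrightarrow> p \<in> fst c' \<longrightarrow>
        \<xi> c' = diff_at s s (snd c ` (fst c \<inter> fst c')) (snd c' \<circ> chart_inv c) (snd c p) (\<xi> c))}"

definition tangent_chart ::
  "('k::dense_unit_ring \<Rightarrow> 'v::{topological_ab_group_add,t2_space} \<Rightarrow> 'v) \<Rightarrow> ('m, 'v) mfd \<Rightarrow>
    ('m, 'v) chart \<Rightarrow> (('m, 'v) tvec, 'v \<times> 'v) chart" where
  "tangent_chart s M c =
     ({q \<in> tangent_vectors s M. fst q \<in> fst c}, \<lambda>q. (snd c (fst q), snd q c))"

definition tangent_bundle ::
  "('k::dense_unit_ring \<Rightarrow> 'v::{topological_ab_group_add,t2_space} \<Rightarrow> 'v) \<Rightarrow> ('m, 'v) mfd \<Rightarrow>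
    (('m, 'v) tvec, 'v \<times> 'v) mfd" where
  "tangent_bundle s M =
     \<lparr>mtop = topology (\<lambda>S. S \<subseteq> tangent_vectors s M \<and>
        (\<forall>c\<in>atlas M. open (snd (tangent_chart s M c) ` (S \<inter> fst (tangent_chart s M c))))),
      atlas = tangent_chart s M ` atlas M\<rparr>"

definition vector_fields ::
  "('k::dense_unit_ring \<Rightarrow> 'v::{topological_ab_group_add,t2_space} \<Rightarrow> 'v) \<Rightarrow> ('m, 'v) mfd \<Rightarrow>
    ('m \<Rightarrow> ('m, 'v) tvec) set" where
  "vector_fields s M = {X \<in> extensional (topspace (mtop M)).
     smooth_map s M (pscale s) (tangent_bundle s M) X \<and> (\<forall>p\<in>topspace (mtop M). fst (X p) = p)}"

definition vf_rep :: "('m, 'v) chart \<Rightarrow> ('m \<Rightarrow> ('m, 'v) tvec) \<Rightarrow> 'v \<Rightarrow> 'v" where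
  "vf_rep c X x = snd (X (chart_inv c x)) c"

definition lie_bracket ::
  "('k::dense_unit_ring \<Rightarrow> 'v::{topological_ab_group_add,t2_space} \<Rightarrow> 'v) \<Rightarrow> ('m, 'v) mfd \<Rightarrow>
    ('m \<Rightarrow> ('m, 'v) tvec) \<Rightarrow> ('m \<Rightarrow> ('m, 'v) tvec) \<Rightarrow> ('m \<Rightarrow> ('m, 'v) tvec)" where
  "lie_bracket s M X Y = (THE Z. Z \<in> vector_fields s M \<and>
     (\<forall>c\<in>atlas M. \<forall>x\<in>chart_img c.
        vf_rep c Z x = diff_at s s (chart_img c) (vf_rep c X) x (vf_rep c Y x)
                     - diff_at s s (chart_img c) (vf_rep c Y) x (vf_rep c X x)))"


section \<open>The second tangent bundle and its sections\<close>

text \<open>In the chart of \<open>TTM = T(TM)\<close> induced by a chart of \<open>M\<close>, the point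
  \<open>x + \<epsilon>\<^sub>1 v\<^sub>1 + \<epsilon>\<^sub>2 v\<^sub>2 + \<epsilon>\<^sub>1 \<epsilon>\<^sub>2 v\<^sub>1\<^sub>2\<close> has the coordinates \<open>((x, v\<^sub>1), (v\<^sub>2, v\<^sub>1\<^sub>2))\<close>: it is
  the tangent vector \<open>v\<^sub>2 + \<epsilon>\<^sub>1 v\<^sub>1\<^sub>2\<close> of \<open>TM\<close> at the point \<open>x + \<epsilon>\<^sub>1 v\<^sub>1\<close>.\<close>

type_synonym ('m, 'v) ttvec = "(('m, 'v) tvec, 'v \<times> 'v) tvec"

abbreviation ttscale ::
  "('k \<Rightarrow> 'v \<Rightarrow> 'v) \<Rightarrow> 'k \<Rightarrow> ('v \<times> 'v) \<times> ('v \<times> 'v) \<Rightarrow> ('v \<times> 'v) \<times> ('v \<times> 'v)" where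
  "ttscale s \<equiv> pscale (pscale s)"

definition TTM ::
  "('k::dense_unit_ring \<Rightarrow> 'v::{topological_ab_group_add,t2_space} \<Rightarrow> 'v) \<Rightarrow> ('m, 'v) mfd \<Rightarrow>
    (('m, 'v) ttvec, ('v \<times> 'v) \<times> ('v \<times> 'v)) mfd" where
  "TTM s M = tangent_bundle (pscale s) (tangent_bundle s M)"

definition tt_chart ::
  "('k::dense_unit_ring \<Rightarrow> 'v::{topological_ab_group_add,t2_space} \<Rightarrow> 'v) \<Rightarrow> ('m, 'v) mfd \<Rightarrow>
    ('m, 'v) chart \<Rightarrow> (('m, 'v) ttvec, ('v \<times> 'v) \<times> ('v \<times> 'v)) chart" where
  "tt_chart s M c = tangent_chart (pscale s) (tangent_bundle s M) (tangent_chart s M c)"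

definition sections2 ::
  "('k::dense_unit_ring \<Rightarrow> 'v::{topological_ab_group_add,t2_space} \<Rightarrow> 'v) \<Rightarrow> ('m, 'v) mfd \<Rightarrow>
    ('m \<Rightarrow> ('m, 'v) ttvec) set" where
  "sections2 s M = {X \<in> extensional (topspace (mtop M)).
     smooth_map s M (ttscale s) (TTM s M) X \<and> (\<forall>p\<in>topspace (mtop M). fst (fst (X p)) = p)}"

definition rep2 ::
  "('k::dense_unit_ring \<Rightarrow> 'v::{topological_ab_group_add,t2_space} \<Rightarrow> 'v) \<Rightarrow> ('m, 'v) mfd \<Rightarrow>
    ('m, 'v) chart \<Rightarrow> ('m \<Rightarrow> ('m, 'v) ttvec) \<Rightarrow> 'v \<Rightarrow> ('v \<times> 'v) \<times> ('v \<times> 'v)" where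
  "rep2 s M c X x = snd (tt_chart s M c) (X (chart_inv c x))"

definition comp1 ::
  "('k::dense_unit_ring \<Rightarrow> 'v::{topological_ab_group_add,t2_space} \<Rightarrow> 'v) \<Rightarrow> ('m, 'v) mfd \<Rightarrow>
    ('m, 'v) chart \<Rightarrow> ('m \<Rightarrow> ('m, 'v) ttvec) \<Rightarrow> 'v \<Rightarrow> 'v" where
  "comp1 s M c X x = snd (fst (rep2 s M c X x))"

definition comp2 ::
  "('k::dense_unit_ring \<Rightarrow> 'v::{topological_ab_group_add,t2_space} \<Rightarrow> 'v) \<Rightarrow> ('m, 'v) mfd \<Rightarrow>
    ('m, 'v) chart \<Rightarrow> ('m \<Rightarrow> ('m, 'v) ttvec) \<Rightarrow> 'v \<Rightarrow> 'v" where
  "comp2 s M c X x = fst (snd (rep2 s M c X x))"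

definition comp12 ::
  "('k::dense_unit_ring \<Rightarrow> 'v::{topological_ab_group_add,t2_space} \<Rightarrow> 'v) \<Rightarrow> ('m, 'v) mfd \<Rightarrow>
    ('m, 'v) chart \<Rightarrow> ('m \<Rightarrow> ('m, 'v) ttvec) \<Rightarrow> 'v \<Rightarrow> 'v" where
  "comp12 s M c X x = snd (snd (rep2 s M c X x))"

text \<open>The smooth section of \<open>TTM\<close> given in every chart \<open>c\<close> by
  \<open>x + \<epsilon>\<^sub>1 A c x + \<epsilon>\<^sub>2 B c x + \<epsilon>\<^sub>1 \<epsilon>\<^sub>2 C c x\<close>.\<close>

definition section2_of ::
  "('k::dense_unit_ring \<Rightarrow> 'v::{topological_ab_group_add,t2_space} \<Rightarrow> 'v) \<Rightarrow> ('m, 'v) mfd \<Rightarrow>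
    (('m, 'v) chart \<Rightarrow> 'v \<Rightarrow> 'v) \<Rightarrow> (('m, 'v) chart \<Rightarrow> 'v \<Rightarrow> 'v) \<Rightarrow> (('m, 'v) chart \<Rightarrow> 'v \<Rightarrow> 'v) \<Rightarrow>
    ('m \<Rightarrow> ('m, 'v) ttvec)" where
  "section2_of s M A B C = (THE Z. Z \<in> sections2 s M \<and>
     (\<forall>c\<in>atlas M. \<forall>x\<in>chart_img c. rep2 s M c Z x = ((x, A c x), (B c x, C c x))))"

definition eps1 ::
  "('k::dense_unit_ring \<Rightarrow> 'v::{topological_ab_group_add,t2_space} \<Rightarrow> 'v) \<Rightarrow> ('m, 'v) mfd \<Rightarrow>
    ('m \<Rightarrow> ('m, 'v) tvec) \<Rightarrow> ('m \<Rightarrow> ('m, 'v) ttvec)" where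
  "eps1 s M Y = section2_of s M (\<lambda>c. vf_rep c Y) (\<lambda>c x. 0) (\<lambda>c x. 0)"

definition eps2 ::
  "('k::dense_unit_ring \<Rightarrow> 'v::{topological_ab_group_add,t2_space} \<Rightarrow> 'v) \<Rightarrow> ('m, 'v) mfd \<Rightarrow>
    ('m \<Rightarrow> ('m, 'v) tvec) \<Rightarrow> ('m \<Rightarrow> ('m, 'v) ttvec)" where
  "eps2 s M Y = section2_of s M (\<lambda>c x. 0) (\<lambda>c. vf_rep c Y) (\<lambda>c x. 0)"

definition eps12 ::
  "('k::dense_unit_ring \<Rightarrow> 'v::{topological_ab_group_add,t2_space} \<Rightarrow> 'v) \<Rightarrow> ('m, 'v) mfd \<Rightarrow>
    ('m \<Rightarrow> ('m, 'v) tvec) \<Rightarrow> ('m \<Rightarrow> ('m, 'v) ttvec)" where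
  "eps12 s M Y = section2_of s M (\<lambda>c x. 0) (\<lambda>c x. 0) (\<lambda>c. vf_rep c Y)"

definition X2 ::
  "('k::dense_unit_ring \<Rightarrow> 'v::{topological_ab_group_add,t2_space} \<Rightarrow> 'v) \<Rightarrow> ('m, 'v) mfd \<Rightarrow>
    ('m \<Rightarrow> ('m, 'v) ttvec) monoid" where
  "X2 s M =
     \<lparr>carrier = sections2 s M,
      mult = (\<lambda>X Y. section2_of s M
        (\<lambda>c x. comp1 s M c X x + comp1 s M c Y x)
        (\<lambda>c x. comp2 s M c X x + comp2 s M c Y x)
        (\<lambda>c x. comp12 s M c X x + comp12 s M c Y x
           + diff_at s s (chart_img c) (comp1 s M c X) x (comp2 s M c Y x)
           + diff_at s s (chart_img c) (comp2 s M c X) x (comp1 s M c Y x))),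
      one = section2_of s M (\<lambda>c x. 0) (\<lambda>c x. 0) (\<lambda>c x. 0)\<rparr>"

definition tilde ::
  "('k::dense_unit_ring \<Rightarrow> 'v::{topological_ab_group_add,t2_space} \<Rightarrow> 'v) \<Rightarrow> ('m, 'v) mfd \<Rightarrow>
    ('m \<Rightarrow> ('m, 'v) ttvec) \<Rightarrow> (('m, 'v) ttvec \<Rightarrow> ('m, 'v) ttvec)" where
  "tilde s M X = (THE F. F \<in> carrier (Diff (ttscale s) (TTM s M)) \<and>
     (\<forall>c\<in>atlas M. \<forall>u\<in>fst (tt_chart s M c). F u \<in> fst (tt_chart s M c) \<and>
        (case snd (tt_chart s M c) u of ((x, v\<^sub>1), (v\<^sub>2, v\<^sub>1\<^sub>2)) \<Rightarrow>
           snd (tt_chart s M c) (F u) =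
             ((x, v\<^sub>1 + comp1 s M c X x),
              (v\<^sub>2 + comp2 s M c X x,
               v\<^sub>1\<^sub>2 + comp12 s M c X x
                 + diff_at s s (chart_img c) (comp1 s M c X) x v\<^sub>2
                 + diff_at s s (chart_img c) (comp2 s M c X) x v\<^sub>1)))))"

definition group_commutator :: "('a, 'b) monoid_scheme \<Rightarrow> 'a \<Rightarrow> 'a \<Rightarrow> 'a" where
  "group_commutator G g h = g \<otimes>\<^bsub>G\<^esub> h \<otimes>\<^bsub>G\<^esub> inv\<^bsub>G\<^esub> g \<otimes>\<^bsub>G\<^esub> inv\<^bsub>G\<^esub> h"

end

theory Submission
  imports Defs
begin

text \<open>
  In the chart of the second tangent bundle induced by a chart of \<open>M\<close>, the diffeomorphism of a section
  with components \<open>A\<close>, \<open>B\<close>, \<open>C\<close> sends \<open>(v\<^sub>1, v\<^sub>2, v\<^sub>1\<^sub>2)\<close> over \<open>x\<close> to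
  \<open>(v\<^sub>1 + A, v\<^sub>2 + B, v\<^sub>1\<^sub>2 + C + dA(v\<^sub>2) + dB(v\<^sub>1))\<close>. So \<open>\<epsilon>\<^sub>1 X\<close> translates \<open>v\<^sub>1\<close> by \<open>X\<close> and adds \<open>dX(v\<^sub>2)\<close> to
  \<open>v\<^sub>1\<^sub>2\<close>, and \<open>\<epsilon>\<^sub>2 Y\<close> translates \<open>v\<^sub>2\<close> by \<open>Y\<close> and adds \<open>dY(v\<^sub>1)\<close>. In the commutator the translations
  cancel, and what remains in \<open>v\<^sub>1\<^sub>2\<close> is \<open>dX(Y) - dY(X)\<close>, because each shear is undone at a point where
  the other coordinate has been translated (\<open>commutators\<close>). This proves the identity between
  diffeomorphisms. The map \<open>tilde\<close> is an injective homomorphism (\<open>tilde_mult\<close>, \<open>tilde_inject\<close>), so the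
  identity between sections follows.

  This calculation presupposes that the objects given by chart formulas exist: the Lie bracket, the
  product of sections, the diffeomorphism of a section. They do because the formulas are compatible with
  changes of charts. Let \<open>\<phi>\<close> be such a change. If local representatives satisfy \<open>A'(\<phi> x) = d\<phi>(x)A(x)\<close>,
  then \<open>dA'(\<phi> x)(d\<phi>(x)w) = d\<^sup>2\<phi>(x)(A(x), w) + d\<phi>(x)(dA(x)w)\<close> (\<open>D_transition\<close>). The second-order term is
  exactly what the transition maps of the second tangent bundle contain (\<open>tt_transition\<close>), and it drops
  out of the bracket; both rest on the symmetry of the second differential (\<open>diff2_at_symmetric\<close>). Over
  a topological ring the symmetry, like the linearity of differentials, is proved for difference quotients
  at unit increments, where one may divide, and extended to \<open>0\<close> by density of the units.

  The smoothness of all these maps comes from two facts: composites of smooth maps are smooth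
  (\<open>Ck_tower_compose\<close>), and the differential \<open>(x, v) \<mapsto> df(x)v\<close> of a smooth map is smooth
  (\<open>smooth_on_diff_at\<close>). The manifold structure of the second tangent bundle is obtained by applying
  \<open>smooth_manifold_tangent_bundle\<close> twice.
\<close>

section \<open>Smooth maps between the levels of the tower\<close>

abbreviation lev :: "nat \<Rightarrow> ('v::topological_space, 'k::topological_space) tower set" where
  "lev n \<equiv> topspace (tower_top n)"

definition tfst :: "('v, 'k) tower \<Rightarrow> ('v, 'k) tower" where "tfst z = fst (unStep z)"
definition tsnd :: "('v, 'k) tower \<Rightarrow> ('v, 'k) tower" where "tsnd z = fst (snd (unStep z))"
definition ttrd :: "('v, 'k) tower \<Rightarrow> 'k" where "ttrd z = snd (snd (unStep z))"

lemma tower_sel [simp]: "tfst (Step x v t) = x" "tsnd (Step x v t) = v" "ttrd (Step x v t) = t"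
  by (simp_all add: tfst_def tsnd_def ttrd_def)

lemma lev_0: "lev 0 = range Base"
  by (simp add: topspace_pullback_topology)

lemma Base_in_lev [simp]: "Base v \<in> lev 0"
  unfolding lev_0 by simp

lemma Base_image_subset_lev [simp]: "Base ` U \<subseteq> lev 0"
  unfolding lev_0 by auto

lemma Base_unBase [simp]: "z \<in> lev 0 \<Longrightarrow> Base (unBase z) = z"
  unfolding lev_0 by auto

lemma lev_Suc: "lev (Suc n) = {Step x v t | x v t. x \<in> lev n \<and> v \<in> lev n}"
  by (auto simp: topspace_pullback_topology image_iff)

lemma Step_in_lev [simp]: "Step x v t \<in> lev (Suc n) \<longleftrightarrow> x \<in> lev n \<and> v \<in> lev n"
  unfolding lev_Suc by simp

lemma Step_in_dq_dom [simp]: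
  "Step x v t \<in> dq_dom s n U \<longleftrightarrow> x \<in> U \<and> v \<in> lev n \<and> tower_add x (tower_scale s t v) \<in> U"
  by (simp add: dq_dom_def)

lemma dq_domE:
  assumes "z \<in> dq_dom s n U"
  obtains x v t where "z = Step x v t" "x \<in> U" "v \<in> lev n" "tower_add x (tower_scale s t v) \<in> U"
  using assms by (auto simp: dq_dom_def)

lemma dq_dom_subset_lev: "U \<subseteq> lev n \<Longrightarrow> dq_dom s n U \<subseteq> lev (Suc n)"
  by (auto elim!: dq_domE simp del: tower_top.simps)

declare tower_top.simps [simp del]

lemma continuous_map_Base:
  "continuous_map X euclidean f \<Longrightarrow> continuous_map X (tower_top 0) (\<lambda>p. Base (f p))"
  by (auto simp: tower_top.simps o_def intro!: continuous_map_pullback')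

lemma continuous_map_unBase: "continuous_map (tower_top 0) euclidean unBase"
  using continuous_map_pullback[OF continuous_map_id, of _ unBase euclidean]
  by (simp add: tower_top.simps)

lemma continuous_map_Step:
  assumes "continuous_map X (tower_top n) a" "continuous_map X (tower_top n) b"
    and "continuous_map X euclidean c"
  shows "continuous_map X (tower_top (Suc n)) (\<lambda>p. Step (a p) (b p) (c p))"
  using assms
  by (auto simp: tower_top.simps o_def image_iff intro!: continuous_map_pullback' continuous_map_pairedI)

lemma continuous_map_unStep:
  "continuous_map (tower_top (Suc n)) (prod_topology (tower_top n) (prod_topology (tower_top n) euclidean)) unStep"
  using continuous_map_pullback[OF continuous_map_id] unfolding tower_top.simps by fastforce

lemma continuous_map_tower_sel:
  "continuous_map (tower_top (Suc n)) (tower_top n) tfst"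
  "continuous_map (tower_top (Suc n)) (tower_top n) tsnd"
  "continuous_map (tower_top (Suc n)) euclidean ttrd"
proof -
  note 1 = continuous_map_fst_of[OF continuous_map_unStep]
    continuous_map_fst_of[OF continuous_map_snd_of[OF continuous_map_unStep]]
    continuous_map_snd_of[OF continuous_map_snd_of[OF continuous_map_unStep]]
  show "continuous_map (tower_top (Suc n)) (tower_top n) tfst"
    by (rule continuous_map_eq[OF 1(1)]) (simp add: tfst_def)
  show "continuous_map (tower_top (Suc n)) (tower_top n) tsnd"
    by (rule continuous_map_eq[OF 1(2)]) (simp add: tsnd_def)
  show "continuous_map (tower_top (Suc n)) euclidean ttrd"
    by (rule continuous_map_eq[OF 1(3)]) (simp add: ttrd_def)
qed

text \<open>
  The difference quotient of a composite \<open>H \<circ> F\<close> is the difference quotient of \<open>H\<close> after the map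
  \<open>(x, v, t) \<mapsto> (F x, F\<^sup>[\<^sup>1\<^sup>] (x, v, t), t)\<close>, whose values lie one level higher. An induction that
  proves the chain rule for \<open>C\<^sup>k\<close> maps therefore has to run over maps from a level of one tower to a
  level of another. Continuity of the map is demanded at every order. For smooth maps this is
  harmless, because they and all their iterated difference quotients are continuous; in return the
  chain rule never has to derive continuity from the existence of a difference quotient.
\<close>

primrec Ck_tower ::
  "nat \<Rightarrow> ('k::dense_unit_ring \<Rightarrow> 'v::{topological_ab_group_add,t2_space} \<Rightarrow> 'v) \<Rightarrow>
    ('k \<Rightarrow> 'w::{topological_ab_group_add,t2_space} \<Rightarrow> 'w) \<Rightarrow> nat \<Rightarrow>
    ('v, 'k) tower set \<Rightarrow> nat \<Rightarrow> (('v, 'k) tower \<Rightarrow> ('w, 'k) tower) \<Rightarrow> bool" where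
  "Ck_tower 0 a b n U m F \<longleftrightarrow> continuous_map (subtopology (tower_top n) U) (tower_top m) F"
| "Ck_tower (Suc k) a b n U m F \<longleftrightarrow>
     continuous_map (subtopology (tower_top n) U) (tower_top m) F \<and>
     (\<exists>G. (\<forall>x v t. Step x v t \<in> dq_dom a n U \<longrightarrow>
             F (tower_add x (tower_scale a t v)) = tower_add (F x) (tower_scale b t (G (Step x v t)))) \<and>
          Ck_tower k a b (Suc n) (dq_dom a n U) m G)"

lemma Ck_tower_SucE:
  assumes "Ck_tower (Suc k) a b n U m F"
  obtains G where
    "\<And>x v t. Step x v t \<in> dq_dom a n U \<Longrightarrow>
      F (tower_add x (tower_scale a t v)) = tower_add (F x) (tower_scale b t (G (Step x v t)))"
    "Ck_tower k a b (Suc n) (dq_dom a n U) m G"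
  using assms unfolding Ck_tower.simps by blast

lemma Ck_tower_SucI:
  assumes "continuous_map (subtopology (tower_top n) U) (tower_top m) F"
    and "\<And>x v t. Step x v t \<in> dq_dom a n U \<Longrightarrow>
      F (tower_add x (tower_scale a t v)) = tower_add (F x) (tower_scale b t (G (Step x v t)))"
    and "Ck_tower k a b (Suc n) (dq_dom a n U) m G"
  shows "Ck_tower (Suc k) a b n U m F"
  using assms unfolding Ck_tower.simps by blast

lemma Ck_tower_continuous:
  "Ck_tower k a b n U m F \<Longrightarrow> continuous_map (subtopology (tower_top n) U) (tower_top m) F"
  by (cases k) auto

lemma Ck_tower_into_lev:
  "Ck_tower k a b n U m F \<Longrightarrow> U \<subseteq> lev n \<Longrightarrow> x \<in> U \<Longrightarrow> F x \<in> lev m"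
  using Ck_tower_continuous[THEN continuous_map_image_subset_topspace] by fastforce

lemma Ck_tower_Suc_imp: "Ck_tower (Suc k) a b n U m F \<Longrightarrow> Ck_tower k a b n U m F"
proof (induction k arbitrary: n U F)
  case 0
  then show ?case
    using Ck_tower_continuous by simp
next
  case (Suc k)
  from Suc.prems obtain G where G: "\<And>x v t. Step x v t \<in> dq_dom a n U \<Longrightarrow>
      F (tower_add x (tower_scale a t v)) = tower_add (F x) (tower_scale b t (G (Step x v t)))"
    "Ck_tower (Suc k) a b (Suc n) (dq_dom a n U) m G"
    by (rule Ck_tower_SucE) (rule that)
  show ?case
    by (rule Ck_tower_SucI[OF Ck_tower_continuous[OF Suc.prems] G(1) Suc.IH[OF G(2)]])
qed

text \<open>
  Linear maps enter the inductions because the coordinates \<open>x\<close>, \<open>v\<close>, \<open>t\<close> of the domain of a difference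
  quotient are linear functions on the next level, and because both operations that an induction
  performs on a linear map \<open>L\<close>, namely \<open>(x, v, t) \<mapsto> L v\<close> and \<open>(x, v, t) \<mapsto> (L x, L v, t)\<close>, give linear
  maps again.
\<close>

definition tower_linear ::
  "('k::dense_unit_ring \<Rightarrow> 'v::{topological_ab_group_add,t2_space} \<Rightarrow> 'v) \<Rightarrow>
    ('k \<Rightarrow> 'w::{topological_ab_group_add,t2_space} \<Rightarrow> 'w) \<Rightarrow> nat \<Rightarrow> nat \<Rightarrow>
    (('v, 'k) tower \<Rightarrow> ('w, 'k) tower) \<Rightarrow> bool" where
  "tower_linear a b n m L \<longleftrightarrow> continuous_map (tower_top n) (tower_top m) L \<and>
     (\<forall>x\<in>lev n. \<forall>v\<in>lev n. \<forall>t.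
        L (tower_add x (tower_scale a t v)) = tower_add (L x) (tower_scale b t (L v)))"

lemma tower_linear_into_lev: "tower_linear a b n m L \<Longrightarrow> x \<in> lev n \<Longrightarrow> L x \<in> lev m"
  unfolding tower_linear_def using continuous_map_image_subset_topspace by blast

lemma tower_linear_tfst: "tower_linear a a (Suc n) n tfst"
  and tower_linear_ttrd: "tower_linear a (*) (Suc n) 0 (\<lambda>z. Base (ttrd z))"
  unfolding tower_linear_def lev_Suc
  by (auto intro: continuous_map_tower_sel continuous_map_Base)

lemma tower_linear_tsnd: "tower_linear a b n m L \<Longrightarrow> tower_linear a b (Suc n) m (\<lambda>z. L (tsnd z))"
  unfolding tower_linear_def lev_Suc
  using continuous_map_compose[OF continuous_map_tower_sel(2), of n "tower_top m" L]
  by (auto simp: o_def)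

lemma tower_linear_Step:
  assumes "tower_linear a b n m L"
  shows "tower_linear a b (Suc n) (Suc m) (\<lambda>z. Step (L (tfst z)) (L (tsnd z)) (ttrd z))"
proof -
  have "continuous_map (tower_top (Suc n)) (tower_top m) (\<lambda>z. L (tfst z))"
    "continuous_map (tower_top (Suc n)) (tower_top m) (\<lambda>z. L (tsnd z))"
    using assms continuous_map_compose[OF continuous_map_tower_sel(1)]
      continuous_map_compose[OF continuous_map_tower_sel(2)]
    unfolding tower_linear_def o_def by blast+
  then show ?thesis
    using assms unfolding tower_linear_def lev_Suc
    by (auto intro!: continuous_map_Step continuous_map_tower_sel)
qed

text \<open>
  The difference quotient of a linear map \<open>L\<close> is \<open>(x, v, t) \<mapsto> L v\<close>, a linear map one level higher.
\<close>

lemma Ck_tower_linear: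
  "tower_linear a b n m L \<Longrightarrow> U \<subseteq> lev n \<Longrightarrow> Ck_tower k a b n U m L"
proof (induction k arbitrary: n U L)
  case 0
  then show ?case
    by (auto simp: tower_linear_def intro: continuous_map_from_subtopology)
next
  case (Suc k)
  have "Ck_tower k a b (Suc n) (dq_dom a n U) m (\<lambda>z. L (tsnd z))"
    by (intro Suc.IH tower_linear_tsnd Suc.prems dq_dom_subset_lev)
  with Suc.prems show ?case
    by (auto simp: tower_linear_def subset_iff
        intro: continuous_map_from_subtopology intro!: exI[of _ "\<lambda>z. L (tsnd z)"])
qed

text \<open>
  The difference quotient of \<open>F \<circ> L\<close> is that of \<open>F\<close> after the linear map
  \<open>(x, v, t) \<mapsto> (L x, L v, t)\<close>, so the statement reproduces itself one level higher. The chain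
  rule uses it for the projection \<open>L = (x, v, t) \<mapsto> x\<close>.
\<close>

lemma Ck_tower_precompose_linear:
  "tower_linear a b n m L \<Longrightarrow> Ck_tower k b c m W l F \<Longrightarrow> U \<subseteq> lev n \<Longrightarrow> L ` U \<subseteq> W \<Longrightarrow>
    Ck_tower k a c n U l (\<lambda>z. F (L z))"
proof (induction k arbitrary: n m U W L F)
  case 0
  then have "continuous_map (subtopology (tower_top n) U) (subtopology (tower_top m) W) L"
    by (auto simp: tower_linear_def continuous_map_in_subtopology intro: continuous_map_from_subtopology)
  then show ?case
    using continuous_map_compose[of _ _ L _ F] 0 by (simp add: o_def)
next
  case (Suc k)
  have "continuous_map (subtopology (tower_top n) U) (subtopology (tower_top m) W) L"
    using Suc.prems
    by (auto simp: tower_linear_def continuous_map_in_subtopology intro: continuous_map_from_subtopology)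
  then have cont: "continuous_map (subtopology (tower_top n) U) (tower_top l) (\<lambda>z. F (L z))"
    using continuous_map_compose[of _ _ L _ F] Suc.prems(2) by (simp add: o_def)
  obtain G where G: "\<And>x v t. Step x v t \<in> dq_dom b m W \<Longrightarrow>
      F (tower_add x (tower_scale b t v)) = tower_add (F x) (tower_scale c t (G (Step x v t)))"
    and G': "Ck_tower k b c (Suc m) (dq_dom b m W) l G"
    using Suc.prems(2) by auto
  let ?L = "\<lambda>z. Step (L (tfst z)) (L (tsnd z)) (ttrd z)"
  have L: "L (tower_add x (tower_scale a t v)) = tower_add (L x) (tower_scale b t (L v))"
    if "x \<in> U" "v \<in> lev n" for x v t
    using Suc.prems(1,3) that by (auto simp: tower_linear_def)
  have img: "?L z \<in> dq_dom b m W" if "z \<in> dq_dom a n U" for z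
    using that
  proof (cases rule: dq_domE)
    case (1 x v t)
    then show ?thesis
      using Suc.prems(4) tower_linear_into_lev[OF Suc.prems(1)] L[of x v t] by force
  qed
  have "Ck_tower k a c (Suc n) (dq_dom a n U) l (\<lambda>z. G (?L z))"
    using img by (intro Suc.IH[OF tower_linear_Step[OF Suc.prems(1)] G']
        dq_dom_subset_lev[OF Suc.prems(3)] image_subsetI)
  moreover have "F (L (tower_add x (tower_scale a t v)))
      = tower_add (F (L x)) (tower_scale c t (G (?L (Step x v t))))"
    if "Step x v t \<in> dq_dom a n U" for x v t
    using img[OF that] G[of "L x" "L v" t] L[of x v t] that by simp
  ultimately show ?case
    using cont by (auto intro!: exI[of _ "\<lambda>z. G (?L z)"])
qed

lemma Ck_tower_Step:
  "Ck_tower k a b n U m A \<Longrightarrow> Ck_tower k a b n U m B \<Longrightarrow> Ck_tower k a (*) n U 0 C \<Longrightarrow> U \<subseteq> lev n \<Longrightarrow>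
    Ck_tower k a b n U (Suc m) (\<lambda>z. Step (A z) (B z) (unBase (C z)))"
proof (induction k arbitrary: n U A B C)
  case 0
  then show ?case
    using continuous_map_compose[OF _ continuous_map_unBase, of _ C]
    by (auto simp: o_def intro!: continuous_map_Step)
next
  case (Suc k)
  have cont: "continuous_map (subtopology (tower_top n) U) (tower_top (Suc m))
      (\<lambda>z. Step (A z) (B z) (unBase (C z)))"
    using continuous_map_compose[OF _ continuous_map_unBase, of _ C] Suc.prems
    by (auto simp: o_def intro!: continuous_map_Step)
  obtain A' where
    A: "\<And>x v t. Step x v t \<in> dq_dom a n U \<Longrightarrow>
      A (tower_add x (tower_scale a t v)) = tower_add (A x) (tower_scale b t (A' (Step x v t)))"
      "Ck_tower k a b (Suc n) (dq_dom a n U) m A'"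
    using Suc.prems(1) by (rule Ck_tower_SucE) (rule that)
  obtain B' where
    B: "\<And>x v t. Step x v t \<in> dq_dom a n U \<Longrightarrow>
      B (tower_add x (tower_scale a t v)) = tower_add (B x) (tower_scale b t (B' (Step x v t)))"
      "Ck_tower k a b (Suc n) (dq_dom a n U) m B'"
    using Suc.prems(2) by (rule Ck_tower_SucE) (rule that)
  obtain C' where
    C: "\<And>x v t. Step x v t \<in> dq_dom a n U \<Longrightarrow>
      C (tower_add x (tower_scale a t v)) = tower_add (C x) (tower_scale (*) t (C' (Step x v t)))"
      "Ck_tower k a (*) (Suc n) (dq_dom a n U) 0 C'"
    using Suc.prems(3) by (rule Ck_tower_SucE) (rule that)
  define G where "G z = Step (A' z) (B' z) (unBase (C' z))" for z
  have dom: "dq_dom a n U \<subseteq> lev (Suc n)"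
    by (rule dq_dom_subset_lev[OF Suc.prems(4)])
  have "unBase (C (tower_add x (tower_scale a t v))) = unBase (C x) + t * unBase (C' (Step x v t))"
    if "Step x v t \<in> dq_dom a n U" for x v t
  proof -
    have "C x \<in> lev 0" "C' (Step x v t) \<in> lev 0"
      using Ck_tower_into_lev[OF Suc.prems(3,4), of x] Ck_tower_into_lev[OF C(2) dom that] that by auto
    then show ?thesis
      unfolding C(1)[OF that] lev_0 by auto
  qed
  then have "Step (A (tower_add x (tower_scale a t v))) (B (tower_add x (tower_scale a t v)))
        (unBase (C (tower_add x (tower_scale a t v))))
      = tower_add (Step (A x) (B x) (unBase (C x))) (tower_scale b t (G (Step x v t)))"
    if "Step x v t \<in> dq_dom a n U" for x v t
    using A(1)[OF that] B(1)[OF that] that by (simp add: G_def)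
  moreover have "Ck_tower k a b (Suc n) (dq_dom a n U) (Suc m) G"
    unfolding G_def by (rule Suc.IH[OF A(2) B(2) C(2) dom])
  ultimately show ?case
    by (rule Ck_tower_SucI[OF cont])
qed

text \<open>
  The chain rule. One order is spent on \<open>F\<close> when it is composed with the projection to \<open>x\<close>, and the
  induction hypothesis applies to \<open>T = (F \<circ> x, F\<^sup>[\<^sup>1\<^sup>], t)\<close> and \<open>H\<^sup>[\<^sup>1\<^sup>]\<close>. That \<open>T\<close> maps into the domain of
  \<open>H\<^sup>[\<^sup>1\<^sup>]\<close> is the defining equation of \<open>F\<^sup>[\<^sup>1\<^sup>]\<close> itself.
\<close>

lemma Ck_tower_compose:
  "Ck_tower k a b n U m F \<Longrightarrow> Ck_tower k b c m W l H \<Longrightarrow> U \<subseteq> lev n \<Longrightarrow> W \<subseteq> lev m \<Longrightarrow> F ` U \<subseteq> W \<Longrightarrow>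
    Ck_tower k a c n U l (\<lambda>z. H (F z))"
proof (induction k arbitrary: n m U W F H)
  case 0
  then have "continuous_map (subtopology (tower_top n) U) (subtopology (tower_top m) W) F"
    by (auto simp: continuous_map_in_subtopology)
  then show ?case
    using continuous_map_compose[of _ _ F _ H] 0 by (simp add: o_def)
next
  case (Suc k)
  have "continuous_map (subtopology (tower_top n) U) (subtopology (tower_top m) W) F"
    using Suc.prems by (auto simp: continuous_map_in_subtopology)
  then have cont: "continuous_map (subtopology (tower_top n) U) (tower_top l) (\<lambda>z. H (F z))"
    using continuous_map_compose[of _ _ F _ H] Suc.prems(2) by (simp add: o_def)
  obtain F1 where F1: "\<And>x v t. Step x v t \<in> dq_dom a n U \<Longrightarrow>
      F (tower_add x (tower_scale a t v)) = tower_add (F x) (tower_scale b t (F1 (Step x v t)))"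
    "Ck_tower k a b (Suc n) (dq_dom a n U) m F1"
    using Suc.prems(1) by auto
  obtain H1 where H1: "\<And>y w t. Step y w t \<in> dq_dom b m W \<Longrightarrow>
      H (tower_add y (tower_scale b t w)) = tower_add (H y) (tower_scale c t (H1 (Step y w t)))"
    "Ck_tower k b c (Suc m) (dq_dom b m W) l H1"
    using Suc.prems(2) by auto
  have dom: "dq_dom a n U \<subseteq> lev (Suc n)" "dq_dom b m W \<subseteq> lev (Suc m)"
    by (rule dq_dom_subset_lev[OF Suc.prems(3)] dq_dom_subset_lev[OF Suc.prems(4)])+
  define T where "T z = Step (F (tfst z)) (F1 z) (ttrd z)" for z
  have fst_U: "tfst ` dq_dom a n U \<subseteq> U"
    by (auto elim!: dq_domE)
  have "Ck_tower k a b (Suc n) (dq_dom a n U) m (\<lambda>z. F (tfst z))"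
    by (rule Ck_tower_precompose_linear
        [OF tower_linear_tfst Ck_tower_Suc_imp[OF Suc.prems(1)] dom(1) fst_U])
  moreover have "Ck_tower k a (*) (Suc n) (dq_dom a n U) 0 (\<lambda>z. Base (ttrd z))"
    by (rule Ck_tower_linear[OF tower_linear_ttrd dom(1)])
  ultimately have T: "Ck_tower k a b (Suc n) (dq_dom a n U) (Suc m) T"
    using Ck_tower_Step[OF _ F1(2) _ dom(1), of "\<lambda>z. F (tfst z)" "\<lambda>z. Base (ttrd z)"]
    by (simp add: T_def[abs_def])
  have T_img: "T ` dq_dom a n U \<subseteq> dq_dom b m W"
  proof (clarify elim!: dq_domE)
    fix x v t assume *: "x \<in> U" "v \<in> lev n" "tower_add x (tower_scale a t v) \<in> U"
    then have d: "Step x v t \<in> dq_dom a n U"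
      by simp
    show "T (Step x v t) \<in> dq_dom b m W"
      using Suc.prems(5) * F1(1)[OF d] Ck_tower_into_lev[OF F1(2) dom(1) d]
      by (auto simp: T_def simp flip: F1(1)[OF d])
  qed
  have "Ck_tower k a c (Suc n) (dq_dom a n U) l (\<lambda>z. H1 (T z))"
    by (rule Suc.IH[OF T H1(2) dom T_img])
  moreover have "H (F (tower_add x (tower_scale a t v)))
      = tower_add (H (F x)) (tower_scale c t (H1 (T (Step x v t))))"
    if "Step x v t \<in> dq_dom a n U" for x v t
  proof -
    have "T (Step x v t) \<in> dq_dom b m W"
      using T_img that by blast
    then show ?thesis
      unfolding F1(1)[OF that] T_def tower_sel by (rule H1(1))
  qed
  ultimately show ?case
    by (rule Ck_tower_SucI[OF cont, rotated])
qed

lemma Ck_tower_imp_Ck_on: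
  "Ck_tower k a b n U 0 F \<Longrightarrow> U \<subseteq> lev n \<Longrightarrow> Ck_on k a b n U (\<lambda>z. unBase (F z))"
proof (induction k arbitrary: n U F)
  case 0
  then show ?case
    using continuous_map_compose[OF _ continuous_map_unBase, of _ F] by (simp add: o_def)
next
  case (Suc k)
  then obtain G where G: "\<And>x v t. Step x v t \<in> dq_dom a n U \<Longrightarrow>
      F (tower_add x (tower_scale a t v)) = tower_add (F x) (tower_scale b t (G (Step x v t)))"
    "Ck_tower k a b (Suc n) (dq_dom a n U) 0 G"
    by auto
  have dom: "dq_dom a n U \<subseteq> lev (Suc n)"
    by (rule dq_dom_subset_lev[OF Suc.prems(2)])
  have "unBase (F (tower_add x (tower_scale a t v))) - unBase (F x) = b t (unBase (G (Step x v t)))"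
    if "Step x v t \<in> dq_dom a n U" for x v t
  proof -
    have "F x \<in> lev 0" "G (Step x v t) \<in> lev 0"
      using Ck_tower_into_lev[OF Suc.prems, of x] Ck_tower_into_lev[OF G(2) dom that] that by auto
    then show ?thesis
      unfolding G(1)[OF that] lev_0 by auto
  qed
  moreover have "continuous_map (subtopology (tower_top (Suc n)) (dq_dom a n U)) euclidean
      (\<lambda>z. unBase (G z))"
    using continuous_map_compose[OF Ck_tower_continuous[OF G(2)] continuous_map_unBase]
    by (simp add: o_def)
  ultimately have "is_dq a b n U (\<lambda>z. unBase (F z)) (\<lambda>z. unBase (G z))"
    unfolding is_dq_def by blast
  with Suc.IH[OF G(2) dom] show ?case
    by auto
qed

lemma Ck_on_imp_Ck_tower:
  "Ck_on k a b n U f \<Longrightarrow> continuous_map (subtopology (tower_top n) U) euclidean f \<Longrightarrow>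
    Ck_tower k a b n U 0 (\<lambda>z. Base (f z))"
proof (induction k arbitrary: n U f)
  case 0
  then show ?case
    by (simp add: continuous_map_Base)
next
  case (Suc k)
  then obtain g where g: "is_dq a b n U f g" "Ck_on k a b (Suc n) (dq_dom a n U) g"
    by auto
  have "Ck_tower k a b (Suc n) (dq_dom a n U) 0 (\<lambda>z. Base (g z))"
    by (rule Suc.IH[OF g(2)]) (use g(1) in \<open>auto simp: is_dq_def\<close>)
  moreover have "f (tower_add x (tower_scale a t v)) = f x + b t (g (Step x v t))"
    if "Step x v t \<in> dq_dom a n U" for x v t
    using g(1) that unfolding is_dq_def by (metis add.commute diff_add_cancel)
  ultimately show ?case
    using Suc.prems(2) by (auto simp: continuous_map_Base simp del: Step_in_dq_dom
        intro!: exI[of _ "\<lambda>z. Base (g z)"])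
qed

section \<open>Smooth maps between modules\<close>

lemma smooth_on_continuous_map:
  fixes a :: "'k::dense_unit_ring \<Rightarrow> 'v::{topological_ab_group_add,t2_space} \<Rightarrow> 'v"
  assumes "smooth_on a b U f"
  shows "continuous_map (subtopology (tower_top 0) (Base ` U :: ('v, 'k) tower set)) euclidean
    (f \<circ> unBase)"
proof -
  have "Ck_on 0 a b 0 (Base ` U) (f \<circ> unBase)"
    using assms unfolding smooth_on_def by blast
  then show ?thesis
    by simp
qed

lemma smooth_on_iff_tower:
  fixes a :: "'k::dense_unit_ring \<Rightarrow> 'v::{topological_ab_group_add,t2_space} \<Rightarrow> 'v"
  shows "smooth_on a b U f \<longleftrightarrow> (\<forall>k. Ck_tower k a b 0 (Base ` U) 0 (\<lambda>z. Base (f (unBase z))))"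
proof
  assume f: "smooth_on a b U f"
  then have "continuous_map (subtopology (tower_top 0) (Base ` U :: ('v, 'k) tower set)) euclidean
      (f \<circ> unBase)"
    by (rule smooth_on_continuous_map)
  with f show "\<forall>k. Ck_tower k a b 0 (Base ` U) 0 (\<lambda>z. Base (f (unBase z)))"
    using Ck_on_imp_Ck_tower[of _ a b 0 "Base ` U" "f \<circ> unBase"] by (auto simp: smooth_on_def)
next
  assume "\<forall>k. Ck_tower k a b 0 (Base ` U) 0 (\<lambda>z. Base (f (unBase z)))"
  then show "smooth_on a b U f"
    using Ck_tower_imp_Ck_on[of _ a b 0 "Base ` U" "\<lambda>z. Base (f (unBase z))"]
    by (auto simp: smooth_on_def o_def)
qed

lemma smooth_on_compose:
  fixes b :: "'k::dense_unit_ring \<Rightarrow> 'v::{topological_ab_group_add,t2_space} \<Rightarrow> 'v"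
  assumes "smooth_on a b U f" "smooth_on b c W g" "f ` U \<subseteq> W"
  shows "smooth_on a c U (\<lambda>x. g (f x))"
proof -
  have "Ck_tower k a c 0 (Base ` U) 0 (\<lambda>z. Base (g (unBase (Base (f (unBase z)) :: ('v, 'k) tower))))" for k
    by (rule Ck_tower_compose[where m = 0 and W = "Base ` W" and F = "\<lambda>z. Base (f (unBase z))"
          and H = "\<lambda>z. Base (g (unBase z))"])
      (use assms in \<open>auto simp: smooth_on_iff_tower\<close>)
  then show ?thesis
    by (simp add: smooth_on_iff_tower)
qed

lemma smooth_on_continuous:
  assumes "smooth_on a b U f"
  shows "continuous_on U f"
proof -
  note 1 = smooth_on_continuous_map[OF assms]
  have "continuous_map (top_of_set U) (subtopology (tower_top 0) (Base ` U)) Base"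
    using continuous_map_Base[of "top_of_set U" "\<lambda>x. x"]
    by (auto simp: continuous_map_in_subtopology)
  from continuous_map_compose[OF this 1] show ?thesis
    by (simp add: o_def)
qed

lemma Ck_on_subset:
  "Ck_on k a b n U f \<Longrightarrow> U' \<subseteq> U \<Longrightarrow> Ck_on k a b n U' f"
proof (induction k arbitrary: n U U' f)
  case 0
  then show ?case
    by (auto intro: continuous_map_from_subtopology_mono)
next
  case (Suc k)
  then obtain g where g: "is_dq a b n U f g" "Ck_on k a b (Suc n) (dq_dom a n U) g"
    by auto
  have sub: "dq_dom a n U' \<subseteq> dq_dom a n U"
    using Suc.prems(2) by (auto elim!: dq_domE)
  then have "is_dq a b n U' f g"
    using g(1) unfolding is_dq_def by (blast intro: continuous_map_from_subtopology_mono)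
  with Suc.IH[OF g(2) sub] show ?case
    by auto
qed

lemma smooth_on_subset: "smooth_on a b U f \<Longrightarrow> U' \<subseteq> U \<Longrightarrow> smooth_on a b U' f"
  unfolding smooth_on_def by (blast intro: Ck_on_subset)

lemma Ck_on_cong:
  assumes "\<And>z. z \<in> U \<Longrightarrow> f z = f' z"
  shows "Ck_on k a b n U f \<longleftrightarrow> Ck_on k a b n U f'"
proof -
  have "is_dq a b n U f g \<longleftrightarrow> is_dq a b n U f' g" for g
    using assms by (auto simp: is_dq_def)
  moreover have "continuous_map (subtopology (tower_top n) U) euclidean f
      \<longleftrightarrow> continuous_map (subtopology (tower_top n) U) euclidean f'"
    by (intro iffI; erule continuous_map_eq) (use assms in auto)
  ultimately show ?thesis
    by (cases k) auto
qed

lemma smooth_on_cong: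
  "(\<And>x. x \<in> U \<Longrightarrow> f x = f' x) \<Longrightarrow> smooth_on a b U f \<longleftrightarrow> smooth_on a b U f'"
  unfolding smooth_on_def by (intro all_cong1 Ck_on_cong) auto

lemma smooth_on_linear:
  assumes "continuous_on UNIV L" "\<And>x v t. L (x + a t v) = L x + b t (L v)"
  shows "smooth_on a b U L"
proof -
  have "continuous_map (tower_top 0) (tower_top 0) (\<lambda>z. Base (L (unBase z)))"
    using continuous_map_compose[OF continuous_map_unBase, of euclidean L] assms(1)
    by (auto simp: o_def intro: continuous_map_Base)
  then have "tower_linear a b 0 0 (\<lambda>z. Base (L (unBase z)))"
    using assms(2) by (auto simp: tower_linear_def lev_0)
  then show ?thesis
    by (auto simp: smooth_on_iff_tower intro!: Ck_tower_linear)
qed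

lemma Ck_on_Pair:
  "Ck_on k a b n U f \<Longrightarrow> Ck_on k a b n U g \<Longrightarrow> Ck_on k a (pscale b) n U (\<lambda>z. (f z, g z))"
proof (induction k arbitrary: n U f g)
  case 0
  then show ?case
    using continuous_map_pairedI[of _ euclidean f euclidean g] by simp
next
  case (Suc k)
  then obtain f1 g1 where 1: "is_dq a b n U f f1" "Ck_on k a b (Suc n) (dq_dom a n U) f1"
    "is_dq a b n U g g1" "Ck_on k a b (Suc n) (dq_dom a n U) g1"
    by auto
  then have "is_dq a (pscale b) n U (\<lambda>z. (f z, g z)) (\<lambda>z. (f1 z, g1 z))"
    using continuous_map_pairedI[of _ euclidean f1 euclidean g1]
    by (auto simp: is_dq_def pscale_def)
  with Suc.IH[OF 1(2,4)] show ?case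
    by auto
qed

lemma smooth_on_Pair:
  "smooth_on a b U f \<Longrightarrow> smooth_on a b U g \<Longrightarrow> smooth_on a (pscale b) U (\<lambda>x. (f x, g x))"
  unfolding smooth_on_def o_def by (auto intro!: Ck_on_Pair)

lemma smooth_on_fst: "smooth_on (pscale s) s U fst"
  and smooth_on_snd: "smooth_on (pscale s) s U snd"
  using smooth_on_linear[of fst "pscale s" s] smooth_on_linear[of snd "pscale s" s]
  by (auto simp: pscale_def continuous_on_fst continuous_on_snd continuous_on_id
      split: prod.split intro: smooth_on_subset[of _ _ UNIV])

lemma smooth_on_fst_compose: "smooth_on a (pscale b) U f \<Longrightarrow> smooth_on a b U (\<lambda>x. fst (f x))"
  and smooth_on_snd_compose: "smooth_on a (pscale b) U f \<Longrightarrow> smooth_on a b U (\<lambda>x. snd (f x))"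
  using smooth_on_compose[OF _ smooth_on_fst[of b UNIV]] smooth_on_compose[OF _ smooth_on_snd[of b UNIV]]
  by blast+

lemma smooth_on_id: "smooth_on a a U (\<lambda>x. x)"
  by (rule smooth_on_subset[OF smooth_on_linear[OF continuous_on_id]]) auto

lemma smooth_on_add:
  assumes "topological_module b" "smooth_on a b U f" "smooth_on a b U g"
  shows "smooth_on a b U (\<lambda>x. f x + g x)"
proof -
  interpret topological_module b
    by fact
  have "smooth_on (pscale b) b UNIV (\<lambda>p. fst p + snd p)"
    by (rule smooth_on_linear, intro continuous_on_add continuous_on_fst continuous_on_snd continuous_on_id)
      (auto simp: pscale_def scale_right_distrib algebra_simps split: prod.split)
  from smooth_on_compose[OF smooth_on_Pair[OF assms(2,3)] this] show ?thesis
    by simp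
qed

lemma smooth_on_uminus:
  assumes "topological_module b" "smooth_on a b U f"
  shows "smooth_on a b U (\<lambda>x. - f x)"
proof -
  interpret topological_module b
    by fact
  have "smooth_on b b UNIV uminus"
    by (rule smooth_on_linear)
      (auto simp: scale_right_distrib algebra_simps intro: continuous_on_minus continuous_on_id)
  from smooth_on_compose[OF assms(2) this] show ?thesis
    by simp
qed

lemma smooth_on_diff:
  "topological_module b \<Longrightarrow> smooth_on a b U f \<Longrightarrow> smooth_on a b U g \<Longrightarrow> smooth_on a b U (\<lambda>x. f x - g x)"
  using smooth_on_add[OF _ _ smooth_on_uminus, of b a U f g] by simp

lemma smooth_on_0:
  assumes "topological_module b"
  shows "smooth_on a b U (\<lambda>x. 0)"
proof -
  interpret topological_module b
    by fact
  show ?thesis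
    by (rule smooth_on_subset[OF smooth_on_linear]) (auto intro: continuous_on_const)
qed


section \<open>Differentials\<close>

lemma (in topological_module) continuous_on_scale_compose:
  assumes "continuous_on S f" "continuous_on S g"
  shows "continuous_on S (\<lambda>x. scale (f x) (g x))"
  using continuous_on_compose2[OF continuous_on_scale continuous_on_Pair[OF assms]] by simp

lemma topological_module_pscale:
  assumes "topological_module s"
  shows "topological_module (pscale s)"
proof -
  interpret topological_module s
    by fact
  have "continuous_on UNIV (\<lambda>(t, v). pscale s t v)"
    unfolding pscale_def case_prod_beta
    by (intro continuous_on_Pair continuous_on_scale_compose continuous_on_fst continuous_on_snd
        continuous_on_id)
  then show ?thesis
    by unfold_locales
      (auto simp: pscale_def scale_right_distrib scale_left_distrib)
qed

lemma (in module) unit_cancel: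
  assumes "t dvd 1" "scale t x = scale t y"
  shows "x = y"
proof -
  obtain r where "r * t = 1"
    using assms(1) by (metis dvdE mult.commute)
  then show ?thesis
    by (metis assms(2) scale_one scale_scale)
qed

lemma eq_on_open_if_eq_on_dense:
  fixes f g :: "'a::topological_space \<Rightarrow> 'b::t2_space"
  assumes "continuous_on S f" "continuous_on S g" "open S" "closure D = UNIV"
    and "\<And>x. x \<in> S \<Longrightarrow> x \<in> D \<Longrightarrow> f x = g x" and "x \<in> S"
  shows "f x = g x"
proof (rule ccontr)
  assume "f x \<noteq> g x"
  from hausdorff[OF this] obtain A B
    where AB: "open A" "open B" "f x \<in> A" "g x \<in> B" "A \<inter> B = {}"
    by auto
  have "open (f -` A \<inter> S)" "open (g -` B \<inter> S)"
    using assms(1-3) AB(1,2) by (auto simp: continuous_on_open_vimage)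
  then have "open ((f -` A \<inter> S) \<inter> (g -` B \<inter> S))"
    by blast
  moreover have "x \<in> (f -` A \<inter> S) \<inter> (g -` B \<inter> S)"
    using AB(3,4) assms(6) by blast
  ultimately obtain y where "y \<in> D" "y \<in> (f -` A \<inter> S) \<inter> (g -` B \<inter> S)"
    using assms(4) by (metis UNIV_I closure_iff_nhds_not_empty disjoint_iff inf_commute order_refl)
  with assms(5)[of y] AB(5) show False
    by auto
qed

lemma closure_units: "closure {t::'k::dense_unit_ring. t dvd 1} = UNIV"
proof -
  have "open (- closure {t::'k. t dvd 1})"
    by (intro open_Compl closed_closure)
  from dense_units[OF this] have "- closure {t::'k. t dvd 1} = {}"
    using closure_subset[of "{t::'k. t dvd 1}"] by auto
  then show ?thesis
    by (metis Compl_empty_eq double_compl)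
qed

text \<open>
  Uniqueness and linearity of differentials are obtained in this way: at a unit \<open>t\<close> the factor \<open>t\<close> cancels,
  and the units accumulate at \<open>0\<close>.
\<close>

lemma eq_at_0_if_scale_eq:
  fixes F G :: "'k::dense_unit_ring \<Rightarrow> 'w::{ab_group_add,t2_space}"
  assumes "module b" "open S" "0 \<in> S" "continuous_on S F" "continuous_on S G"
    and "\<And>t. t \<in> S \<Longrightarrow> b t (F t) = b t (G t)"
  shows "F 0 = G 0"
  by (rule eq_on_open_if_eq_on_dense[OF assms(4,5,2) closure_units _ assms(3)])
    (use assms(6) module.unit_cancel[OF assms(1)] in auto)

text \<open>
  Difference quotients at level \<open>0\<close>, freed from the constructors of the tower, so that limits for
  \<open>t \<rightarrow> 0\<close> can be taken with ordinary continuity in product spaces.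
\<close>

definition has_dq ::
  "('k::dense_unit_ring \<Rightarrow> 'v::{topological_ab_group_add,t2_space} \<Rightarrow> 'v) \<Rightarrow>
    ('k \<Rightarrow> 'w::{topological_ab_group_add,t2_space} \<Rightarrow> 'w) \<Rightarrow>
    'v set \<Rightarrow> ('v \<Rightarrow> 'w) \<Rightarrow> ('v \<Rightarrow> 'v \<Rightarrow> 'k \<Rightarrow> 'w) \<Rightarrow> bool" where
  "has_dq a b U f g \<longleftrightarrow>
     continuous_on {(x, v, t). x \<in> U \<and> x + a t v \<in> U} (\<lambda>(x, v, t). g x v t) \<and>
     (\<forall>x v t. x \<in> U \<longrightarrow> x + a t v \<in> U \<longrightarrow> f (x + a t v) = f x + b t (g x v t))"

lemma has_dq_continuous:
  assumes "has_dq a b U f g" "continuous_on S p" "continuous_on S q" "continuous_on S r"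
    and "\<And>y. y \<in> S \<Longrightarrow> p y \<in> U" "\<And>y. y \<in> S \<Longrightarrow> p y + a (r y) (q y) \<in> U"
  shows "continuous_on S (\<lambda>y. g (p y) (q y) (r y))"
proof -
  have "continuous_on S (\<lambda>y. (\<lambda>(x, v, t). g x v t) (p y, q y, r y))"
    by (rule continuous_on_compose2[of "{(x, v, t). x \<in> U \<and> x + a t v \<in> U}"])
      (use assms in \<open>auto simp: has_dq_def intro!: continuous_on_Pair\<close>)
  then show ?thesis
    by simp
qed

lemma has_dqD:
  "has_dq a b U f g \<Longrightarrow> x \<in> U \<Longrightarrow> x + a t v \<in> U \<Longrightarrow> f (x + a t v) = f x + b t (g x v t)"
  by (simp add: has_dq_def)

lemma is_dq_imp_has_dq:
  assumes "is_dq a b 0 (Base ` U) (f \<circ> unBase) G"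
  shows "has_dq a b U f (\<lambda>x v t. G (Step (Base x) (Base v) t))"
proof -
  let ?D = "{(x, v, t). x \<in> U \<and> x + a t v \<in> U}"
  have dom: "Step (Base x) (Base v) t \<in> dq_dom a 0 (Base ` U) \<longleftrightarrow> x \<in> U \<and> x + a t v \<in> U" for x v t
    by auto
  have "continuous_map (top_of_set ?D) (tower_top (Suc 0)) (\<lambda>p. Step (Base (fst p)) (Base (fst (snd p))) (snd (snd p)))"
    by (intro continuous_map_Step continuous_map_Base) (auto intro!: continuous_intros)
  then have "continuous_map (top_of_set ?D) (subtopology (tower_top (Suc 0)) (dq_dom a 0 (Base ` U)))
      (\<lambda>p. Step (Base (fst p)) (Base (fst (snd p))) (snd (snd p)))"
    using dom by (auto simp: continuous_map_in_subtopology simp del: Step_in_dq_dom)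
  from continuous_map_compose[OF this, of euclidean G] assms
  have "continuous_on ?D (\<lambda>(x, v, t). G (Step (Base x) (Base v) t))"
    by (simp add: is_dq_def o_def case_prod_beta)
  moreover have "f (x + a t v) = f x + b t (G (Step (Base x) (Base v) t))"
    if "x \<in> U" "x + a t v \<in> U" for x v t
  proof -
    have "Step (Base x) (Base v) t \<in> dq_dom a 0 (Base ` U)"
      using dom that by blast
    then have "f (x + a t v) - f x = b t (G (Step (Base x) (Base v) t))"
      using assms[unfolded is_dq_def, THEN conjunct2, rule_format, of "Base x" "Base v" t] by simp
    then show ?thesis
      by (simp add: algebra_simps)
  qed
  ultimately show ?thesis
    unfolding has_dq_def by blast
qed

lemma has_dq_imp_is_dq:
  fixes a :: "'k::dense_unit_ring \<Rightarrow> 'v::{topological_ab_group_add,t2_space} \<Rightarrow> 'v"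
  assumes "has_dq a b U f g"
  shows "is_dq a b 0 (Base ` U) (f \<circ> unBase) (\<lambda>z. g (unBase (tfst z)) (unBase (tsnd z)) (ttrd z))"
proof -
  let ?D = "{(x, v, t). x \<in> U \<and> x + a t v \<in> U}" and ?X = "tower_top (Suc 0) :: ('v, 'k) tower topology"
  have "continuous_map ?X euclidean (\<lambda>z. unBase (tfst z))" "continuous_map ?X euclidean (\<lambda>z. unBase (tsnd z))"
    using continuous_map_compose[OF continuous_map_tower_sel(1) continuous_map_unBase]
      continuous_map_compose[OF continuous_map_tower_sel(2) continuous_map_unBase] by (auto simp: o_def)
  then have "continuous_map ?X (prod_topology euclidean (prod_topology euclidean euclidean))
      (\<lambda>z. (unBase (tfst z), unBase (tsnd z), ttrd z))"
    by (intro continuous_map_pairedI continuous_map_tower_sel)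
  then have "continuous_map ?X euclidean (\<lambda>z. (unBase (tfst z), unBase (tsnd z), ttrd z))"
    by (simp add: euclidean_product_topology)
  then have "continuous_map (subtopology ?X (dq_dom a 0 (Base ` U))) (top_of_set ?D)
      (\<lambda>z. (unBase (tfst z), unBase (tsnd z), ttrd z))"
    by (auto simp: continuous_map_in_subtopology lev_0 elim!: dq_domE
        intro: continuous_map_from_subtopology)
  from continuous_map_compose[OF this, of euclidean "\<lambda>(x, v, t). g x v t"] assms
  have "continuous_map (subtopology ?X (dq_dom a 0 (Base ` U))) euclidean
      (\<lambda>z. g (unBase (tfst z)) (unBase (tsnd z)) (ttrd z))"
    by (simp add: has_dq_def o_def)
  then show ?thesis
    using assms unfolding is_dq_def by (auto simp: has_dq_def lev_0)
qed

lemma smooth_on_has_dq: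
  assumes "smooth_on a b U f"
  obtains g where "has_dq a b U f g"
proof -
  have "Ck_on (Suc 0) a b 0 (Base ` U) (f \<circ> unBase)"
    using assms unfolding smooth_on_def by blast
  then show ?thesis
    using is_dq_imp_has_dq that by (metis Ck_on.simps(2))
qed

context
  fixes a :: "'k::dense_unit_ring \<Rightarrow> 'v::{topological_ab_group_add,t2_space} \<Rightarrow> 'v"
    and b :: "'k \<Rightarrow> 'w::{topological_ab_group_add,t2_space} \<Rightarrow> 'w"
  assumes a: "topological_module a" and b: "topological_module b"
begin

interpretation A: topological_module a by (rule a)
interpretation B: topological_module b by (rule b)

lemma open_scale_vimage:
  assumes "open U"
  shows "open {t. x + a t v \<in> U}"
proof -
  have "continuous_on UNIV (\<lambda>t. x + a t v)"
    by (intro continuous_on_add continuous_on_const A.continuous_on_scale_compose continuous_on_id)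
  from open_vimage[OF assms this] show ?thesis
    by (simp add: vimage_def)
qed

text \<open>
  Two continuous difference quotients agree at \<open>t = 0\<close>, so the one chosen in the definition of the
  differential may be replaced by any other.
\<close>

lemma diff_at_eq:
  assumes "open U" "has_dq a b U f g" "x \<in> U"
  shows "diff_at a b U f x v = g x v 0"
proof -
  define G where "G = (SOME g. is_dq a b 0 (Base ` U) (f \<circ> unBase) g)"
  have "is_dq a b 0 (Base ` U) (f \<circ> unBase) G"
    unfolding G_def using has_dq_imp_is_dq[OF assms(2)]
    by (rule someI[where P = "is_dq a b 0 (Base ` U) (f \<circ> unBase)"])
  then have G: "has_dq a b U f (\<lambda>x v t. G (Step (Base x) (Base v) t))"
    by (rule is_dq_imp_has_dq)
  have "G (Step (Base x) (Base v) 0) = g x v 0"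
  proof (rule eq_at_0_if_scale_eq[OF B.module_axioms open_scale_vimage[OF assms(1), of x v],
        of "\<lambda>t. G (Step (Base x) (Base v) t)" "g x v"])
    show "continuous_on {t. x + a t v \<in> U} (\<lambda>t. G (Step (Base x) (Base v) t))"
      by (rule has_dq_continuous[OF G, of _ "\<lambda>t. x" "\<lambda>t. v" "\<lambda>t. t"])
        (auto intro: assms(3) continuous_on_id)
    show "continuous_on {t. x + a t v \<in> U} (g x v)"
      by (rule has_dq_continuous[OF assms(2), of _ "\<lambda>t. x" "\<lambda>t. v" "\<lambda>t. t"])
        (auto intro: assms(3) continuous_on_id)
  qed (use assms(3) has_dqD[OF G] has_dqD[OF assms(2)] in auto)
  then show ?thesis
    by (simp add: diff_at_def G_def)
qed

text \<open>
  Going from \<open>x\<close> to \<open>x + t (v + w)\<close> by way of \<open>x + t v\<close> splits the difference quotient in direction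
  \<open>v + w\<close> into those in direction \<open>v\<close> at \<open>x\<close> and in direction \<open>w\<close> at \<open>x + t v\<close>; let \<open>t\<close> tend to \<open>0\<close>.
\<close>

lemma diff_at_add_vec:
  assumes "open U" "smooth_on a b U f" "x \<in> U"
  shows "diff_at a b U f x (v + w) = diff_at a b U f x v + diff_at a b U f x w"
proof -
  obtain g where g: "has_dq a b U f g"
    using smooth_on_has_dq[OF assms(2)] .
  let ?S = "{t. x + a t v \<in> U} \<inter> {t. x + a t (v + w) \<in> U}"
  have "g x (v + w) 0 = g x v 0 + g (x + a 0 v) w 0"
  proof (rule eq_at_0_if_scale_eq[OF B.module_axioms, of ?S "\<lambda>t. g x (v + w) t" "\<lambda>t. g x v t + g (x + a t v) w t"])
    show "open ?S"
      by (intro open_Int open_scale_vimage assms(1))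
    show "continuous_on ?S (g x (v + w))"
      by (rule has_dq_continuous[OF g, of _ "\<lambda>t. x" "\<lambda>t. v + w" "\<lambda>t. t"])
        (auto intro: assms(3) continuous_on_id)
    have 1: "continuous_on ?S (g x v)"
      by (rule has_dq_continuous[OF g, of _ "\<lambda>t. x" "\<lambda>t. v" "\<lambda>t. t"])
        (auto intro: assms(3) continuous_on_id)
    have "continuous_on ?S (\<lambda>t. g (x + a t v) w t)"
      by (rule has_dq_continuous[OF g, of _ "\<lambda>t. x + a t v" "\<lambda>t. w" "\<lambda>t. t"])
        (auto simp: A.scale_right_distrib add.assoc
          intro!: continuous_on_add A.continuous_on_scale_compose continuous_on_id continuous_on_const)
    with 1 show "continuous_on ?S (\<lambda>t. g x v t + g (x + a t v) w t)"
      by (rule continuous_on_add)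
    fix t assume t: "t \<in> ?S"
    have "f x + b t (g x (v + w) t) = f (x + a t v + a t w)"
      using has_dqD[OF g assms(3), of t "v + w"] t by (simp add: A.scale_right_distrib add.assoc)
    also have "\<dots> = f (x + a t v) + b t (g (x + a t v) w t)"
      using t by (intro has_dqD[OF g]) (auto simp: A.scale_right_distrib add.assoc)
    also have "f (x + a t v) = f x + b t (g x v t)"
      using t by (intro has_dqD[OF g] assms(3)) auto
    finally show "b t (g x (v + w) t) = b t (g x v t + g (x + a t v) w t)"
      by (simp add: B.scale_right_distrib add.assoc)
  qed (use assms(3) in auto)
  then show ?thesis
    by (simp add: diff_at_eq[OF assms(1) g assms(3)])
qed

lemma diff_at_0_vec:
  assumes "open U" "smooth_on a b U f" "x \<in> U"
  shows "diff_at a b U f x 0 = 0"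
  using diff_at_add_vec[OF assms, of 0 0] by simp

lemma diff_at_minus_vec:
  assumes "open U" "smooth_on a b U f" "x \<in> U"
  shows "diff_at a b U f x (- v) = - diff_at a b U f x v"
  using diff_at_add_vec[OF assms, of v "- v"] diff_at_0_vec[OF assms]
  by (simp add: eq_neg_iff_add_eq_0 add.commute)

text \<open>
  The step \<open>t (r v)\<close> is also the step \<open>(t r) v\<close>.
\<close>

lemma diff_at_scale_vec:
  assumes "open U" "smooth_on a b U f" "x \<in> U"
  shows "diff_at a b U f x (a r v) = b r (diff_at a b U f x v)"
proof -
  obtain g where g: "has_dq a b U f g"
    using smooth_on_has_dq[OF assms(2)] .
  let ?S = "{t. x + a t (a r v) \<in> U}"
  have "g x (a r v) 0 = b r (g x v (0 * r))"
  proof (rule eq_at_0_if_scale_eq[OF B.module_axioms, of ?S "g x (a r v)" "\<lambda>t. b r (g x v (t * r))"])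
    show "open ?S"
      by (rule open_scale_vimage[OF assms(1)])
    show "continuous_on ?S (g x (a r v))"
      by (rule has_dq_continuous[OF g, of _ "\<lambda>t. x" "\<lambda>t. a r v" "\<lambda>t. t"])
        (auto intro: assms(3) continuous_on_id)
    have "continuous_on ?S (\<lambda>t. g x v (t * r))"
      by (rule has_dq_continuous[OF g, of _ "\<lambda>t. x" "\<lambda>t. v" "\<lambda>t. t * r"])
        (auto intro!: assms(3) continuous_intros)
    then show "continuous_on ?S (\<lambda>t. b r (g x v (t * r)))"
      by (intro B.continuous_on_scale_compose continuous_on_const)
    fix t assume "t \<in> ?S"
    then show "b t (g x (a r v) t) = b t (b r (g x v (t * r)))"
      using has_dqD[OF g assms(3), of t "a r v"] has_dqD[OF g assms(3), of "t * r" v] by simp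
  qed (use assms(3) in auto)
  then show ?thesis
    by (simp add: diff_at_eq[OF assms(1) g assms(3)])
qed

lemma diff_at_linear:
  assumes "open U" "x \<in> U" "continuous_on UNIV L" "\<And>x v t. L (x + a t v) = L x + b t (L v)"
  shows "diff_at a b U L x v = L v"
proof -
  have "has_dq a b U L (\<lambda>x v t. L v)"
    unfolding has_dq_def
    by (auto simp: assms(4) case_prod_beta intro!: continuous_on_compose2[OF assms(3)] continuous_intros)
  from diff_at_eq[OF assms(1) this assms(2)] show ?thesis .
qed

text \<open>
  A difference quotient on \<open>U\<close> is one on every open subset.
\<close>

lemma diff_at_local:
  assumes "open U" "smooth_on a b U f" "open V" "V \<subseteq> U" "x \<in> V" "\<And>y. y \<in> V \<Longrightarrow> h y = f y"
  shows "diff_at a b V h x v = diff_at a b U f x v"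
proof -
  obtain g where g: "has_dq a b U f g"
    using smooth_on_has_dq[OF assms(2)] .
  have "has_dq a b V h g"
    using g assms(4,6) unfolding has_dq_def by (force intro: continuous_on_subset)
  with g assms show ?thesis
    by (auto simp: diff_at_eq subsetD)
qed

lemma diff_at_add:
  assumes "open U" "smooth_on a b U f" "smooth_on a b U h" "x \<in> U"
  shows "diff_at a b U (\<lambda>x. f x + h x) x v = diff_at a b U f x v + diff_at a b U h x v"
proof -
  obtain g where g: "has_dq a b U f g"
    using smooth_on_has_dq[OF assms(2)] .
  obtain g' where g': "has_dq a b U h g'"
    using smooth_on_has_dq[OF assms(3)] .
  have "has_dq a b U (\<lambda>x. f x + h x) (\<lambda>x v t. g x v t + g' x v t)"
    using g g' unfolding has_dq_def
    by (auto simp: case_prod_beta B.scale_right_distrib intro!: continuous_on_add)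
  with g g' assms show ?thesis
    by (simp add: diff_at_eq)
qed

text \<open>
  The differential is the smooth map \<open>f\<^sup>[\<^sup>1\<^sup>]\<close> after the linear inclusion \<open>(x, v) \<mapsto> (x, v, 0)\<close>.
\<close>

lemma smooth_on_diff_at:
  assumes "open U" "smooth_on a b U f"
  shows "smooth_on (pscale a) b (U \<times> UNIV) (\<lambda>(x, v). diff_at a b U f x v)"
  unfolding smooth_on_def
proof
  fix k
  have "Ck_on (Suc k) a b 0 (Base ` U) (f \<circ> unBase)"
    using assms(2) unfolding smooth_on_def by blast
  then obtain g where g: "is_dq a b 0 (Base ` U) (f \<circ> unBase) g"
    "Ck_on k a b (Suc 0) (dq_dom a 0 (Base ` U)) g"
    by auto
  define j :: "('v \<times> 'v, 'k) tower \<Rightarrow> ('v, 'k) tower" where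
    "j z = Step (Base (fst (unBase z))) (Base (snd (unBase z))) 0" for z
  have "continuous_on UNIV (fst :: 'v \<times> 'v \<Rightarrow> 'v)" "continuous_on UNIV (snd :: 'v \<times> 'v \<Rightarrow> 'v)"
    by (intro continuous_on_fst continuous_on_snd continuous_on_id)+
  then have "continuous_map (tower_top 0) euclidean (\<lambda>z. fst (unBase z :: 'v \<times> 'v))"
    "continuous_map (tower_top 0) euclidean (\<lambda>z. snd (unBase z :: 'v \<times> 'v))"
    using continuous_map_compose[OF continuous_map_unBase, of euclidean fst]
      continuous_map_compose[OF continuous_map_unBase, of euclidean snd]
    by (auto simp: o_def)
  then have "continuous_map (tower_top 0) (tower_top (Suc 0)) j"
    unfolding j_def by (intro continuous_map_Step continuous_map_Base) auto
  then have "tower_linear (pscale a) a 0 (Suc 0) j"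
    by (auto simp: tower_linear_def lev_0 j_def pscale_def)
  moreover have "Ck_tower k a b (Suc 0) (dq_dom a 0 (Base ` U)) 0 (\<lambda>z. Base (g z))"
    using g by (intro Ck_on_imp_Ck_tower) (auto simp: is_dq_def)
  moreover have "j ` Base ` (U \<times> UNIV) \<subseteq> dq_dom a 0 (Base ` U)"
    by (auto simp: j_def)
  ultimately have "Ck_tower k (pscale a) b 0 (Base ` (U \<times> UNIV)) 0 (\<lambda>z. Base (g (j z)))"
    by (intro Ck_tower_precompose_linear[of _ _ _ _ j]) auto
  from Ck_tower_imp_Ck_on[OF this]
  have "Ck_on k (pscale a) b 0 (Base ` (U \<times> UNIV)) (\<lambda>z. g (j z))"
    by simp
  moreover have "((\<lambda>(x, v). diff_at a b U f x v) \<circ> unBase) z = g (j z)" if "z \<in> Base ` (U \<times> UNIV)" for z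
    using that diff_at_eq[OF assms(1) is_dq_imp_has_dq[OF g(1)]] by (auto simp: j_def)
  ultimately show "Ck_on k (pscale a) b 0 (Base ` (U \<times> UNIV)) ((\<lambda>(x, v). diff_at a b U f x v) \<circ> unBase)"
    using Ck_on_cong[of "Base ` (U \<times> UNIV)" "(\<lambda>(x, v). diff_at a b U f x v) \<circ> unBase"
        "\<lambda>z. g (j z)" k "pscale a" b 0] by simp
qed

end

lemma smooth_on_diff_at_compose:
  assumes "topological_module a" "topological_module b" "open U" "smooth_on a b U f"
    and "smooth_on c a W p" "smooth_on c a W q" "p ` W \<subseteq> U"
  shows "smooth_on c b W (\<lambda>y. diff_at a b U f (p y) (q y))"
  using smooth_on_compose[OF smooth_on_Pair[OF assms(5,6)] smooth_on_diff_at[OF assms(1-4)]] assms(7)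
  by auto

lemma diff_at_Pair:
  assumes "topological_module a" "topological_module b"
    and "open U" "smooth_on a b U f" "smooth_on a b U h" "x \<in> U"
  shows "diff_at a (pscale b) U (\<lambda>x. (f x, h x)) x v = (diff_at a b U f x v, diff_at a b U h x v)"
proof -
  obtain g where g: "has_dq a b U f g"
    using smooth_on_has_dq[OF assms(4)] .
  obtain g' where g': "has_dq a b U h g'"
    using smooth_on_has_dq[OF assms(5)] .
  have "has_dq a (pscale b) U (\<lambda>x. (f x, h x)) (\<lambda>x v t. (g x v t, g' x v t))"
    using g g' unfolding has_dq_def by (auto simp: case_prod_beta pscale_def intro!: continuous_on_Pair)
  with g g' assms topological_module_pscale[OF assms(2)] show ?thesis
    by (simp add: diff_at_eq)
qed

lemma diff_at_compose:
  assumes a: "topological_module a" and b: "topological_module b" and c: "topological_module c"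
    and U: "open U" "open W" and f: "smooth_on a b U f" and h: "smooth_on b c W h"
    and img: "f ` U \<subseteq> W" and x: "x \<in> U"
  shows "diff_at a c U (\<lambda>x. h (f x)) x v = diff_at b c W h (f x) (diff_at a b U f x v)"
proof -
  obtain g where g: "has_dq a b U f g"
    using smooth_on_has_dq[OF f] .
  obtain k where k: "has_dq b c W h k"
    using smooth_on_has_dq[OF h] .
  let ?D = "{(x, v, t). x \<in> U \<and> x + a t v \<in> U}"
  have W: "f x \<in> W" "f x + b t (g x v t) \<in> W" if "x \<in> U" "x + a t v \<in> U" for x v t
    using that img has_dqD[OF g that] by (auto simp flip: has_dqD[OF g that])
  have "continuous_on ?D (\<lambda>p. k (f (fst p)) (g (fst p) (fst (snd p)) (snd (snd p))) (snd (snd p)))"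
  proof (rule has_dq_continuous[OF k])
    show "continuous_on ?D (\<lambda>p. f (fst p))"
      by (rule continuous_on_compose2[OF smooth_on_continuous[OF f]]) (auto intro!: continuous_intros)
    show "continuous_on ?D (\<lambda>p. g (fst p) (fst (snd p)) (snd (snd p)))"
      using g by (simp add: has_dq_def case_prod_beta)
  qed (use W in \<open>auto intro!: continuous_intros\<close>)
  moreover have "h (f (x + a t v)) = h (f x) + c t (k (f x) (g x v t) t)"
    if "x \<in> U" "x + a t v \<in> U" for x v t
    using has_dqD[OF g that] has_dqD[OF k W[OF that]] by simp
  ultimately have "has_dq a c U (\<lambda>x. h (f x)) (\<lambda>x v t. k (f x) (g x v t) t)"
    by (auto simp: has_dq_def case_prod_beta)
  from diff_at_eq[OF a c U(1) this x] diff_at_eq[OF a b U(1) g x] show ?thesis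
    using diff_at_eq[OF b c U(2) k] img x by (simp add: image_subset_iff)
qed

section \<open>The second differential\<close>

text \<open>
  The derivative of \<open>y \<mapsto> df(y)v\<close> at \<open>x\<close> in direction \<open>w\<close>, expressed by the differential of
  \<open>(x, v) \<mapsto> df(x)v\<close> since the latter is what the second tangent map contains.
\<close>

definition diff2_at ::
  "('k::dense_unit_ring \<Rightarrow> 'v::{topological_ab_group_add,t2_space} \<Rightarrow> 'v) \<Rightarrow>
    ('k \<Rightarrow> 'w::{topological_ab_group_add,t2_space} \<Rightarrow> 'w) \<Rightarrow>
    'v set \<Rightarrow> ('v \<Rightarrow> 'w) \<Rightarrow> 'v \<Rightarrow> 'v \<Rightarrow> 'v \<Rightarrow> 'w" where
  "diff2_at a b U f x v w =
     diff_at (pscale a) b (U \<times> UNIV) (\<lambda>(x, v). diff_at a b U f x v) (x, v) (w, 0)"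

context
  fixes a :: "'k::dense_unit_ring \<Rightarrow> 'v::{topological_ab_group_add,t2_space} \<Rightarrow> 'v"
    and b :: "'k \<Rightarrow> 'w::{topological_ab_group_add,t2_space} \<Rightarrow> 'w"
    and U f
  assumes a: "topological_module a" and b: "topological_module b"
    and U: "open U" and f: "smooth_on a b U f"
begin

interpretation A: topological_module a by (rule a)
interpretation B: topological_module b by (rule b)

text \<open>
  In a direction \<open>(0, u)\<close> the base point stays fixed and \<open>df(x)\<close>, being linear, is its own
  differential; the direction \<open>(w, 0)\<close> gives the second differential.
\<close>

lemma diff_at_diff_at:
  assumes "x \<in> U"
  shows "diff_at (pscale a) b (U \<times> UNIV) (\<lambda>(x, v). diff_at a b U f x v) (x, v) (w, u)
    = diff2_at a b U f x v w + diff_at a b U f x u"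
proof -
  let ?P = "\<lambda>(x, v). diff_at a b U f x v"
  note pa = topological_module_pscale[OF a]
  note P = smooth_on_diff_at[OF a b U f]
  have UV: "open (U \<times> (UNIV :: 'v set))"
    using U by (simp add: open_Times)
  have xv: "(x, v) \<in> U \<times> UNIV"
    using assms by simp
  obtain g where g: "has_dq (pscale a) b (U \<times> UNIV) ?P g"
    using smooth_on_has_dq[OF P] .
  have "g (x, v) (0, u) 0 = diff_at a b U f x u"
  proof (rule eq_at_0_if_scale_eq[OF B.module_axioms open_UNIV, of "g (x, v) (0, u)"
        "\<lambda>t. diff_at a b U f x u"])
    show "continuous_on UNIV (g (x, v) (0, u))"
      by (rule has_dq_continuous[OF g, of _ "\<lambda>t. (x, v)" "\<lambda>t. (0, u)" "\<lambda>t. t"])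
        (auto simp: pscale_def assms intro!: continuous_intros)
    fix t
    have "diff_at a b U f x (v + a t u) = diff_at a b U f x v + b t (g (x, v) (0, u) t)"
      using has_dqD[OF g xv, of t "(0, u)"] assms by (simp add: pscale_def)
    then show "b t (g (x, v) (0, u) t) = b t (diff_at a b U f x u)"
      using diff_at_add_vec[OF a b U f assms, of v "a t u"] diff_at_scale_vec[OF a b U f assms, of t u]
      by simp
  qed (auto intro: continuous_on_const)
  then have "diff_at (pscale a) b (U \<times> UNIV) ?P (x, v) (0, u) = diff_at a b U f x u"
    using diff_at_eq[OF pa b UV g xv] by simp
  then show ?thesis
    using diff_at_add_vec[OF pa b UV P xv, of "(w, 0)" "(0, u)"] by (simp add: diff2_at_def)
qed

text \<open>
  Off the diagonal, the iterated difference quotient in directions \<open>v\<close>, \<open>w\<close> with unit increments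
  \<open>t\<close>, \<open>r\<close> is the second difference
  \<open>f (x + t v + r w) - f (x + t v) - f (x + r w) + f x\<close> divided by \<open>t r\<close>, which does not
  depend on the order of the two directions.  Units are dense, so the symmetry persists at
  \<open>t = r = 0\<close>.
\<close>

lemma diff2_at_symmetric:
  assumes x: "x \<in> U"
  shows "diff2_at a b U f x v w = diff2_at a b U f x w v"
proof -
  let ?P = "\<lambda>(x, v). diff_at a b U f x v"
  note pa = topological_module_pscale[OF a]
  have UV: "open (U \<times> (UNIV :: 'v set))"
    using U by (simp add: open_Times)
  have "Ck_on (Suc (Suc 0)) a b 0 (Base ` U) (f \<circ> unBase)"
    using f unfolding smooth_on_def by blast
  then obtain g1 g2 where g1: "is_dq a b 0 (Base ` U) (f \<circ> unBase) g1"
    and g2: "is_dq a b (Suc 0) (dq_dom a 0 (Base ` U)) g1 g2"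
    by auto
  note G1 = is_dq_imp_has_dq[OF g1]
  define q where "q x v t w u r = g2 (Step (Step (Base x) (Base v) t) (Step (Base w) (Base u) 0) r)"
    for x v t w u r
  have dom: "Step (Step (Base x) (Base v) t) (Step (Base w) (Base u) 0) r
      \<in> dq_dom a (Suc 0) (dq_dom a 0 (Base ` U)) \<longleftrightarrow>
      x \<in> U \<and> x + a t v \<in> U \<and> x + a r w \<in> U \<and> x + a r w + a t (v + a r u) \<in> U" for x v t w u r
    by auto
  have q_eq: "g1 (Step (Base (x + a r w)) (Base (v + a r u)) t) = g1 (Step (Base x) (Base v) t) + b r (q x v t w u r)"
    if "x \<in> U" "x + a t v \<in> U" "x + a r w \<in> U" "x + a r w + a t (v + a r u) \<in> U" for x v t w u r
  proof -
    have "g1 (tower_add (Step (Base x) (Base v) t) (tower_scale a r (Step (Base w) (Base u) 0)))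
        - g1 (Step (Base x) (Base v) t) = b r (q x v t w u r)"
      using g2 that dom[of x v t w u r] unfolding is_dq_def q_def by blast
    then show ?thesis
      by (simp add: algebra_simps)
  qed
  have q_cont: "continuous_on S (\<lambda>y. q (p1 y) (p2 y) (p3 y) (p4 y) (p5 y) (p6 y))"
    if "continuous_on S p1" "continuous_on S p2" "continuous_on S p3" "continuous_on S p4"
      "continuous_on S p5" "continuous_on S p6"
      "\<And>y. y \<in> S \<Longrightarrow> p1 y \<in> U \<and> p1 y + a (p3 y) (p2 y) \<in> U \<and> p1 y + a (p6 y) (p4 y) \<in> U \<and>
        p1 y + a (p6 y) (p4 y) + a (p3 y) (p2 y + a (p6 y) (p5 y)) \<in> U"
    for S :: "'c::topological_space set" and p1 p2 p3 p4 p5 p6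
  proof -
    let ?T = "\<lambda>y. Step (Step (Base (p1 y)) (Base (p2 y)) (p3 y)) (Step (Base (p4 y)) (Base (p5 y)) 0) (p6 y)"
    have "continuous_map (top_of_set S) (tower_top (Suc (Suc 0))) ?T"
      using that by (intro continuous_map_Step continuous_map_Base) auto
    then have "continuous_map (top_of_set S)
        (subtopology (tower_top (Suc (Suc 0))) (dq_dom a (Suc 0) (dq_dom a 0 (Base ` U)))) ?T"
      using that(7) dom by (auto simp: continuous_map_in_subtopology simp del: Step_in_dq_dom)
    from continuous_map_compose[OF this, of euclidean g2] g2 show ?thesis
      by (simp add: is_dq_def o_def q_def)
  qed
  have "has_dq (pscale a) b (U \<times> UNIV) ?P (\<lambda>p d r. q (fst p) (snd p) 0 (fst d) (snd d) r)"
  proof -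
    have "continuous_on {(p, d, t). p \<in> U \<times> UNIV \<and> p + pscale a t d \<in> U \<times> UNIV}
        (\<lambda>y. q (fst (fst y)) (snd (fst y)) 0 (fst (fst (snd y))) (snd (fst (snd y))) (snd (snd y)))"
      by (rule q_cont) (auto simp: pscale_def intro!: continuous_intros)
    then show ?thesis
      using q_eq[of _ 0] by (auto simp: has_dq_def case_prod_beta pscale_def diff_at_eq[OF a b U G1])
  qed
  from diff_at_eq[OF pa b UV this]
  have diff2: "diff2_at a b U f x v w = q x v 0 w 0 0" for v w
    using x by (simp add: diff2_at_def)
  let ?S = "(\<lambda>p. x + a (fst p) v) -` U \<inter> (\<lambda>p. x + a (snd p) w) -` U
    \<inter> (\<lambda>p. x + a (fst p) v + a (snd p) w) -` U"
  have "(\<lambda>p. q x v (fst p) w 0 (snd p)) (0, 0) = (\<lambda>p. q x w (snd p) v 0 (fst p)) (0, 0)"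
  proof (rule eq_on_open_if_eq_on_dense[of ?S _ _ "{t. t dvd 1} \<times> {t. t dvd 1}"])
    show "continuous_on ?S (\<lambda>p. q x v (fst p) w 0 (snd p))" "continuous_on ?S (\<lambda>p. q x w (snd p) v 0 (fst p))"
      by (rule q_cont; auto simp: x add_ac intro!: continuous_intros)+
    show "open ?S"
      by (intro open_Int open_vimage U continuous_on_add continuous_on_const A.continuous_on_scale_compose
          continuous_on_fst continuous_on_snd continuous_on_id)
    show "closure ({t::'k. t dvd 1} \<times> {t::'k. t dvd 1}) = UNIV"
      by (simp add: closure_Times closure_units)
    show "q x v (fst p) w 0 (snd p) = q x w (snd p) v 0 (fst p)"
      if S: "p \<in> ?S" and D: "p \<in> {t. t dvd 1} \<times> {t. t dvd 1}" for p
    proof -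
      obtain t r where p: "p = (t, r)" "t dvd 1" "r dvd 1"
        using D by auto
      have U': "x + a t v \<in> U" "x + a r w \<in> U" "x + a r w + a t v \<in> U" "x + a t v + a r w \<in> U"
        using S by (auto simp: p add_ac)
      let ?d = "f (x + a t v + a r w) - f (x + a t v) - f (x + a r w) + f x"
      have "b t (b r (q x v t w 0 r)) = ?d"
        using q_eq[of x t v r w 0] has_dqD[OF G1, of "x + a r w" t v] has_dqD[OF G1 x, of t v] U' x
        by (simp add: B.scale_right_distrib add_ac) 
      moreover have "b r (b t (q x w r v 0 t)) = ?d"
        using q_eq[of x r w t v 0] has_dqD[OF G1, of "x + a t v" r w] has_dqD[OF G1 x, of r w] U' x
        by (simp add: B.scale_right_distrib add_ac)
      ultimately have "b (t * r) (q x v t w 0 r) = b (t * r) (q x w r v 0 t)"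
        by (simp add: mult.commute)
      moreover have "t * r dvd 1"
        using mult_dvd_mono[OF p(2,3)] by simp
      ultimately show ?thesis
        using B.unit_cancel p(1) by simp
    qed
  qed (use x in auto)
  then show ?thesis
    by (simp add: diff2)
qed

lemma diff2_at_add_right:
  assumes "x \<in> U"
  shows "diff2_at a b U f x v (w + w') = diff2_at a b U f x v w + diff2_at a b U f x v w'"
  using diff_at_add_vec[OF topological_module_pscale[OF a] b _ smooth_on_diff_at[OF a b U f],
      of "(x, v)" "(w, 0)" "(w', 0)"] assms U
  by (simp add: diff2_at_def open_Times)

lemma diff2_at_add_left:
  assumes "x \<in> U"
  shows "diff2_at a b U f x (v + v') w = diff2_at a b U f x v w + diff2_at a b U f x v' w"
  using diff2_at_add_right[OF assms, of w v v'] by (simp add: diff2_at_symmetric[OF assms, of _ w])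

end

section \<open>Charts and transition maps\<close>

abbreviation overlap :: "('m, 'v) chart \<Rightarrow> ('m, 'v) chart \<Rightarrow> 'v set" where
  "overlap c c' \<equiv> snd c ` (fst c \<inter> fst c')"

abbreviation transition :: "('m, 'v) chart \<Rightarrow> ('m, 'v) chart \<Rightarrow> 'v \<Rightarrow> 'v" where
  "transition c c' \<equiv> snd c' \<circ> chart_inv c"

locale smooth_mfd =
  fixes s :: "'k::dense_unit_ring \<Rightarrow> 'v::{topological_ab_group_add,t2_space} \<Rightarrow> 'v"
    and M :: "('m, 'v) mfd"
  assumes scale: "topological_module s" and mfd: "smooth_manifold s M"
begin

abbreviation "TV \<equiv> tangent_vectors s M"
abbreviation "TM \<equiv> tangent_bundle s M"
abbreviation "tc \<equiv> tangent_chart s M"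

lemma topspace_eq: "topspace (mtop M) = (\<Union>c\<in>atlas M. fst c)"
  using mfd unfolding smooth_manifold_def by blast

lemma chart_at:
  assumes "p \<in> topspace (mtop M)"
  obtains c where "c \<in> atlas M" "p \<in> fst c"
  using assms topspace_eq by auto

lemma chart_subset_topspace: "c \<in> atlas M \<Longrightarrow> p \<in> fst c \<Longrightarrow> p \<in> topspace (mtop M)"
  using topspace_eq by auto

lemma chart_props:
  assumes "c \<in> atlas M"
  shows openin_chart: "openin (mtop M) (fst c)"
    and open_chart_img: "open (chart_img c)"
    and chart_homeomorphic:
      "homeomorphic_map (subtopology (mtop M) (fst c)) (top_of_set (chart_img c)) (snd c)"
  using mfd assms unfolding smooth_manifold_def by blast+

lemma topspace_subtopology_chart:
  "c \<in> atlas M \<Longrightarrow> topspace (mtop M) \<inter> fst c = fst c"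
  using topspace_eq by auto

lemma inj_on_chart: "c \<in> atlas M \<Longrightarrow> inj_on (snd c) (fst c)"
  using homeomorphic_imp_injective_map[OF chart_homeomorphic] by (simp add: topspace_subtopology_chart)

lemma chart_inv_chart [simp]: "c \<in> atlas M \<Longrightarrow> p \<in> fst c \<Longrightarrow> chart_inv c (snd c p) = p"
  by (rule inv_into_f_f[OF inj_on_chart])

lemma openin_chart_image:
  assumes "c \<in> atlas M" "openin (mtop M) S"
  shows "open (snd c ` (fst c \<inter> S))"
proof -
  have "openin (subtopology (mtop M) (fst c)) (fst c \<inter> S)"
    using assms(2) by (rule openin_subtopology_Int2)
  then have "openin (top_of_set (chart_img c)) (snd c ` (fst c \<inter> S))"
    using homeomorphic_imp_open_map[OF chart_homeomorphic[OF assms(1)]] by (simp add: open_map_def)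
  then show ?thesis
    using open_chart_img[OF assms(1)] by (simp add: openin_open_eq)
qed

lemma openin_chart_vimage:
  assumes "c \<in> atlas M" "open V"
  shows "openin (mtop M) {p \<in> fst c. snd c p \<in> V}"
proof -
  have "openin (top_of_set (chart_img c)) (chart_img c \<inter> V)"
    using assms(2) by auto
  then have "openin (subtopology (mtop M) (fst c)) {p \<in> fst c. snd c p \<in> chart_img c \<inter> V}"
    using openin_continuous_map_preimage[OF homeomorphic_imp_continuous_map[OF chart_homeomorphic[OF assms(1)]]]
    unfolding topspace_subtopology topspace_subtopology_chart[OF assms(1)] by blast
  moreover have "{p \<in> fst c. snd c p \<in> chart_img c \<inter> V} = {p \<in> fst c. snd c p \<in> V}"
    by auto
  ultimately show ?thesis
    using openin_chart[OF assms(1)] by (metis openin_trans_full)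
qed

lemma open_overlap: "c \<in> atlas M \<Longrightarrow> c' \<in> atlas M \<Longrightarrow> open (overlap c c')"
  by (rule openin_chart_image[OF _ openin_chart])

lemma overlap_subset: "overlap c c' \<subseteq> chart_img c"
  by auto

lemma transition_chart: "c \<in> atlas M \<Longrightarrow> p \<in> fst c \<Longrightarrow> transition c c' (snd c p) = snd c' p"
  by simp

lemma smooth_transition:
  "c \<in> atlas M \<Longrightarrow> c' \<in> atlas M \<Longrightarrow> smooth_on s s (overlap c c') (transition c c')"
  using mfd unfolding smooth_manifold_def by blast

definition dtrans :: "('m, 'v) chart \<Rightarrow> ('m, 'v) chart \<Rightarrow> 'v \<Rightarrow> 'v \<Rightarrow> 'v" where
  "dtrans c c' = diff_at s s (overlap c c') (transition c c')"

definition d2trans :: "('m, 'v) chart \<Rightarrow> ('m, 'v) chart \<Rightarrow> 'v \<Rightarrow> 'v \<Rightarrow> 'v \<Rightarrow> 'v" where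
  "d2trans c c' = diff2_at s s (overlap c c') (transition c c')"

lemma dtrans_add:
  "c \<in> atlas M \<Longrightarrow> c' \<in> atlas M \<Longrightarrow> x \<in> overlap c c' \<Longrightarrow>
    dtrans c c' x (v + w) = dtrans c c' x v + dtrans c c' x w"
  unfolding dtrans_def
  by (rule diff_at_add_vec[OF scale scale open_overlap smooth_transition])

lemma dtrans_0:
  "c \<in> atlas M \<Longrightarrow> c' \<in> atlas M \<Longrightarrow> x \<in> overlap c c' \<Longrightarrow> dtrans c c' x 0 = 0"
  unfolding dtrans_def
  by (rule diff_at_0_vec[OF scale scale open_overlap smooth_transition])

lemma dtrans_minus:
  "c \<in> atlas M \<Longrightarrow> c' \<in> atlas M \<Longrightarrow> x \<in> overlap c c' \<Longrightarrow> dtrans c c' x (- v) = - dtrans c c' x v"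
  unfolding dtrans_def
  by (rule diff_at_minus_vec[OF scale scale open_overlap smooth_transition])

lemma dtrans_diff:
  "c \<in> atlas M \<Longrightarrow> c' \<in> atlas M \<Longrightarrow> x \<in> overlap c c' \<Longrightarrow>
    dtrans c c' x (v - w) = dtrans c c' x v - dtrans c c' x w"
  using dtrans_add[of c c' x v "- w"] dtrans_minus[of c c' x w] by simp

lemma d2trans_symmetric:
  "c \<in> atlas M \<Longrightarrow> c' \<in> atlas M \<Longrightarrow> x \<in> overlap c c' \<Longrightarrow> d2trans c c' x v w = d2trans c c' x w v"
  unfolding d2trans_def
  by (rule diff2_at_symmetric[OF scale scale open_overlap smooth_transition])

lemma d2trans_add_left:
  "c \<in> atlas M \<Longrightarrow> c' \<in> atlas M \<Longrightarrow> x \<in> overlap c c' \<Longrightarrow>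
    d2trans c c' x (v + v') w = d2trans c c' x v w + d2trans c c' x v' w"
  unfolding d2trans_def
  by (rule diff2_at_add_left[OF scale scale open_overlap smooth_transition])

lemma d2trans_add_right:
  "c \<in> atlas M \<Longrightarrow> c' \<in> atlas M \<Longrightarrow> x \<in> overlap c c' \<Longrightarrow>
    d2trans c c' x v (w + w') = d2trans c c' x v w + d2trans c c' x v w'"
  unfolding d2trans_def
  by (rule diff2_at_add_right[OF scale scale open_overlap smooth_transition])

lemma d2trans_0:
  "c \<in> atlas M \<Longrightarrow> c' \<in> atlas M \<Longrightarrow> x \<in> overlap c c' \<Longrightarrow> d2trans c c' x 0 w = 0"
  "c \<in> atlas M \<Longrightarrow> c' \<in> atlas M \<Longrightarrow> x \<in> overlap c c' \<Longrightarrow> d2trans c c' x w 0 = 0"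
  using d2trans_add_left[of c c' x 0 0 w] d2trans_add_right[of c c' x w 0 0] by simp_all

lemma dtrans_self:
  assumes "c \<in> atlas M" "x \<in> chart_img c"
  shows "dtrans c c x v = v"
proof -
  have "diff_at s s (overlap c c) (transition c c) x v = diff_at s s UNIV (\<lambda>x. x) x v"
    by (rule diff_at_local[OF scale scale open_UNIV smooth_on_id open_overlap[OF assms(1,1)]])
      (use assms in auto)
  also have "\<dots> = v"
    by (rule diff_at_linear[OF scale scale]) (auto intro: continuous_on_id)
  finally show ?thesis
    by (simp add: dtrans_def)
qed

text \<open>
  The chain rule on the triple overlap. It makes the equivalence between pairs of a chart and a
  vector consistent, so that a tangent vector may be prescribed by its coordinates in one chart.
\<close>

lemma dtrans_cocycle:
  assumes c: "c \<in> atlas M" "c' \<in> atlas M" "c'' \<in> atlas M"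
    and p: "p \<in> fst c" "p \<in> fst c'" "p \<in> fst c''"
  shows "dtrans c c'' (snd c p) v = dtrans c' c'' (snd c' p) (dtrans c c' (snd c p) v)"
proof -
  define V where "V = snd c ` (fst c \<inter> (fst c' \<inter> fst c''))"
  define V' where "V' = snd c' ` (fst c' \<inter> (fst c \<inter> fst c''))"
  have V: "open V" "V \<subseteq> overlap c c''" "V \<subseteq> overlap c c'" "snd c p \<in> V"
    unfolding V_def using p by (auto intro!: openin_chart_image openin_chart openin_Int c)
  have V': "open V'" "V' \<subseteq> overlap c' c''" "snd c' p \<in> V'"
    unfolding V'_def using p by (auto intro!: openin_chart_image openin_chart openin_Int c)
  have img: "transition c c' ` V \<subseteq> V'"
    using c by (auto simp: V_def V'_def)
  have sm: "smooth_on s s V (transition c c')" "smooth_on s s V' (transition c' c'')"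
    by (rule smooth_on_subset[OF smooth_transition[OF c(1,2)] V(3)],
        rule smooth_on_subset[OF smooth_transition[OF c(2,3)] V'(2)])
  have "dtrans c c'' (snd c p) v = diff_at s s V (\<lambda>x. transition c' c'' (transition c c' x)) (snd c p) v"
    unfolding dtrans_def
    by (rule diff_at_local[OF scale scale open_overlap smooth_transition V(1,2,4), symmetric])
      (use c in \<open>auto simp: V_def\<close>)
  also have "\<dots> = diff_at s s V' (transition c' c'') (transition c c' (snd c p))
      (diff_at s s V (transition c c') (snd c p) v)"
    by (rule diff_at_compose[OF scale scale scale V(1) V'(1) sm img V(4)])
  also have "diff_at s s V (transition c c') (snd c p) v = dtrans c c' (snd c p) v"
    unfolding dtrans_def
    by (rule diff_at_local[OF scale scale open_overlap smooth_transition V(1,3,4)]) (use c in auto)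
  also have "diff_at s s V' (transition c' c'') (transition c c' (snd c p)) w
      = dtrans c' c'' (snd c' p) w" for w
    unfolding dtrans_def transition_chart[OF c(1) p(1)]
    by (rule diff_at_local[OF scale scale open_overlap smooth_transition V'(1,2,3)]) (use c in auto)
  finally show ?thesis .
qed

section \<open>The tangent bundle as a manifold\<close>

lemma fst_tc: "fst (tc c) = {q \<in> TV. fst q \<in> fst c}"
  and snd_tc: "snd (tc c) q = (snd c (fst q), snd q c)"
  by (simp_all add: tangent_chart_def)

lemma tangent_vector_transition:
  "q \<in> TV \<Longrightarrow> c \<in> atlas M \<Longrightarrow> c' \<in> atlas M \<Longrightarrow> fst q \<in> fst c \<Longrightarrow> fst q \<in> fst c' \<Longrightarrow>
    snd q c' = dtrans c c' (snd c (fst q)) (snd q c)"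
  unfolding tangent_vectors_def dtrans_def case_prod_beta mem_Collect_eq by blast

lemma tangent_vector_base: "q \<in> TV \<Longrightarrow> fst q \<in> topspace (mtop M)"
  unfolding tangent_vectors_def case_prod_beta mem_Collect_eq by blast

lemma tangent_vector_eqI:
  assumes "q \<in> TV" "q' \<in> TV" "fst q = fst q'" "c \<in> atlas M" "fst q \<in> fst c" "snd q c = snd q' c"
  shows "q = q'"
proof (rule prod_eqI)
  show "snd q = snd q'"
  proof (rule extensionalityI)
    show "snd q \<in> extensional {c \<in> atlas M. fst q \<in> fst c}" "snd q' \<in> extensional {c \<in> atlas M. fst q \<in> fst c}"
      using assms(1-3) unfolding tangent_vectors_def case_prod_beta mem_Collect_eq by metis+
    fix c' assume "c' \<in> {c \<in> atlas M. fst q \<in> fst c}"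
    then show "snd q c' = snd q' c'"
      using tangent_vector_transition[of q c c'] tangent_vector_transition[of q' c c'] assms by auto
  qed
qed (rule assms(3))

lemma tangent_vector_exists:
  assumes "c \<in> atlas M" "p \<in> fst c"
  obtains q where "q \<in> TV" "fst q = p" "snd q c = v"
proof
  define q where "q = (p, \<lambda>c'\<in>{c \<in> atlas M. p \<in> fst c}. dtrans c c' (snd c p) v)"
  show "q \<in> TV"
    unfolding tangent_vectors_def case_prod_beta mem_Collect_eq dtrans_def[symmetric]
  proof (intro conjI ballI impI)
    show "snd q c'' = dtrans c' c'' (snd c' (fst q)) (snd q c')"
      if "c' \<in> atlas M" "c'' \<in> atlas M" "fst q \<in> fst c'" "fst q \<in> fst c''" for c' c''
      using dtrans_cocycle[OF assms(1) that(1,2) assms(2)] that by (simp add: q_def)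
  qed (use chart_subset_topspace[OF assms] in \<open>auto simp: q_def\<close>)
  show "fst q = p" "snd q c = v"
    using assms dtrans_self by (auto simp: q_def)
qed

lemma inj_on_tc:
  assumes "c \<in> atlas M"
  shows "inj_on (snd (tc c)) (fst (tc c))"
proof (rule inj_onI)
  fix q q' assume "q \<in> fst (tc c)" "q' \<in> fst (tc c)" "snd (tc c) q = snd (tc c) q'"
  then have q: "q \<in> TV" "q' \<in> TV" "fst q \<in> fst c" "fst q' \<in> fst c"
    "snd c (fst q) = snd c (fst q')" "snd q c = snd q' c"
    by (simp_all add: fst_tc snd_tc)
  from inj_onD[OF inj_on_chart[OF assms] q(5,3,4)] show "q = q'"
    by (rule tangent_vector_eqI[OF q(1,2) _ assms q(3,6)])
qed

lemma tc_image:
  assumes "c \<in> atlas M"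
  shows "snd (tc c) ` {q \<in> TV. fst q \<in> fst c \<and> fst q \<in> S} = snd c ` (fst c \<inter> S) \<times> UNIV"
proof (intro equalityI subsetI)
  fix y :: "'v \<times> 'v" assume "y \<in> snd c ` (fst c \<inter> S) \<times> UNIV"
  then obtain p v where p: "p \<in> fst c" "p \<in> S" and y: "y = (snd c p, v)"
    by auto
  obtain q where "q \<in> TV" "fst q = p" "snd q c = v"
    using tangent_vector_exists[OF assms p(1)] .
  with p y have "y = snd (tc c) q" "q \<in> {q \<in> TV. fst q \<in> fst c \<and> fst q \<in> S}"
    by (simp_all add: snd_tc)
  then show "y \<in> snd (tc c) ` {q \<in> TV. fst q \<in> fst c \<and> fst q \<in> S}"
    by (rule image_eqI)
qed (auto simp: snd_tc)

lemma tc_chart_img: "c \<in> atlas M \<Longrightarrow> chart_img (tc c) = chart_img c \<times> UNIV"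
  using tc_image[of c UNIV] by (simp add: fst_tc)

lemma tc_overlap:
  assumes "c \<in> atlas M"
  shows "overlap (tc c) (tc c') = overlap c c' \<times> UNIV"
proof -
  have "fst (tc c) \<inter> fst (tc c') = {q \<in> TV. fst q \<in> fst c \<and> fst q \<in> fst c'}"
    by (auto simp: fst_tc)
  then show ?thesis
    using tc_image[OF assms] by simp
qed

lemma tc_transition:
  assumes "c \<in> atlas M" "c' \<in> atlas M" "x \<in> overlap c c'"
  shows "transition (tc c) (tc c') (x, v) = (transition c c' x, dtrans c c' x v)"
proof -
  obtain p where p: "p \<in> fst c" "p \<in> fst c'" "x = snd c p"
    using assms(3) by auto
  obtain q where q: "q \<in> TV" "fst q = p" "snd q c = v"
    using tangent_vector_exists[OF assms(1) p(1)] .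
  have "chart_inv (tc c) (x, v) = q"
    using inv_into_f_f[OF inj_on_tc[OF assms(1)], of q] p q by (simp add: fst_tc snd_tc)
  then show ?thesis
    using tangent_vector_transition[OF q(1) assms(1,2)] p q assms by (simp add: snd_tc)
qed

lemma smooth_tc_transition:
  assumes "c \<in> atlas M" "c' \<in> atlas M"
  shows "smooth_on (pscale s) (pscale s) (overlap c c' \<times> UNIV)
    (\<lambda>p. (transition c c' (fst p), dtrans c c' (fst p) (snd p)))"
  unfolding dtrans_def
  by (intro smooth_on_Pair smooth_on_diff_at_compose[OF scale scale open_overlap smooth_transition]
      smooth_on_compose[OF smooth_on_fst smooth_transition] smooth_on_fst smooth_on_snd assms) auto

lemma istopology_tangent_bundle:
  "istopology (\<lambda>S. S \<subseteq> TV \<and> (\<forall>c\<in>atlas M. open (snd (tc c) ` (S \<inter> fst (tc c)))))"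
proof -
  have "open (snd (tc c) ` (S \<inter> T \<inter> fst (tc c)))"
    if "c \<in> atlas M" "open (snd (tc c) ` (S \<inter> fst (tc c)))" "open (snd (tc c) ` (T \<inter> fst (tc c)))" for c S T
  proof -
    have "snd (tc c) ` (S \<inter> T \<inter> fst (tc c)) = snd (tc c) ` (S \<inter> fst (tc c)) \<inter> snd (tc c) ` (T \<inter> fst (tc c))"
      using inj_on_tc[OF that(1)] by (auto simp: inj_on_def)
    then show ?thesis
      using that by auto
  qed
  moreover have "snd (tc c) ` (\<Union>\<S> \<inter> fst (tc c)) = (\<Union>S\<in>\<S>. snd (tc c) ` (S \<inter> fst (tc c)))" for c \<S>
    by auto
  ultimately show ?thesis
    unfolding istopology_def by (auto intro!: open_UN)
qed

lemma openin_TM: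
  "openin (mtop TM) S \<longleftrightarrow> S \<subseteq> TV \<and> (\<forall>c\<in>atlas M. open (snd (tc c) ` (S \<inter> fst (tc c))))"
  unfolding tangent_bundle_def by (simp add: topology_inverse'[OF istopology_tangent_bundle])

lemma atlas_TM: "atlas TM = tc ` atlas M"
  by (simp add: tangent_bundle_def)

text \<open>
  Openness in the tangent bundle is defined by a test in every chart. For a subset of one chart
  domain the test in that chart suffices, because in any other chart the image is a preimage under a
  continuous transition map.
\<close>

lemma openin_TM_in_chart:
  assumes "c \<in> atlas M" "S \<subseteq> fst (tc c)" "open (snd (tc c) ` S)"
  shows "openin (mtop TM) S"
  unfolding openin_TM
proof (intro conjI ballI)
  show "S \<subseteq> TV"
    using assms(2) by (auto simp: fst_tc)
  fix c' assume c': "c' \<in> atlas M"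
  let ?T = "\<lambda>p. (transition c' c (fst p), dtrans c' c (fst p) (snd p))"
  have T: "transition (tc c') (tc c) y = ?T y" if "y \<in> overlap c' c \<times> UNIV" for y
    using tc_transition[OF c' assms(1)] that by auto
  have "snd (tc c') ` (S \<inter> fst (tc c')) = (overlap c' c \<times> UNIV) \<inter> ?T -` (snd (tc c) ` S)"
  proof (intro equalityI subsetI)
    fix y assume "y \<in> snd (tc c') ` (S \<inter> fst (tc c'))"
    then obtain q where q: "q \<in> S" "q \<in> fst (tc c')" "y = snd (tc c') q"
      by auto
    then have y: "y \<in> overlap c' c \<times> UNIV"
      using assms(2) tc_overlap[OF c', of c] by blast
    moreover have "transition (tc c') (tc c) y = snd (tc c) q"
      using q inv_into_f_f[OF inj_on_tc[OF c']] by simp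
    ultimately show "y \<in> (overlap c' c \<times> UNIV) \<inter> ?T -` (snd (tc c) ` S)"
      using T q(1) by auto
  next
    fix y assume y: "y \<in> (overlap c' c \<times> UNIV) \<inter> ?T -` (snd (tc c) ` S)"
    then obtain q where q: "q \<in> fst (tc c')" "q \<in> fst (tc c)" "y = snd (tc c') q"
      using tc_overlap[OF c', of c] by blast
    have "transition (tc c') (tc c) y = snd (tc c) q"
      using q inv_into_f_f[OF inj_on_tc[OF c']] by simp
    then have "snd (tc c) q \<in> snd (tc c) ` S"
      using y T by auto
    then have "q \<in> S"
      using inj_on_image_mem_iff[OF inj_on_tc[OF assms(1)] q(2) assms(2)] by simp
    then show "y \<in> snd (tc c') ` (S \<inter> fst (tc c'))"
      using q by blast
  qed
  moreover have "open ((overlap c' c \<times> UNIV) \<inter> ?T -` (snd (tc c) ` S))"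
    by (rule continuous_open_preimage[OF smooth_on_continuous[OF smooth_tc_transition[OF c' assms(1)]]])
      (use open_overlap[OF c' assms(1)] assms(3) in \<open>auto intro: open_Times\<close>)
  ultimately show "open (snd (tc c') ` (S \<inter> fst (tc c')))"
    by simp
qed

lemma topspace_TM: "topspace (mtop TM) = TV"
proof -
  have "openin (mtop TM) TV"
    unfolding openin_TM
    using tc_chart_img open_chart_img by (auto simp: fst_tc Int_def intro!: open_Times)
  then show ?thesis
    by (metis openin_TM openin_subset openin_topspace subset_antisym)
qed

text \<open>
  This holds for every manifold, hence also for the tangent bundle itself; the second use gives the
  manifold structure of the second tangent bundle.
\<close>

lemma smooth_manifold_tangent_bundle: "smooth_manifold (pscale s) TM"
  unfolding smooth_manifold_def atlas_TM ball_simps topspace_TM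
proof (intro conjI ballI)
  show "(\<Union>c\<in>tc ` atlas M. fst c) = TV"
    using topspace_eq tangent_vector_base by (fastforce simp: fst_tc)
  fix c assume c: "c \<in> atlas M"
  show op: "open (chart_img (tc c))"
    using open_chart_img[OF c] by (simp add: tc_chart_img[OF c] open_Times)
  show dom: "openin (mtop TM) (fst (tc c))"
    by (rule openin_TM_in_chart[OF c _ op]) simp
  have top: "topspace (mtop TM) \<inter> fst (tc c) = fst (tc c)"
    using openin_subset[OF dom] by auto
  show "homeomorphic_map (subtopology (mtop TM) (fst (tc c))) (top_of_set (chart_img (tc c))) (snd (tc c))"
  proof (rule bijective_open_imp_homeomorphic_map)
    show "open_map (subtopology (mtop TM) (fst (tc c))) (top_of_set (chart_img (tc c))) (snd (tc c))"
      unfolding open_map_def openin_open_subtopology[OF dom] openin_open_eq[OF op]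
      using c by (auto simp: openin_TM inf_absorb1)
    have "openin (mtop TM) {q \<in> fst (tc c). snd (tc c) q \<in> V}" if "open V" "V \<subseteq> chart_img (tc c)" for V
    proof (rule openin_TM_in_chart[OF c])
      have "snd (tc c) ` {q \<in> fst (tc c). snd (tc c) q \<in> V} = V"
        using that(2) by auto
      then show "open (snd (tc c) ` {q \<in> fst (tc c). snd (tc c) q \<in> V})"
        using that(1) by simp
    qed auto
    then show "continuous_map (subtopology (mtop TM) (fst (tc c))) (top_of_set (chart_img (tc c))) (snd (tc c))"
      unfolding continuous_map_def topspace_subtopology top openin_open_subtopology[OF dom] openin_open_eq[OF op] by auto
  qed (simp_all only: topspace_subtopology top inj_on_tc[OF c] topspace_euclidean Int_UNIV_left)
  fix c' assume c': "c' \<in> atlas M"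
  show "smooth_on (pscale s) (pscale s) (overlap (tc c) (tc c')) (transition (tc c) (tc c'))"
    unfolding tc_overlap[OF c]
    by (rule smooth_on_cong[THEN iffD1, OF _ smooth_tc_transition[OF c c']])
      (use tc_transition[OF c c'] in auto)
qed

end

section \<open>Smooth maps in charts\<close>

text \<open>
  Smoothness asks for all pairs of charts of \<open>M\<close> and \<open>N\<close>. One chart of \<open>N\<close> containing the image of each
  chart domain suffices, since the other local representatives arise by a transition map of \<open>N\<close>. Sections
  and fibre-preserving maps have such charts: those induced by the charts of the base.
\<close>

lemma smooth_mapI:
  assumes M: "smooth_mfd a M" and N: "smooth_mfd b N"
    and d: "\<And>c. c \<in> atlas M \<Longrightarrow> d c \<in> atlas N"
    and img: "\<And>c. c \<in> atlas M \<Longrightarrow> f ` fst c \<subseteq> fst (d c)"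
    and smooth: "\<And>c. c \<in> atlas M \<Longrightarrow> smooth_on a b (chart_img c) (\<lambda>x. snd (d c) (f (chart_inv c x)))"
  shows "smooth_map a M b N f"
proof -
  interpret M: smooth_mfd a M by fact
  interpret N: smooth_mfd b N by fact
  have "continuous_map (mtop M) (mtop N) f"
    unfolding continuous_map_def
  proof (intro conjI allI impI)
    show "f \<in> topspace (mtop M) \<rightarrow> topspace (mtop N)"
      using d img by (fastforce simp: M.topspace_eq N.topspace_eq)
    fix W assume W: "openin (mtop N) W"
    have "openin (mtop M) {p \<in> fst c. f p \<in> W}" if c: "c \<in> atlas M" for c
    proof -
      let ?r = "\<lambda>x. snd (d c) (f (chart_inv c x))"
      have "open (chart_img c \<inter> ?r -` (snd (d c) ` (fst (d c) \<inter> W)))"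
        by (intro continuous_open_preimage smooth_on_continuous[OF smooth] M.open_chart_img
            N.openin_chart_image W d c)
      from M.openin_chart_vimage[OF c this]
      have "openin (mtop M) {p \<in> fst c. snd (d c) (f p) \<in> snd (d c) ` (fst (d c) \<inter> W)}"
        using c by (simp cong: conj_cong)
      moreover have "snd (d c) (f p) \<in> snd (d c) ` (fst (d c) \<inter> W) \<longleftrightarrow> f p \<in> W" if "p \<in> fst c" for p
        using inj_on_image_mem_iff[OF N.inj_on_chart[OF d[OF c]], of "f p" "fst (d c) \<inter> W"] img[OF c] that
        by auto
      ultimately show ?thesis
        by (simp cong: conj_cong)
    qed
    then have "openin (mtop M) (\<Union>c\<in>atlas M. {p \<in> fst c. f p \<in> W})"
      by blast
    moreover have "(\<Union>c\<in>atlas M. {p \<in> fst c. f p \<in> W}) = {p \<in> topspace (mtop M). f p \<in> W}"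
      by (auto simp: M.topspace_eq)
    ultimately show "openin (mtop M) {p \<in> topspace (mtop M). f p \<in> W}"
      by simp
  qed
  moreover have "smooth_on a b (snd c ` (fst c \<inter> f -` fst c')) (snd c' \<circ> f \<circ> chart_inv c)"
    if c: "c \<in> atlas M" "c' \<in> atlas N" for c c'
  proof -
    let ?U = "snd c ` (fst c \<inter> f -` fst c')"
    let ?r = "\<lambda>x. snd (d c) (f (chart_inv c x))"
    have "smooth_on a b ?U (\<lambda>x. transition (d c) c' (?r x))"
    proof (rule smooth_on_compose[OF smooth_on_subset[OF smooth[OF c(1)]] N.smooth_transition[OF d[OF c(1)] c(2)]])
      show "?r ` ?U \<subseteq> overlap (d c) c'"
        using c img[OF c(1)] by auto
    qed auto
    moreover have "transition (d c) c' (?r x) = (snd c' \<circ> f \<circ> chart_inv c) x" if "x \<in> ?U" for x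
      using that c img[OF c(1)] N.chart_inv_chart[OF d[OF c(1)]] by auto
    ultimately show ?thesis
      using smooth_on_cong[of ?U "\<lambda>x. transition (d c) c' (?r x)" "snd c' \<circ> f \<circ> chart_inv c" a b] by simp
  qed
  ultimately show ?thesis
    unfolding smooth_map_def by blast
qed

lemma smooth_map_in_charts:
  assumes "smooth_map a M b N f" "c \<in> atlas M" "c' \<in> atlas N" "f ` fst c \<subseteq> fst c'"
  shows "smooth_on a b (chart_img c) (\<lambda>x. snd c' (f (chart_inv c x)))"
proof -
  have "fst c \<inter> f -` fst c' = fst c"
    using assms(4) by auto
  moreover have "smooth_on a b (snd c ` (fst c \<inter> f -` fst c')) (snd c' \<circ> f \<circ> chart_inv c)"
    using assms(1-3) unfolding smooth_map_def by blast
  ultimately show ?thesis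
    by (simp add: o_def)
qed

section \<open>The second tangent bundle\<close>

context smooth_mfd
begin

lemma smooth_mfd_TM: "smooth_mfd (pscale s) TM"
  by (rule smooth_mfd.intro[OF topological_module_pscale[OF scale] smooth_manifold_tangent_bundle])

interpretation T: smooth_mfd "pscale s" TM
  by (rule smooth_mfd_TM)

lemma smooth_mfd_TTM: "smooth_mfd (ttscale s) (TTM s M)"
  unfolding TTM_def by (rule T.smooth_mfd_TM)

interpretation TT: smooth_mfd "ttscale s" "TTM s M"
  by (rule smooth_mfd_TTM)

abbreviation "tt \<equiv> tt_chart s M"
abbreviation "TTV \<equiv> topspace (mtop (TTM s M))"

lemma TTV_eq: "TTV = T.TV"
  unfolding TTM_def by (rule T.topspace_TM)

lemma atlas_TTM: "atlas (TTM s M) = tt ` atlas M"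
  unfolding TTM_def T.atlas_TM atlas_TM image_image tt_chart_def ..

lemma tt_in_atlas [simp]: "c \<in> atlas M \<Longrightarrow> tt c \<in> atlas (TTM s M)"
  unfolding atlas_TTM by simp

lemma tc_in_atlas [simp]: "c \<in> atlas M \<Longrightarrow> tc c \<in> atlas TM"
  unfolding atlas_TM by simp

lemma fst_tt: "fst (tt c) = {u \<in> TTV. fst (fst u) \<in> fst c}"
  using T.tangent_vector_base unfolding tt_chart_def T.fst_tc fst_tc TTV_eq topspace_TM by blast

lemma fst_fst_snd_tt: "fst (fst (snd (tt c) u)) = snd c (fst (fst u))"
  by (simp add: tt_chart_def T.snd_tc snd_tc)

lemma TTV_base: "u \<in> TTV \<Longrightarrow> fst (fst u) \<in> topspace (mtop M)"
  using T.tangent_vector_base tangent_vector_base unfolding TTV_eq topspace_TM by blast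

lemma tt_chart_at:
  assumes "u \<in> TTV"
  obtains c where "c \<in> atlas M" "u \<in> fst (tt c)"
  using chart_at[OF TTV_base[OF assms]] assms that unfolding fst_tt by blast

lemma tt_chart_img: "c \<in> atlas M \<Longrightarrow> chart_img (tt c) = (chart_img c \<times> UNIV) \<times> UNIV"
  unfolding tt_chart_def using T.tc_chart_img[of "tc c"] tc_chart_img by simp

lemma tt_eqI:
  "c \<in> atlas M \<Longrightarrow> u \<in> fst (tt c) \<Longrightarrow> u' \<in> fst (tt c) \<Longrightarrow> snd (tt c) u = snd (tt c) u' \<Longrightarrow> u = u'"
  using inj_onD[OF TT.inj_on_chart[of "tt c"]] by simp

lemma tt_point:
  assumes "c \<in> atlas M" "fst (fst y) \<in> chart_img c"
  shows "chart_inv (tt c) y \<in> fst (tt c)" "snd (tt c) (chart_inv (tt c) y) = y"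
proof -
  have "y \<in> chart_img (tt c)"
    using assms by (cases y) (auto simp: tt_chart_img)
  then show "chart_inv (tt c) y \<in> fst (tt c)" "snd (tt c) (chart_inv (tt c) y) = y"
    by (auto intro: inv_into_into f_inv_into_f)
qed

text \<open>
  Differentiating \<open>(x, v) \<mapsto> (\<phi> x, d\<phi>(x)v)\<close>: this is where the second differential of a change of charts
  \<open>\<phi>\<close> enters.
\<close>

lemma dtrans_tc:
  assumes c: "c \<in> atlas M" "c' \<in> atlas M" and x: "x \<in> overlap c c'"
  shows "T.dtrans (tc c) (tc c') (x, v) (w, u) = (dtrans c c' x w, d2trans c c' x v w + dtrans c c' x u)"
proof -
  let ?O = "overlap c c' \<times> (UNIV :: 'v set)"
  let ?f = "\<lambda>p. transition c c' (fst p)" and ?g = "\<lambda>p. dtrans c c' (fst p) (snd p)"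
  note ps = topological_module_pscale[OF scale]
  have O: "open ?O"
    using open_overlap[OF c] by (simp add: open_Times)
  have xv: "(x, v) \<in> ?O"
    using x by simp
  have f: "smooth_on (pscale s) s ?O ?f"
    by (rule smooth_on_compose[OF smooth_on_fst smooth_transition[OF c]]) auto
  have g: "smooth_on (pscale s) s ?O ?g"
    unfolding dtrans_def
    by (rule smooth_on_diff_at_compose[OF scale scale open_overlap[OF c] smooth_transition[OF c]
          smooth_on_fst smooth_on_snd]) auto
  have "T.dtrans (tc c) (tc c') (x, v) (w, u)
      = diff_at (pscale s) (pscale s) ?O (\<lambda>p. (?f p, ?g p)) (x, v) (w, u)"
    unfolding T.dtrans_def tc_overlap[OF c(1)]
    by (rule diff_at_local[OF ps ps O smooth_on_Pair[OF f g] O order_refl xv])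
      (use tc_transition[OF c] in auto)
  also have "\<dots> = (diff_at (pscale s) s ?O ?f (x, v) (w, u), diff_at (pscale s) s ?O ?g (x, v) (w, u))"
    by (rule diff_at_Pair[OF ps scale O f g xv])
  also have "diff_at (pscale s) s ?O ?f (x, v) (w, u)
      = diff_at s s (overlap c c') (transition c c') (fst (x, v)) (diff_at (pscale s) s ?O fst (x, v) (w, u))"
    by (rule diff_at_compose[OF ps scale scale O open_overlap[OF c] smooth_on_fst smooth_transition[OF c] _ xv])
      auto
  also have "diff_at (pscale s) s ?O fst (x, v) (w, u) = w"
    using diff_at_linear[OF ps scale O xv, of fst]
    by (simp add: pscale_def case_prod_beta continuous_on_fst continuous_on_id)
  also have "diff_at (pscale s) s ?O ?g (x, v) (w, u) = d2trans c c' x v w + dtrans c c' x u"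
    using diff_at_diff_at[OF scale scale open_overlap[OF c] smooth_transition[OF c] x, of v w u]
    by (simp add: dtrans_def d2trans_def case_prod_beta')
  finally show ?thesis
    by (simp add: dtrans_def o_def)
qed

lemma tt_transition:
  assumes "c \<in> atlas M" "c' \<in> atlas M" "x \<in> overlap c c'"
  shows "transition (tt c) (tt c') ((x, v1), (v2, v12)) =
    ((transition c c' x, dtrans c c' x v1),
     (dtrans c c' x v2, d2trans c c' x v1 v2 + dtrans c c' x v12))"
proof -
  have "(x, v1) \<in> overlap (tc c) (tc c')"
    using assms(3) by (simp add: tc_overlap[OF assms(1)])
  from T.tc_transition[OF _ _ this] show ?thesis
    using assms by (simp add: tt_chart_def tc_transition dtrans_tc del: comp_apply)
qed

lemma tt_chart_transition:
  "c \<in> atlas M \<Longrightarrow> u \<in> fst (tt c) \<Longrightarrow> snd (tt c') u = transition (tt c) (tt c') (snd (tt c) u)"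
  using TT.transition_chart[of "tt c" u "tt c'"] by simp

section \<open>Vector fields in charts\<close>

abbreviation D :: "('m, 'v) chart \<Rightarrow> ('v \<Rightarrow> 'v) \<Rightarrow> 'v \<Rightarrow> 'v \<Rightarrow> 'v" where
  "D c f \<equiv> diff_at s s (chart_img c) f"

abbreviation smooth_in :: "('m, 'v) chart \<Rightarrow> ('v \<Rightarrow> 'v) \<Rightarrow> bool" where
  "smooth_in c f \<equiv> smooth_on s s (chart_img c) f"

lemma smooth_in_D: "c \<in> atlas M \<Longrightarrow> smooth_in c f \<Longrightarrow> smooth_in c g \<Longrightarrow> smooth_in c (\<lambda>x. D c f x (g x))"
  by (rule smooth_on_diff_at_compose[OF scale scale open_chart_img _ smooth_on_id]) auto

lemma D_cong:
  assumes "c \<in> atlas M" "smooth_in c f" "x \<in> chart_img c" "\<And>y. y \<in> chart_img c \<Longrightarrow> h y = f y"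
  shows "D c h x v = D c f x v"
  by (rule diff_at_local[OF scale scale open_chart_img[OF assms(1)] assms(2) open_chart_img[OF assms(1)]])
    (use assms in auto)

lemma D_0: "c \<in> atlas M \<Longrightarrow> x \<in> chart_img c \<Longrightarrow> D c (\<lambda>x. 0) x v = 0"
proof -
  interpret topological_module s
    by (rule scale)
  show "c \<in> atlas M \<Longrightarrow> x \<in> chart_img c \<Longrightarrow> D c (\<lambda>x. 0) x v = 0"
    using diff_at_linear[OF scale scale open_chart_img, of c x "\<lambda>x. 0"] by (simp add: continuous_on_const)
qed

lemma D_uminus:
  assumes "c \<in> atlas M" "smooth_in c f" "x \<in> chart_img c"
  shows "D c (\<lambda>x. - f x) x v = - D c f x v"
proof -
  interpret topological_module s
    by (rule scale)
  have "D c (\<lambda>x. - f x) x v = diff_at s s UNIV uminus (f x) (D c f x v)"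
    by (rule diff_at_compose[OF scale scale scale open_chart_img[OF assms(1)] open_UNIV assms(2)
          smooth_on_uminus[OF scale smooth_on_id] _ assms(3)]) simp
  also have "\<dots> = - D c f x v"
    by (rule diff_at_linear[OF scale scale open_UNIV])
      (auto intro: continuous_on_minus continuous_on_id)
  finally show ?thesis .
qed

lemmas D_linear =
  diff_at_add_vec[OF scale scale open_chart_img] diff_at_minus_vec[OF scale scale open_chart_img]
  diff_at_0_vec[OF scale scale open_chart_img]

text \<open>
  Both sides of \<open>A'(\<phi> x) = d\<phi>(x) A(x)\<close>, which relates the local representatives \<open>A\<close>, \<open>A'\<close> of a vector
  field, are differentiated in direction \<open>w\<close>. The term with the second differential of \<open>\<phi>\<close> is the
  defect of the differential of a vector field from being chart-independent.
\<close>

lemma D_transition: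
  assumes c: "c \<in> atlas M" "c' \<in> atlas M" and A: "smooth_in c A" "smooth_in c' A'"
    and eq: "\<And>x. x \<in> overlap c c' \<Longrightarrow> A' (transition c c' x) = dtrans c c' x (A x)"
    and x: "x \<in> overlap c c'"
  shows "D c' A' (transition c c' x) (dtrans c c' x w) = d2trans c c' x (A x) w + dtrans c c' x (D c A x w)"
proof -
  let ?O = "overlap c c'" and ?P = "\<lambda>(x, v). dtrans c c' x v"
  note ps = topological_module_pscale[OF scale]
  note O = open_overlap[OF c]
  have OV: "open (?O \<times> (UNIV :: 'v set))"
    using O by (simp add: open_Times)
  have P: "smooth_on (pscale s) s (?O \<times> UNIV) ?P"
    unfolding dtrans_def by (rule smooth_on_diff_at[OF scale scale O smooth_transition[OF c]])
  have A_O: "smooth_on s s ?O A"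
    by (rule smooth_on_subset[OF A(1) overlap_subset])
  have xA: "smooth_on s (pscale s) ?O (\<lambda>x. (x, A x))"
    by (rule smooth_on_Pair[OF smooth_on_id A_O])
  have PA: "smooth_on s s ?O (\<lambda>x. ?P (x, A x))"
    by (rule smooth_on_compose[OF xA P]) auto
  have "D c' A' (transition c c' x) (dtrans c c' x w) = diff_at s s ?O (\<lambda>x. A' (transition c c' x)) x w"
    unfolding dtrans_def
    by (rule diff_at_compose[OF scale scale scale O open_chart_img[OF c(2)] smooth_transition[OF c] A(2) _ x,
          symmetric]) (use c in auto)
  also have "\<dots> = diff_at s s ?O (\<lambda>x. ?P (x, A x)) x w"
    by (rule diff_at_local[OF scale scale O PA O order_refl x]) (use eq in auto)
  also have "\<dots> = diff_at (pscale s) s (?O \<times> UNIV) ?P (x, A x) (diff_at s (pscale s) ?O (\<lambda>x. (x, A x)) x w)"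
    by (rule diff_at_compose[OF scale ps scale O OV xA P _ x]) auto
  also have "diff_at s (pscale s) ?O (\<lambda>x. (x, A x)) x w = (diff_at s s ?O (\<lambda>x. x) x w, diff_at s s ?O A x w)"
    by (rule diff_at_Pair[OF scale scale O smooth_on_id A_O x])
  also have "diff_at s s ?O (\<lambda>x. x) x w = w"
    by (rule diff_at_linear[OF scale scale O x]) (auto intro: continuous_on_id)
  also have "diff_at s s ?O A x w = D c A x w"
    by (rule diff_at_local[OF scale scale open_chart_img[OF c(1)] A(1) O overlap_subset x]) simp
  also have "diff_at (pscale s) s (?O \<times> UNIV) ?P (x, A x) (w, D c A x w)
      = d2trans c c' x (A x) w + dtrans c c' x (D c A x w)"
    unfolding dtrans_def d2trans_def
    by (rule diff_at_diff_at[OF scale scale O smooth_transition[OF c] x])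
  finally show ?thesis .
qed

lemma vector_field_in_TV:
  assumes "X \<in> vector_fields s M" "p \<in> topspace (mtop M)"
  shows "X p \<in> TV" "fst (X p) = p"
proof -
  have "X \<in> topspace (mtop M) \<rightarrow> topspace (mtop TM)"
    using assms(1) unfolding vector_fields_def smooth_map_def continuous_map_def by blast
  then show "X p \<in> TV"
    using assms(2) by (auto simp: topspace_TM)
  show "fst (X p) = p"
    using assms by (simp add: vector_fields_def)
qed

lemma smooth_in_vf_rep:
  assumes X: "X \<in> vector_fields s M" and c: "c \<in> atlas M"
  shows "smooth_in c (vf_rep c X)"
proof -
  have "X ` fst c \<subseteq> fst (tc c)"
    using vector_field_in_TV[OF X chart_subset_topspace[OF c]] by (auto simp: fst_tc)
  then have "smooth_on s (pscale s) (chart_img c) (\<lambda>x. snd (tc c) (X (chart_inv c x)))"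
    using X c by (intro smooth_map_in_charts[of s M "pscale s" TM]) (auto simp: vector_fields_def)
  from smooth_on_snd_compose[OF this] show ?thesis
    by (simp add: snd_tc vf_rep_def[abs_def])
qed

lemma vf_rep_transition:
  assumes X: "X \<in> vector_fields s M" and c: "c \<in> atlas M" "c' \<in> atlas M" and x: "x \<in> overlap c c'"
  shows "vf_rep c' X (transition c c' x) = dtrans c c' x (vf_rep c X x)"
proof -
  obtain p where p: "p \<in> fst c" "p \<in> fst c'" "x = snd c p"
    using x by auto
  note Xp = vector_field_in_TV[OF X chart_subset_topspace[OF c(1) p(1)]]
  show ?thesis
    using tangent_vector_transition[OF Xp(1) c] Xp(2) p c by (simp add: vf_rep_def)
qed

lemma vector_field_eqI:
  assumes X: "X \<in> vector_fields s M" and Y: "Y \<in> vector_fields s M"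
    and eq: "\<And>c x. c \<in> atlas M \<Longrightarrow> x \<in> chart_img c \<Longrightarrow> vf_rep c X x = vf_rep c Y x"
  shows "X = Y"
proof (rule extensionalityI)
  show "X \<in> extensional (topspace (mtop M))" "Y \<in> extensional (topspace (mtop M))"
    using X Y by (auto simp: vector_fields_def)
  fix p assume p: "p \<in> topspace (mtop M)"
  obtain c where c: "c \<in> atlas M" "p \<in> fst c"
    using chart_at[OF p] .
  show "X p = Y p"
    by (rule tangent_vector_eqI[of _ _ c])
      (use vector_field_in_TV[OF X p] vector_field_in_TV[OF Y p] c eq[OF c(1), of "snd c p"] in
        \<open>auto simp: vf_rep_def\<close>)
qed

lemma vector_field_exists:
  assumes smooth: "\<And>c. c \<in> atlas M \<Longrightarrow> smooth_in c (A c)"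
    and eq: "\<And>c c' x. c \<in> atlas M \<Longrightarrow> c' \<in> atlas M \<Longrightarrow> x \<in> overlap c c' \<Longrightarrow>
      A c' (transition c c' x) = dtrans c c' x (A c x)"
  shows "\<exists>Z\<in>vector_fields s M. \<forall>c\<in>atlas M. \<forall>x\<in>chart_img c. vf_rep c Z x = A c x"
proof -
  have "\<exists>q\<in>TV. fst q = p \<and> (\<forall>c\<in>atlas M. p \<in> fst c \<longrightarrow> snd q c = A c (snd c p))"
    if p: "p \<in> topspace (mtop M)" for p
  proof -
    obtain c where c: "c \<in> atlas M" "p \<in> fst c"
      using chart_at[OF p] .
    obtain q where q: "q \<in> TV" "fst q = p" "snd q c = A c (snd c p)"
      using tangent_vector_exists[OF c] .
    have "snd q c' = A c' (snd c' p)" if c': "c' \<in> atlas M" "p \<in> fst c'" for c'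
      using tangent_vector_transition[OF q(1) c(1) c'(1)] eq[OF c(1) c'(1), of "snd c p"] q c c' by simp
    with q show ?thesis
      by blast
  qed
  then obtain Z where Z: "\<And>p. p \<in> topspace (mtop M) \<Longrightarrow> Z p \<in> TV \<and> fst (Z p) = p \<and>
      (\<forall>c\<in>atlas M. p \<in> fst c \<longrightarrow> snd (Z p) c = A c (snd c p))"
    by metis
  define Z' where "Z' = restrict Z (topspace (mtop M))"
  have rep: "vf_rep c Z' x = A c x" if "c \<in> atlas M" "x \<in> chart_img c" for c x
    using that Z chart_subset_topspace[OF that(1)] by (auto simp: vf_rep_def Z'_def)
  have "smooth_map s M (pscale s) TM Z'"
  proof (rule smooth_mapI[where d = tc])
    show "smooth_mfd s M" "smooth_mfd (pscale s) TM"
      by (rule smooth_mfd_axioms smooth_mfd_TM)+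
    fix c assume c: "c \<in> atlas M"
    show "Z' ` fst c \<subseteq> fst (tc c)"
      using Z chart_subset_topspace[OF c] by (auto simp: fst_tc Z'_def)
    have "(x, A c x) = snd (tc c) (Z' (chart_inv c x))" if "x \<in> chart_img c" for x
      using that Z chart_subset_topspace[OF c] rep[OF c that] c by (auto simp: snd_tc vf_rep_def Z'_def)
    then show "smooth_on s (pscale s) (chart_img c) (\<lambda>x. snd (tc c) (Z' (chart_inv c x)))"
      by (rule smooth_on_cong[THEN iffD1, OF _ smooth_on_Pair[OF smooth_on_id smooth[OF c]]])
  qed simp
  then have "Z' \<in> vector_fields s M"
    using Z by (auto simp: vector_fields_def Z'_def)
  with rep show ?thesis
    by blast
qed

text \<open>
  The defects of \<open>dX(x)Y(x)\<close> and \<open>dY(x)X(x)\<close> are \<open>d\<^sup>2\<phi>(x)(X, Y)\<close> and \<open>d\<^sup>2\<phi>(x)(Y, X)\<close>. They cancel by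
  symmetry, so the local brackets form a vector field.
\<close>

lemma lie_bracket_in_charts:
  assumes X: "X \<in> vector_fields s M" and Y: "Y \<in> vector_fields s M"
  shows "lie_bracket s M X Y \<in> vector_fields s M"
    and "c \<in> atlas M \<Longrightarrow> x \<in> chart_img c \<Longrightarrow> vf_rep c (lie_bracket s M X Y) x =
      D c (vf_rep c X) x (vf_rep c Y x) - D c (vf_rep c Y) x (vf_rep c X x)"
proof -
  let ?A = "\<lambda>c x. D c (vf_rep c X) x (vf_rep c Y x) - D c (vf_rep c Y) x (vf_rep c X x)"
  let ?P = "\<lambda>Z. Z \<in> vector_fields s M \<and> (\<forall>c\<in>atlas M. \<forall>x\<in>chart_img c. vf_rep c Z x = ?A c x)"
  note XY = smooth_in_vf_rep[OF X] smooth_in_vf_rep[OF Y]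
  have "\<exists>Z\<in>vector_fields s M. \<forall>c\<in>atlas M. \<forall>x\<in>chart_img c. vf_rep c Z x = ?A c x"
  proof (rule vector_field_exists)
    fix c assume c: "c \<in> atlas M"
    show "smooth_in c (?A c)"
      using smooth_on_add[OF scale smooth_in_D[OF c XY[OF c]] smooth_on_uminus[OF scale smooth_in_D[OF c XY(2,1)[OF c]]]]
      by simp
  next
    fix c c' x assume c: "c \<in> atlas M" "c' \<in> atlas M" and x: "x \<in> overlap c c'"
    have "D c' (vf_rep c' X) (transition c c' x) (dtrans c c' x w) =
        d2trans c c' x (vf_rep c X x) w + dtrans c c' x (D c (vf_rep c X) x w)" for w
      by (rule D_transition[OF c XY(1)[OF c(1)] XY(1)[OF c(2)] vf_rep_transition[OF X c] x])
    moreover have "D c' (vf_rep c' Y) (transition c c' x) (dtrans c c' x w) =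
        d2trans c c' x (vf_rep c Y x) w + dtrans c c' x (D c (vf_rep c Y) x w)" for w
      by (rule D_transition[OF c XY(2)[OF c(1)] XY(2)[OF c(2)] vf_rep_transition[OF Y c] x])
    ultimately show "?A c' (transition c c' x) = dtrans c c' x (?A c x)"
      by (simp only: vf_rep_transition[OF X c x] vf_rep_transition[OF Y c x] dtrans_diff[OF c x]
          d2trans_symmetric[OF c x, of "vf_rep c X x"] add_diff_cancel_left)
  qed
  then have ex: "\<exists>Z. ?P Z"
    by blast
  have "\<exists>!Z. ?P Z"
  proof (rule ex_ex1I[OF ex])
    show "Z = Z'" if "?P Z" "?P Z'" for Z Z'
      by (rule vector_field_eqI[OF that[THEN conjunct1]])
        (simp only: that[THEN conjunct2, rule_format])
  qed
  from theI'[OF this] show "lie_bracket s M X Y \<in> vector_fields s M"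
    and "c \<in> atlas M \<Longrightarrow> x \<in> chart_img c \<Longrightarrow> vf_rep c (lie_bracket s M X Y) x = ?A c x"
    unfolding lie_bracket_def by blast+
qed

section \<open>Sections of the second tangent bundle in charts\<close>

text \<open>
  Local representatives \<open>x + \<epsilon>\<^sub>1 A(x) + \<epsilon>\<^sub>2 B(x) + \<epsilon>\<^sub>1 \<epsilon>\<^sub>2 C(x)\<close> that fit together. Compatibility is
  stated for the point of the second tangent bundle as a whole; in this form it passes directly through
  any map that commutes with the transition maps.
\<close>

definition section_data ::
  "(('m, 'v) chart \<Rightarrow> 'v \<Rightarrow> 'v) \<Rightarrow> (('m, 'v) chart \<Rightarrow> 'v \<Rightarrow> 'v) \<Rightarrow> (('m, 'v) chart \<Rightarrow> 'v \<Rightarrow> 'v) \<Rightarrow> bool"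
  where "section_data A B C \<longleftrightarrow>
    (\<forall>c\<in>atlas M. smooth_in c (A c) \<and> smooth_in c (B c) \<and> smooth_in c (C c)) \<and>
    (\<forall>c\<in>atlas M. \<forall>c'\<in>atlas M. \<forall>x\<in>overlap c c'.
      ((transition c c' x, A c' (transition c c' x)), (B c' (transition c c' x), C c' (transition c c' x)))
      = transition (tt c) (tt c') ((x, A c x), (B c x, C c x)))"

lemma section_data_smooth:
  assumes "section_data A B C" "c \<in> atlas M"
  shows "smooth_in c (A c)" "smooth_in c (B c)" "smooth_in c (C c)"
  using assms unfolding section_data_def by blast+

lemma section_data_transition:
  assumes "section_data A B C" "c \<in> atlas M" "c' \<in> atlas M" "x \<in> overlap c c'"
  shows "((transition c c' x, A c' (transition c c' x)), (B c' (transition c c' x), C c' (transition c c' x)))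
      = transition (tt c) (tt c') ((x, A c x), (B c x, C c x))"
  using assms unfolding section_data_def by blast

lemma section_data_components:
  assumes "section_data A B C" "c \<in> atlas M" "c' \<in> atlas M" "x \<in> overlap c c'"
  shows "A c' (transition c c' x) = dtrans c c' x (A c x)"
    and "B c' (transition c c' x) = dtrans c c' x (B c x)"
    and "C c' (transition c c' x) = d2trans c c' x (A c x) (B c x) + dtrans c c' x (C c x)"
  using section_data_transition[OF assms] unfolding tt_transition[OF assms(2-4)] prod.inject by blast+

lemma section_in_TTV:
  assumes "X \<in> sections2 s M" "p \<in> topspace (mtop M)"
  shows "X p \<in> TTV" "fst (fst (X p)) = p"
proof -
  have "X \<in> topspace (mtop M) \<rightarrow> TTV"
    using assms(1) unfolding sections2_def smooth_map_def continuous_map_def by blast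
  then show "X p \<in> TTV"
    using assms(2) by auto
  show "fst (fst (X p)) = p"
    using assms by (simp add: sections2_def)
qed

lemma section_in_tt:
  "X \<in> sections2 s M \<Longrightarrow> c \<in> atlas M \<Longrightarrow> p \<in> fst c \<Longrightarrow> X p \<in> fst (tt c)"
  using section_in_TTV[of X p] chart_subset_topspace[of c p] by (simp add: fst_tt)

lemma rep2_eq:
  assumes "X \<in> sections2 s M" "c \<in> atlas M" "x \<in> chart_img c"
  shows "rep2 s M c X x = ((x, comp1 s M c X x), (comp2 s M c X x, comp12 s M c X x))"
proof -
  have "fst (fst (rep2 s M c X x)) = x"
    using assms section_in_TTV(2)[OF assms(1) chart_subset_topspace[OF assms(2)]]
    by (auto simp: rep2_def fst_fst_snd_tt)
  then show ?thesis
    by (simp add: comp1_def comp2_def comp12_def prod_eq_iff)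
qed

lemma section_data_section:
  assumes X: "X \<in> sections2 s M"
  shows "section_data (\<lambda>c. comp1 s M c X) (\<lambda>c. comp2 s M c X) (\<lambda>c. comp12 s M c X)"
  unfolding section_data_def
proof (intro conjI ballI)
  fix c assume c: "c \<in> atlas M"
  have "smooth_on s (ttscale s) (chart_img c) (\<lambda>x. snd (tt c) (X (chart_inv c x)))"
    by (rule smooth_map_in_charts[of s M _ "TTM s M"])
      (use X c section_in_tt[OF X c] in \<open>auto simp: sections2_def\<close>)
  then have r: "smooth_on s (ttscale s) (chart_img c) (rep2 s M c X)"
    by (simp add: rep2_def[abs_def])
  show "smooth_in c (comp1 s M c X)" "smooth_in c (comp2 s M c X)" "smooth_in c (comp12 s M c X)"
    unfolding comp1_def[abs_def] comp2_def[abs_def] comp12_def[abs_def]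
    by (intro smooth_on_fst_compose smooth_on_snd_compose r)+
  fix c' x assume c': "c' \<in> atlas M" and x: "x \<in> overlap c c'"
  obtain p where p: "p \<in> fst c" "p \<in> fst c'" "x = snd c p"
    using x by auto
  have x': "transition c c' x \<in> chart_img c'"
    using p c by auto
  have "rep2 s M c' X (transition c c' x) = transition (tt c) (tt c') (rep2 s M c X x)"
    using tt_chart_transition[OF c section_in_tt[OF X c p(1)], of c'] p c c' by (simp add: rep2_def)
  then show "((transition c c' x, comp1 s M c' X (transition c c' x)),
      (comp2 s M c' X (transition c c' x), comp12 s M c' X (transition c c' x)))
      = transition (tt c) (tt c') ((x, comp1 s M c X x), (comp2 s M c X x, comp12 s M c X x))"
    unfolding rep2_eq[OF X c' x'] rep2_eq[OF X c subsetD[OF overlap_subset x]] .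
qed

lemma section_eqI:
  assumes X: "X \<in> sections2 s M" and Y: "Y \<in> sections2 s M"
    and eq: "\<And>c x. c \<in> atlas M \<Longrightarrow> x \<in> chart_img c \<Longrightarrow> rep2 s M c X x = rep2 s M c Y x"
  shows "X = Y"
proof (rule extensionalityI)
  show "X \<in> extensional (topspace (mtop M))" "Y \<in> extensional (topspace (mtop M))"
    using X Y by (auto simp: sections2_def)
  fix p assume p: "p \<in> topspace (mtop M)"
  obtain c where c: "c \<in> atlas M" "p \<in> fst c"
    using chart_at[OF p] .
  show "X p = Y p"
    by (rule tt_eqI[OF c(1)])
      (use section_in_tt[OF X c] section_in_tt[OF Y c] c eq[OF c(1), of "snd c p"] in
        \<open>auto simp: rep2_def\<close>)
qed

lemma section_exists:
  assumes data: "section_data A B C"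
  shows "\<exists>Z\<in>sections2 s M. \<forall>c\<in>atlas M. \<forall>x\<in>chart_img c. rep2 s M c Z x = ((x, A c x), (B c x, C c x))"
proof -
  let ?R = "\<lambda>c x. ((x, A c x), (B c x, C c x))"
  have "\<exists>u\<in>TTV. fst (fst u) = p \<and> (\<forall>c\<in>atlas M. p \<in> fst c \<longrightarrow> snd (tt c) u = ?R c (snd c p))"
    if p: "p \<in> topspace (mtop M)" for p
  proof -
    obtain c where c: "c \<in> atlas M" "p \<in> fst c"
      using chart_at[OF p] .
    define u where "u = chart_inv (tt c) (?R c (snd c p))"
    have u: "u \<in> fst (tt c)" "snd (tt c) u = ?R c (snd c p)"
      unfolding u_def by (rule tt_point[OF c(1)]; use c in simp)+
    have base: "fst (fst u) = p"
    proof (rule inj_onD[OF inj_on_chart[OF c(1)]])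
      show "snd c (fst (fst u)) = snd c p"
        using fst_fst_snd_tt[of c u] u(2) by simp
    qed (use u(1) c(2) in \<open>auto simp: fst_tt\<close>)
    have "snd (tt c') u = ?R c' (snd c' p)" if c': "c' \<in> atlas M" "p \<in> fst c'" for c'
      using tt_chart_transition[OF c(1) u(1), of c'] section_data_transition[OF data c(1) c'(1), of "snd c p"]
        c c' u(2) by simp
    with u base show ?thesis
      unfolding fst_tt by blast
  qed
  then obtain Z where Z: "\<And>p. p \<in> topspace (mtop M) \<Longrightarrow> Z p \<in> TTV \<and> fst (fst (Z p)) = p \<and>
      (\<forall>c\<in>atlas M. p \<in> fst c \<longrightarrow> snd (tt c) (Z p) = ?R c (snd c p))"
    by metis
  define Z' where "Z' = restrict Z (topspace (mtop M))"
  have rep: "rep2 s M c Z' x = ?R c x" if "c \<in> atlas M" "x \<in> chart_img c" for c x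
    using that Z chart_subset_topspace[OF that(1)] by (auto simp: rep2_def Z'_def)
  have "smooth_map s M (ttscale s) (TTM s M) Z'"
  proof (rule smooth_mapI[where d = tt])
    show "smooth_mfd s M" "smooth_mfd (ttscale s) (TTM s M)"
      by (rule smooth_mfd_axioms smooth_mfd_TTM)+
    fix c assume c: "c \<in> atlas M"
    show "Z' ` fst c \<subseteq> fst (tt c)"
      using Z chart_subset_topspace[OF c] by (auto simp: fst_tt Z'_def)
    have "?R c x = snd (tt c) (Z' (chart_inv c x))" if "x \<in> chart_img c" for x
      using rep[OF c that] by (simp add: rep2_def)
    then show "smooth_on s (ttscale s) (chart_img c) (\<lambda>x. snd (tt c) (Z' (chart_inv c x)))"
      by (rule smooth_on_cong[THEN iffD1, OF _ smooth_on_Pair[OF smooth_on_Pair[OF smooth_on_id section_data_smooth(1)[OF data c]]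
              smooth_on_Pair[OF section_data_smooth(2,3)[OF data c]]]])
  qed simp
  then have "Z' \<in> sections2 s M"
    using Z by (auto simp: sections2_def Z'_def)
  with rep show ?thesis
    by blast
qed

lemma section2_of:
  assumes data: "section_data A B C"
  shows "section2_of s M A B C \<in> sections2 s M"
    and "c \<in> atlas M \<Longrightarrow> x \<in> chart_img c \<Longrightarrow> comp1 s M c (section2_of s M A B C) x = A c x"
    and "c \<in> atlas M \<Longrightarrow> x \<in> chart_img c \<Longrightarrow> comp2 s M c (section2_of s M A B C) x = B c x"
    and "c \<in> atlas M \<Longrightarrow> x \<in> chart_img c \<Longrightarrow> comp12 s M c (section2_of s M A B C) x = C c x"
proof -
  let ?P = "\<lambda>Z. Z \<in> sections2 s M \<and> (\<forall>c\<in>atlas M. \<forall>x\<in>chart_img c. rep2 s M c Z x = ((x, A c x), (B c x, C c x)))"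
  have "\<exists>!Z. ?P Z"
  proof (rule ex_ex1I)
    show "\<exists>Z. ?P Z"
      using section_exists[OF data] by blast
    show "Z = Z'" if "?P Z" "?P Z'" for Z Z'
      by (rule section_eqI[OF that[THEN conjunct1]])
        (simp only: that[THEN conjunct2, rule_format])
  qed
  from theI'[OF this] have *: "?P (section2_of s M A B C)"
    unfolding section2_of_def .
  then show "section2_of s M A B C \<in> sections2 s M"
    by blast
  show "c \<in> atlas M \<Longrightarrow> x \<in> chart_img c \<Longrightarrow> comp1 s M c (section2_of s M A B C) x = A c x"
    and "c \<in> atlas M \<Longrightarrow> x \<in> chart_img c \<Longrightarrow> comp2 s M c (section2_of s M A B C) x = B c x"
    and "c \<in> atlas M \<Longrightarrow> x \<in> chart_img c \<Longrightarrow> comp12 s M c (section2_of s M A B C) x = C c x"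
    by (simp_all add: comp1_def comp2_def comp12_def *[THEN conjunct2, rule_format])
qed

section \<open>Diffeomorphisms given in charts\<close>

text \<open>
  The form in which \<open>tilde\<close> describes a diffeomorphism. It is stable under composition, and it determines
  an extensional map, so identities in \<open>Diff\<close> can be verified for the local maps \<open>f\<close>.
\<close>

definition chart_form ::
  "(('m, 'v) ttvec \<Rightarrow> ('m, 'v) ttvec) \<Rightarrow>
    (('m, 'v) chart \<Rightarrow> ('v \<times> 'v) \<times> ('v \<times> 'v) \<Rightarrow> ('v \<times> 'v) \<times> ('v \<times> 'v)) \<Rightarrow> bool" where
  "chart_form F f \<longleftrightarrow>
    (\<forall>c\<in>atlas M. \<forall>u\<in>fst (tt c). F u \<in> fst (tt c) \<and> snd (tt c) (F u) = f c (snd (tt c) u))"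

lemma chart_form_unique:
  assumes "F \<in> extensional TTV" "G \<in> extensional TTV" "chart_form F f" "chart_form G g"
    and "\<And>c y. c \<in> atlas M \<Longrightarrow> fst (fst y) \<in> chart_img c \<Longrightarrow> f c y = g c y"
  shows "F = G"
proof (rule extensionalityI[OF assms(1,2)])
  fix u assume "u \<in> TTV"
  then obtain c where c: "c \<in> atlas M" "u \<in> fst (tt c)"
    by (rule tt_chart_at)
  have "fst (fst (snd (tt c) u)) \<in> chart_img c"
    using c(2) by (auto simp: fst_fst_snd_tt fst_tt)
  then show "F u = G u"
    using c assms(3-5) by (intro tt_eqI[OF c(1)]) (auto simp: chart_form_def)
qed

lemma chart_form_compose:
  assumes "chart_form F f" "chart_form G g"
  shows "chart_form (compose TTV F G) (\<lambda>c y. f c (g c y))"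
proof -
  have "compose TTV F G u = F (G u)" if "u \<in> fst (tt c)" for c u
    using that by (simp add: fst_tt compose_eq)
  with assms show ?thesis
    unfolding chart_form_def by simp
qed

text \<open>
  A diffeomorphism over the identity of the base may be prescribed in charts. The inverse
  requires no separate gluing: \<open>F\<close> preserves each chart domain, so its inverse does too and is
  there given by the local inverses \<open>g\<close>.
\<close>

lemma chart_form_diffeomorphism_exists:
  assumes smooth: "\<And>c. c \<in> atlas M \<Longrightarrow> smooth_on (ttscale s) (ttscale s) (chart_img (tt c)) (f c)"
      "\<And>c. c \<in> atlas M \<Longrightarrow> smooth_on (ttscale s) (ttscale s) (chart_img (tt c)) (g c)"
    and base: "\<And>c y. fst (fst (f c y)) = fst (fst y)" "\<And>c y. fst (fst (g c y)) = fst (fst y)"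
    and inverse: "\<And>c y. c \<in> atlas M \<Longrightarrow> f c (g c y) = y" "\<And>c y. c \<in> atlas M \<Longrightarrow> g c (f c y) = y"
    and trans: "\<And>c c' y. c \<in> atlas M \<Longrightarrow> c' \<in> atlas M \<Longrightarrow> fst (fst y) \<in> overlap c c' \<Longrightarrow>
      transition (tt c) (tt c') (f c y) = f c' (transition (tt c) (tt c') y)"
  shows "\<exists>F. F \<in> carrier (Diff (ttscale s) (TTM s M)) \<and> chart_form F f"
proof -
  have "\<exists>w\<in>TTV. fst (fst w) = fst (fst u) \<and>
      (\<forall>c\<in>atlas M. u \<in> fst (tt c) \<longrightarrow> snd (tt c) w = f c (snd (tt c) u))" if u: "u \<in> TTV" for u
  proof -
    obtain c where c: "c \<in> atlas M" "u \<in> fst (tt c)"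
      using tt_chart_at[OF u] .
    have uc: "fst (fst u) \<in> fst c"
      using c(2) by (simp add: fst_tt)
    have yc: "fst (fst (f c (snd (tt c) u))) = snd c (fst (fst u))"
      by (simp add: base fst_fst_snd_tt)
    define w where "w = chart_inv (tt c) (f c (snd (tt c) u))"
    have w: "w \<in> fst (tt c)" "snd (tt c) w = f c (snd (tt c) u)"
      unfolding w_def by (rule tt_point[OF c(1)]; use uc yc in simp)+
    have b: "fst (fst w) = fst (fst u)"
    proof (rule inj_onD[OF inj_on_chart[OF c(1)]])
      show "snd c (fst (fst w)) = snd c (fst (fst u))"
        using fst_fst_snd_tt[of c w] w(2) yc by simp
    qed (use w(1) uc in \<open>auto simp: fst_tt\<close>)
    have "snd (tt c') w = f c' (snd (tt c') u)" if c': "c' \<in> atlas M" "u \<in> fst (tt c')" for c'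
    proof -
      have "fst (fst (snd (tt c) u)) \<in> overlap c c'"
        using c'(2) uc by (auto simp: fst_fst_snd_tt fst_tt)
      from trans[OF c(1) c'(1) this] show ?thesis
        using tt_chart_transition[OF c(1) w(1), of c'] tt_chart_transition[OF c, of c'] w(2) by simp
    qed
    with w b show ?thesis
      unfolding fst_tt by blast
  qed
  then obtain F0 where F0: "\<And>u. u \<in> TTV \<Longrightarrow> F0 u \<in> TTV \<and> fst (fst (F0 u)) = fst (fst u) \<and>
      (\<forall>c\<in>atlas M. u \<in> fst (tt c) \<longrightarrow> snd (tt c) (F0 u) = f c (snd (tt c) u))"
    by metis
  define F where "F = restrict F0 TTV"
  have form: "chart_form F f"
    using F0 by (auto simp: chart_form_def F_def fst_tt)
  have F_base: "F u \<in> TTV" "fst (fst (F u)) = fst (fst u)" if "u \<in> TTV" for u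
    using F0 that by (auto simp: F_def)
  have F_c: "F u \<in> fst (tt c)" "snd (tt c) (F u) = f c (snd (tt c) u)"
    if "c \<in> atlas M" "u \<in> fst (tt c)" for c u
    using form that by (auto simp: chart_form_def)
  have inj: "inj_on F TTV"
  proof (rule inj_onI)
    fix u w assume u: "u \<in> TTV" and w: "w \<in> TTV" and eq: "F u = F w"
    obtain c where c: "c \<in> atlas M" "u \<in> fst (tt c)"
      using tt_chart_at[OF u] .
    have wc: "w \<in> fst (tt c)"
      using F_base(2)[OF u] F_base(2)[OF w] eq c(2) w by (simp add: fst_tt)
    have "g c (f c (snd (tt c) u)) = g c (f c (snd (tt c) w))"
      using F_c(2)[OF c] F_c(2)[OF c(1) wc] eq by simp
    then show "u = w"
      by (intro tt_eqI[OF c wc]) (simp add: inverse(2)[OF c(1)])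
  qed
  have inv_c: "inv_into TTV F w \<in> fst (tt c) \<and> snd (tt c) (inv_into TTV F w) = g c (snd (tt c) w) \<and> w \<in> F ` TTV"
    if c: "c \<in> atlas M" and w: "w \<in> fst (tt c)" for c w
  proof -
    define u where "u = chart_inv (tt c) (g c (snd (tt c) w))"
    have u: "u \<in> fst (tt c)" "snd (tt c) u = g c (snd (tt c) w)"
      unfolding u_def
      by (rule tt_point[OF c]; use w in \<open>auto simp: base fst_fst_snd_tt fst_tt\<close>)+
    have "F u = w"
      by (rule tt_eqI[OF c F_c(1)[OF c u(1)] w]) (simp add: F_c(2)[OF c u(1)] u(2) inverse(1)[OF c])
    moreover have "u \<in> TTV"
      using u(1) by (simp add: fst_tt)
    ultimately have "inv_into TTV F w = u" "w \<in> F ` TTV"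
      using inv_into_f_f[OF inj, of u] by auto
    with u show ?thesis
      by simp
  qed
  have "F ` TTV = TTV"
  proof
    show "F ` TTV \<subseteq> TTV"
      using F_base(1) by blast
    show "TTV \<subseteq> F ` TTV"
      using inv_c tt_chart_at by blast
  qed
  with inj have "F \<in> Bij TTV"
    by (auto simp: Bij_def bij_betw_def F_def)
  moreover have "smooth_map (ttscale s) (TTM s M) (ttscale s) (TTM s M) h"
    if h: "\<And>c u. c \<in> atlas M \<Longrightarrow> u \<in> fst (tt c) \<Longrightarrow> h u \<in> fst (tt c) \<and> snd (tt c) (h u) = k c (snd (tt c) u)"
      and k: "\<And>c. c \<in> atlas M \<Longrightarrow> smooth_on (ttscale s) (ttscale s) (chart_img (tt c)) (k c)" for h k
  proof (rule smooth_mapI[where d = "\<lambda>c. c", OF smooth_mfd_TTM smooth_mfd_TTM])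
    fix c' assume "c' \<in> atlas (TTM s M)"
    then obtain c where c: "c \<in> atlas M" "c' = tt c"
      unfolding atlas_TTM by blast
    show "h ` fst c' \<subseteq> fst c'"
      using h[OF c(1)] c(2) by auto
    show "smooth_on (ttscale s) (ttscale s) (chart_img c') (\<lambda>x. snd c' (h (chart_inv c' x)))"
      unfolding c(2)
    proof (rule smooth_on_cong[THEN iffD1, OF _ k[OF c(1)]])
      fix y assume "y \<in> chart_img (tt c)"
      then show "k c y = snd (tt c) (h (chart_inv (tt c) y))"
        using h[OF c(1), of "chart_inv (tt c) y"] by (simp add: inv_into_into f_inv_into_f)
    qed
  qed
  from this[of F f] this[of "inv_into TTV F" g]
  have "smooth_map (ttscale s) (TTM s M) (ttscale s) (TTM s M) F"
    "smooth_map (ttscale s) (TTM s M) (ttscale s) (TTM s M) (inv_into TTV F)"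
    using F_c inv_c smooth by blast+
  ultimately show ?thesis
    using form by (auto simp: Diff_def)
qed

section \<open>The action of sections on the second tangent bundle\<close>

text \<open>
  The map \<open>tilde\<close> of a section with components \<open>A\<close>, \<open>B\<close>, \<open>C\<close>, in the coordinates of one chart.
\<close>

definition local_action ::
  "(('m, 'v) chart \<Rightarrow> 'v \<Rightarrow> 'v) \<Rightarrow> (('m, 'v) chart \<Rightarrow> 'v \<Rightarrow> 'v) \<Rightarrow> (('m, 'v) chart \<Rightarrow> 'v \<Rightarrow> 'v) \<Rightarrow>
    ('m, 'v) chart \<Rightarrow> ('v \<times> 'v) \<times> ('v \<times> 'v) \<Rightarrow> ('v \<times> 'v) \<times> ('v \<times> 'v)" where
  "local_action A B C c = (\<lambda>((x, v1), (v2, v12)).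
    ((x, v1 + A c x), (v2 + B c x, v12 + C c x + D c (A c) x v2 + D c (B c) x v1)))"

definition local_action_inverse ::
  "(('m, 'v) chart \<Rightarrow> 'v \<Rightarrow> 'v) \<Rightarrow> (('m, 'v) chart \<Rightarrow> 'v \<Rightarrow> 'v) \<Rightarrow> (('m, 'v) chart \<Rightarrow> 'v \<Rightarrow> 'v) \<Rightarrow>
    ('m, 'v) chart \<Rightarrow> ('v \<times> 'v) \<times> ('v \<times> 'v) \<Rightarrow> ('v \<times> 'v) \<times> ('v \<times> 'v)" where
  "local_action_inverse A B C c = (\<lambda>((x, w1), (w2, w12)).
    ((x, w1 - A c x), (w2 - B c x, w12 - C c x - D c (A c) x (w2 - B c x) - D c (B c) x (w1 - A c x))))"

text \<open>
  Applying the transition map after the action produces \<open>d\<^sup>2\<phi>(x)(v\<^sub>1 + A, v\<^sub>2 + B)\<close>. In the other order,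
  \<open>d\<^sup>2\<phi>(x)(v\<^sub>1, v\<^sub>2)\<close> comes from the point, \<open>d\<^sup>2\<phi>(x)(A, B)\<close> from the section, and the mixed terms
  \<open>d\<^sup>2\<phi>(x)(A, v\<^sub>2)\<close>, \<open>d\<^sup>2\<phi>(x)(B, v\<^sub>1)\<close> from the defects of \<open>dA\<close> and \<open>dB\<close>. The two agree because
  \<open>d\<^sup>2\<phi>(x)\<close> is bilinear and symmetric.
\<close>

lemma local_action_transition:
  assumes data: "section_data A B C" and c: "c \<in> atlas M" "c' \<in> atlas M" and y: "fst (fst y) \<in> overlap c c'"
  shows "transition (tt c) (tt c') (local_action A B C c y) = local_action A B C c' (transition (tt c) (tt c') y)"
proof -
  obtain x v1 v2 v12 where y_eq: "y = ((x, v1), (v2, v12))"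
    by (metis prod.collapse)
  have x: "x \<in> overlap c c'"
    using y by (simp add: y_eq)
  note sm = section_data_smooth[OF data c(1)] section_data_smooth[OF data c(2)]
  note comp = section_data_components[OF data c]
  have DA: "D c' (A c') (transition c c' x) (dtrans c c' x w) =
      d2trans c c' x (A c x) w + dtrans c c' x (D c (A c) x w)" for w
    by (rule D_transition[OF c sm(1,4) comp(1) x])
  have DB: "D c' (B c') (transition c c' x) (dtrans c c' x w) =
      d2trans c c' x (B c x) w + dtrans c c' x (D c (B c) x w)" for w
    by (rule D_transition[OF c sm(2,5) comp(2) x])
  show ?thesis
    unfolding y_eq local_action_def prod.case tt_transition[OF c x] DA DB comp[OF x]
      d2trans_add_left[OF c x] d2trans_add_right[OF c x] dtrans_add[OF c x]
      d2trans_symmetric[OF c x, of "B c x" v1]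
    by (simp add: add_ac)
qed

lemma smooth_local_action:
  assumes data: "section_data A B C" and c: "c \<in> atlas M"
  shows "smooth_on (ttscale s) (ttscale s) (chart_img (tt c)) (local_action A B C c)"
    and "smooth_on (ttscale s) (ttscale s) (chart_img (tt c)) (local_action_inverse A B C c)"
proof -
  let ?S = "\<lambda>f. smooth_on (ttscale s) s (chart_img (tt c)) f"
  have pr: "?S (\<lambda>y. fst (fst y))" "?S (\<lambda>y. snd (fst y))" "?S (\<lambda>y. fst (snd y))" "?S (\<lambda>y. snd (snd y))"
    by (intro smooth_on_fst_compose smooth_on_snd_compose smooth_on_id)+
  have base: "(\<lambda>y. fst (fst y)) ` chart_img (tt c) \<subseteq> chart_img c"
    unfolding tt_chart_img[OF c] by auto
  have comp: "?S (\<lambda>y. f (fst (fst y)))" if "smooth_in c f" for f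
    by (rule smooth_on_compose[OF pr(1) that base])
  have D: "?S (\<lambda>y. D c f (fst (fst y)) (h y))" if "smooth_in c f" "?S h" for f h
    by (rule smooth_on_diff_at_compose[OF scale scale open_chart_img[OF c] that(1) pr(1) that(2) base])
  note sm = section_data_smooth[OF data c]
  show "smooth_on (ttscale s) (ttscale s) (chart_img (tt c)) (local_action A B C c)"
    unfolding local_action_def case_prod_beta
    by (intro smooth_on_Pair smooth_on_add[OF scale] pr comp D sm)
  show "smooth_on (ttscale s) (ttscale s) (chart_img (tt c)) (local_action_inverse A B C c)"
    unfolding local_action_inverse_def case_prod_beta
    by (intro smooth_on_Pair smooth_on_diff[OF scale] pr comp D sm)
qed

abbreviation section_action ::
  "('m \<Rightarrow> ('m, 'v) ttvec) \<Rightarrow> ('m, 'v) chart \<Rightarrow> ('v \<times> 'v) \<times> ('v \<times> 'v) \<Rightarrow> ('v \<times> 'v) \<times> ('v \<times> 'v)" where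
  "section_action X \<equiv> local_action (\<lambda>c. comp1 s M c X) (\<lambda>c. comp2 s M c X) (\<lambda>c. comp12 s M c X)"

abbreviation "DiffTT \<equiv> Diff (ttscale s) (TTM s M)"

lemma Diff_Bij: "F \<in> carrier DiffTT \<Longrightarrow> F \<in> Bij TTV"
  by (simp add: Diff_def)

lemma Diff_mult: "F \<in> carrier DiffTT \<Longrightarrow> G \<in> carrier DiffTT \<Longrightarrow> F \<otimes>\<^bsub>DiffTT\<^esub> G = compose TTV F G"
  by (simp add: Diff_def BijGroup_def)

lemma Diff_one: "\<one>\<^bsub>DiffTT\<^esub> = (\<lambda>u\<in>TTV. u)"
  by (simp add: Diff_def BijGroup_def)

lemma chart_form_one: "chart_form \<one>\<^bsub>DiffTT\<^esub> (\<lambda>c y. y)"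
  by (simp add: chart_form_def Diff_one fst_tt)

lemma chart_form_mult:
  assumes "F \<in> carrier DiffTT" "G \<in> carrier DiffTT" "chart_form F f" "chart_form G g"
  shows "chart_form (F \<otimes>\<^bsub>DiffTT\<^esub> G) (\<lambda>c y. f c (g c y))"
  unfolding Diff_mult[OF assms(1,2)] by (rule chart_form_compose[OF assms(3,4)])

lemma tilde_spec:
  assumes X: "X \<in> sections2 s M"
  shows tilde_Diff: "tilde s M X \<in> carrier DiffTT"
    and chart_form_tilde: "chart_form (tilde s M X) (section_action X)"
proof -
  let ?P = "\<lambda>F. F \<in> carrier DiffTT \<and> chart_form F (section_action X)"
  note data = section_data_section[OF X]
  have "\<exists>!F. ?P F"
  proof (rule ex_ex1I)
    show "\<exists>F. ?P F"
      by (rule chart_form_diffeomorphism_exists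
          [where g = "local_action_inverse (\<lambda>c. comp1 s M c X) (\<lambda>c. comp2 s M c X) (\<lambda>c. comp12 s M c X)"])
        (use smooth_local_action[OF data] local_action_transition[OF data] in
          \<open>simp_all add: local_action_def local_action_inverse_def case_prod_beta\<close>)
    show "F = G" if "?P F" "?P G" for F G
      by (rule chart_form_unique[of F G "section_action X" "section_action X"])
        (use that Diff_Bij Bij_imp_extensional in auto)
  qed
  moreover have "tilde s M X = (THE F. ?P F)"
    unfolding tilde_def chart_form_def local_action_def by (simp add: case_prod_beta)
  ultimately have "?P (tilde s M X)"
    using theI'[of ?P] by simp
  then show "tilde s M X \<in> carrier DiffTT" "chart_form (tilde s M X) (section_action X)"
    by blast+
qed

lemma local_action_section2_of:
  assumes data: "section_data A B C" and c: "c \<in> atlas M" and y: "fst (fst y) \<in> chart_img c"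
  shows "section_action (section2_of s M A B C) c y = local_action A B C c y"
proof -
  note eq = section2_of(2-4)[OF data c]
  note sm = section_data_smooth[OF data c]
  show ?thesis
    using eq[OF y] D_cong[OF c sm(1) y eq(1)] D_cong[OF c sm(2) y eq(2)]
    by (simp add: local_action_def case_prod_beta)
qed

text \<open>
  A section is the image of the zero section under its action.
\<close>

lemma tilde_inject:
  assumes X: "X \<in> sections2 s M" and Y: "Y \<in> sections2 s M" and eq: "tilde s M X = tilde s M Y"
  shows "X = Y"
proof (rule section_eqI[OF X Y])
  fix c x assume c: "c \<in> atlas M" and x: "x \<in> chart_img c"
  let ?y = "((x, 0), (0, 0)) :: ('v \<times> 'v) \<times> ('v \<times> 'v)"
  define u where "u = chart_inv (tt c) ?y"
  have u: "u \<in> fst (tt c)" "snd (tt c) u = ?y"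
    unfolding u_def by (rule tt_point[OF c]; use x in simp)+
  have "section_action Z c ?y = rep2 s M c Z x" if Z: "Z \<in> sections2 s M" for Z
    using D_linear(3)[OF c section_data_smooth(1)[OF section_data_section[OF Z] c] x]
      D_linear(3)[OF c section_data_smooth(2)[OF section_data_section[OF Z] c] x]
    by (simp add: local_action_def rep2_eq[OF Z c x])
  then show "rep2 s M c X x = rep2 s M c Y x"
    using chart_form_tilde[OF X] chart_form_tilde[OF Y] c u eq X Y unfolding chart_form_def by metis
qed

text \<open>
  The local representative of a product \<open>X \<cdot> Y\<close> is the action of \<open>X\<close> applied to that of \<open>Y\<close>; as the action
  is chart-independent, so is the product. Composing the actions of \<open>X\<close> and \<open>Y\<close> gives the action of
  the product because differentials are linear and additive.
\<close>

lemma tilde_mult: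
  assumes X: "X \<in> sections2 s M" and Y: "Y \<in> sections2 s M"
  shows X2_closed: "X \<otimes>\<^bsub>X2 s M\<^esub> Y \<in> sections2 s M"
    and "tilde s M (X \<otimes>\<^bsub>X2 s M\<^esub> Y) = tilde s M X \<otimes>\<^bsub>DiffTT\<^esub> tilde s M Y"
proof -
  let ?A = "\<lambda>c x. comp1 s M c X x + comp1 s M c Y x"
  let ?B = "\<lambda>c x. comp2 s M c X x + comp2 s M c Y x"
  let ?C = "\<lambda>c x. comp12 s M c X x + comp12 s M c Y x
    + D c (comp1 s M c X) x (comp2 s M c Y x) + D c (comp2 s M c X) x (comp1 s M c Y x)"
  note dX = section_data_section[OF X] and dY = section_data_section[OF Y]
  have R: "((x, ?A c x), (?B c x, ?C c x))
      = section_action X c ((x, comp1 s M c Y x), (comp2 s M c Y x, comp12 s M c Y x))" for c x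
    by (simp add: local_action_def add_ac)
  have data: "section_data ?A ?B ?C"
    unfolding section_data_def
  proof (intro conjI ballI)
    fix c assume c: "c \<in> atlas M"
    note smX = section_data_smooth[OF dX c] and smY = section_data_smooth[OF dY c]
    show "smooth_in c (?A c)" "smooth_in c (?B c)" "smooth_in c (?C c)"
      by (intro smooth_on_add[OF scale] smooth_in_D[OF c] smX smY)+
    fix c' x assume c': "c' \<in> atlas M" and x: "x \<in> overlap c c'"
    show "((transition c c' x, ?A c' (transition c c' x)), (?B c' (transition c c' x), ?C c' (transition c c' x)))
        = transition (tt c) (tt c') ((x, ?A c x), (?B c x, ?C c x))"
      unfolding R section_data_transition[OF dY c c' x]
      by (rule local_action_transition[OF dX c c', symmetric]) (use x in simp)
  qed
  have mult: "X \<otimes>\<^bsub>X2 s M\<^esub> Y = section2_of s M ?A ?B ?C"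
    by (simp add: X2_def)
  show closed: "X \<otimes>\<^bsub>X2 s M\<^esub> Y \<in> sections2 s M"
    unfolding mult by (rule section2_of(1)[OF data])
  note tX = tilde_spec[OF X] and tY = tilde_spec[OF Y]
  show "tilde s M (X \<otimes>\<^bsub>X2 s M\<^esub> Y) = tilde s M X \<otimes>\<^bsub>DiffTT\<^esub> tilde s M Y"
  proof (rule chart_form_unique[OF _ _ chart_form_tilde[OF closed] chart_form_mult[OF tX(1) tY(1) tX(2) tY(2)]])
    show "tilde s M (X \<otimes>\<^bsub>X2 s M\<^esub> Y) \<in> extensional TTV"
      by (rule Bij_imp_extensional[OF Diff_Bij[OF tilde_Diff[OF closed]]])
    show "tilde s M X \<otimes>\<^bsub>DiffTT\<^esub> tilde s M Y \<in> extensional TTV"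
      by (simp add: Diff_mult[OF tX(1) tY(1)])
    fix c and y :: "('v \<times> 'v) \<times> ('v \<times> 'v)"
    assume c: "c \<in> atlas M" and y: "fst (fst y) \<in> chart_img c"
    note smX = section_data_smooth[OF dX c] and smY = section_data_smooth[OF dY c]
    have "section_action (X \<otimes>\<^bsub>X2 s M\<^esub> Y) c y = local_action ?A ?B ?C c y"
      unfolding mult by (rule local_action_section2_of[OF data c y])
    also have "\<dots> = section_action X c (section_action Y c y)"
      using diff_at_add[OF scale scale open_chart_img[OF c] smX(1) smY(1) y]
        diff_at_add[OF scale scale open_chart_img[OF c] smX(2) smY(2) y]
        D_linear(1)[OF c smX(1) y] D_linear(1)[OF c smX(2) y]
      by (simp add: local_action_def case_prod_beta add_ac)
    finally show "section_action (X \<otimes>\<^bsub>X2 s M\<^esub> Y) c y = section_action X c (section_action Y c y)" .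
  qed
qed

lemma smooth_in_0: "smooth_in c (\<lambda>x. 0)"
  by (rule smooth_on_0[OF scale])

lemma tilde_one:
  shows X2_one_closed: "\<one>\<^bsub>X2 s M\<^esub> \<in> sections2 s M"
    and "tilde s M \<one>\<^bsub>X2 s M\<^esub> = \<one>\<^bsub>DiffTT\<^esub>"
proof -
  have data: "section_data (\<lambda>c x. 0) (\<lambda>c x. 0) (\<lambda>c x. 0)"
    by (auto simp: section_data_def smooth_in_0 tt_transition dtrans_0 d2trans_0 simp del: comp_apply)
  have one: "\<one>\<^bsub>X2 s M\<^esub> = section2_of s M (\<lambda>c x. 0) (\<lambda>c x. 0) (\<lambda>c x. 0)"
    by (simp add: X2_def)
  show closed: "\<one>\<^bsub>X2 s M\<^esub> \<in> sections2 s M"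
    unfolding one by (rule section2_of(1)[OF data])
  show "tilde s M \<one>\<^bsub>X2 s M\<^esub> = \<one>\<^bsub>DiffTT\<^esub>"
  proof (rule chart_form_unique[OF _ _ chart_form_tilde[OF closed] chart_form_one])
    show "tilde s M \<one>\<^bsub>X2 s M\<^esub> \<in> extensional TTV"
      by (rule Bij_imp_extensional[OF Diff_Bij[OF tilde_Diff[OF closed]]])
    show "\<one>\<^bsub>DiffTT\<^esub> \<in> extensional TTV"
      by (simp add: Diff_one)
    show "section_action \<one>\<^bsub>X2 s M\<^esub> c y = y" if "c \<in> atlas M" "fst (fst y) \<in> chart_img c" for c y
      unfolding one local_action_section2_of[OF data that]
      using D_0[OF that] by (simp add: local_action_def case_prod_beta)
  qed
qed

text \<open>
  Inverses in \<open>X2\<close> and in \<open>Diff\<close> are definite descriptions. Uniqueness comes from the group of all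
  bijections, and is carried over to sections by the injective homomorphism \<open>tilde\<close>.
\<close>

lemma inverse_pair:
  assumes X: "X \<in> sections2 s M" and Y: "Y \<in> sections2 s M"
    and inverse: "\<And>c y. c \<in> atlas M \<Longrightarrow> fst (fst y) \<in> chart_img c \<Longrightarrow> section_action X c (section_action Y c y) = y"
      "\<And>c y. c \<in> atlas M \<Longrightarrow> fst (fst y) \<in> chart_img c \<Longrightarrow> section_action Y c (section_action X c y) = y"
  shows "inv\<^bsub>X2 s M\<^esub> X = Y" and "inv\<^bsub>DiffTT\<^esub> (tilde s M X) = tilde s M Y"
proof -
  have one: "tilde s M V \<otimes>\<^bsub>DiffTT\<^esub> tilde s M W = \<one>\<^bsub>DiffTT\<^esub>"
    if V: "V \<in> sections2 s M" and W: "W \<in> sections2 s M"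
      and id: "\<And>c y. c \<in> atlas M \<Longrightarrow> fst (fst y) \<in> chart_img c \<Longrightarrow> section_action V c (section_action W c y) = y"
    for V W
  proof (rule chart_form_unique[OF _ _ chart_form_mult[OF tilde_Diff[OF V] tilde_Diff[OF W]
            chart_form_tilde[OF V] chart_form_tilde[OF W]] chart_form_one])
    show "tilde s M V \<otimes>\<^bsub>DiffTT\<^esub> tilde s M W \<in> extensional TTV"
      by (simp add: Diff_mult[OF tilde_Diff[OF V] tilde_Diff[OF W]])
    show "\<one>\<^bsub>DiffTT\<^esub> \<in> extensional TTV"
      by (simp add: Diff_one)
  qed (rule id)
  note XY = one[OF X Y inverse(1)] and YX = one[OF Y X inverse(2)]
  interpret B: group "BijGroup TTV"
    by (rule group_BijGroup)
  have unique: "F = tilde s M Y"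
    if F: "F \<in> carrier DiffTT" and 1: "F \<otimes>\<^bsub>DiffTT\<^esub> tilde s M X = \<one>\<^bsub>DiffTT\<^esub>" for F
  proof -
    have "F \<in> carrier (BijGroup TTV)" "tilde s M X \<in> carrier (BijGroup TTV)" "tilde s M Y \<in> carrier (BijGroup TTV)"
      using Diff_Bij[OF F] Diff_Bij[OF tilde_Diff[OF X]] Diff_Bij[OF tilde_Diff[OF Y]]
      by (simp_all add: BijGroup_def)
    then show ?thesis
      using B.inv_unique[of F "tilde s M X" "tilde s M Y"] 1 XY by (simp add: Diff_def)
  qed
  show "inv\<^bsub>DiffTT\<^esub> (tilde s M X) = tilde s M Y"
    unfolding m_inv_def
  proof (rule the_equality)
    show "tilde s M Y \<in> carrier DiffTT \<and> tilde s M X \<otimes>\<^bsub>DiffTT\<^esub> tilde s M Y = \<one>\<^bsub>DiffTT\<^esub>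
        \<and> tilde s M Y \<otimes>\<^bsub>DiffTT\<^esub> tilde s M X = \<one>\<^bsub>DiffTT\<^esub>"
      by (intro conjI tilde_Diff[OF Y] XY YX)
  qed (elim conjE, rule unique)
  have carrier: "carrier (X2 s M) = sections2 s M"
    by (simp add: X2_def)
  have mult_one: "V \<otimes>\<^bsub>X2 s M\<^esub> W = \<one>\<^bsub>X2 s M\<^esub> \<longleftrightarrow> tilde s M V \<otimes>\<^bsub>DiffTT\<^esub> tilde s M W = \<one>\<^bsub>DiffTT\<^esub>"
    if "V \<in> sections2 s M" "W \<in> sections2 s M" for V W
    using tilde_inject[OF X2_closed[OF that] X2_one_closed] tilde_mult(2)[OF that] tilde_one(2) by auto
  show "inv\<^bsub>X2 s M\<^esub> X = Y"
    unfolding m_inv_def carrier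
  proof (rule the_equality)
    show "Y \<in> sections2 s M \<and> X \<otimes>\<^bsub>X2 s M\<^esub> Y = \<one>\<^bsub>X2 s M\<^esub> \<and> Y \<otimes>\<^bsub>X2 s M\<^esub> X = \<one>\<^bsub>X2 s M\<^esub>"
      using X Y XY YX mult_one by simp
    fix Z assume Z: "Z \<in> sections2 s M \<and> X \<otimes>\<^bsub>X2 s M\<^esub> Z = \<one>\<^bsub>X2 s M\<^esub> \<and> Z \<otimes>\<^bsub>X2 s M\<^esub> X = \<one>\<^bsub>X2 s M\<^esub>"
    then have "tilde s M Z = tilde s M Y"
      using mult_one[of Z X] X by (intro unique tilde_Diff) auto
    then show "Z = Y"
      using tilde_inject Z Y by blast
  qed
qed

section \<open>The commutator\<close>

text \<open>
  The sections \<open>\<epsilon>\<^sub>1 X\<close>, \<open>\<epsilon>\<^sub>2 X\<close>, \<open>\<epsilon>\<^sub>1 \<epsilon>\<^sub>2 X\<close> and the inverses of the first two. At most one of the components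
  \<open>A\<close>, \<open>B\<close> is nonzero, so the term \<open>d\<^sup>2\<phi>(x)(A, B)\<close> in the transition map vanishes.
\<close>

lemma section_data_axis:
  assumes X: "X \<in> vector_fields s M"
  shows "section_data (\<lambda>c. vf_rep c X) (\<lambda>c x. 0) (\<lambda>c x. 0)"
    and "section_data (\<lambda>c x. 0) (\<lambda>c. vf_rep c X) (\<lambda>c x. 0)"
    and "section_data (\<lambda>c x. 0) (\<lambda>c x. 0) (\<lambda>c. vf_rep c X)"
    and "section_data (\<lambda>c x. - vf_rep c X x) (\<lambda>c x. 0) (\<lambda>c x. 0)"
    and "section_data (\<lambda>c x. 0) (\<lambda>c x. - vf_rep c X x) (\<lambda>c x. 0)"
  unfolding section_data_def
  by (simp_all add: smooth_in_0 smooth_in_vf_rep[OF X] smooth_on_uminus[OF scale] tt_transition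
      dtrans_0 dtrans_minus d2trans_0 vf_rep_transition[OF X] del: comp_apply)

text \<open>
  With \<open>g = \<epsilon>\<^sub>1 X\<close> and \<open>h = \<epsilon>\<^sub>2 Y\<close>, the four factors of \<open>g h g\<inverse> h\<inverse>\<close> move a point of a chart from
  \<open>(v\<^sub>1, v\<^sub>2)\<close> through \<open>(v\<^sub>1, v\<^sub>2 - Y)\<close>, \<open>(v\<^sub>1 - X, v\<^sub>2 - Y)\<close>, \<open>(v\<^sub>1 - X, v\<^sub>2)\<close> back to \<open>(v\<^sub>1, v\<^sub>2)\<close>, while
  \<open>v\<^sub>1\<^sub>2\<close> receives \<open>- dY(v\<^sub>1) - dX(v\<^sub>2 - Y) + dY(v\<^sub>1 - X) + dX(v\<^sub>2) = dX(Y) - dY(X)\<close>.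
\<close>

lemma commutators:
  assumes X: "X \<in> vector_fields s M" and Y: "Y \<in> vector_fields s M"
  shows "group_commutator (X2 s M) (eps1 s M X) (eps2 s M Y) = eps12 s M (lie_bracket s M X Y)"
    and "group_commutator DiffTT (tilde s M (eps1 s M X)) (tilde s M (eps2 s M Y))
      = tilde s M (eps12 s M (lie_bracket s M X Y))"
proof -
  let ?t = "tilde s M"
  note L = lie_bracket_in_charts[OF X Y]
  define g where "g = eps1 s M X"
  define h where "h = eps2 s M Y"
  define e where "e = eps12 s M (lie_bracket s M X Y)"
  define g' where "g' = section2_of s M (\<lambda>c x. - vf_rep c X x) (\<lambda>c x. 0) (\<lambda>c x. 0)"
  define h' where "h' = section2_of s M (\<lambda>c x. 0) (\<lambda>c x. - vf_rep c Y x) (\<lambda>c x. 0)"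
  note data = section_data_axis[OF X] section_data_axis[OF Y] section_data_axis[OF L(1)]
  have sec: "g \<in> sections2 s M" "h \<in> sections2 s M" "e \<in> sections2 s M" "g' \<in> sections2 s M" "h' \<in> sections2 s M"
    unfolding g_def h_def e_def g'_def h'_def eps1_def eps2_def eps12_def
    by (rule section2_of(1)[OF data(1)] section2_of(1)[OF data(7)] section2_of(1)[OF data(13)]
        section2_of(1)[OF data(4)] section2_of(1)[OF data(10)])+
  have form: "section_action g c ((x, v1), (v2, v12)) = ((x, v1 + vf_rep c X x), (v2, v12 + D c (vf_rep c X) x v2))"
      "section_action h c ((x, v1), (v2, v12)) = ((x, v1), (v2 + vf_rep c Y x, v12 + D c (vf_rep c Y) x v1))"
      "section_action g' c ((x, v1), (v2, v12)) = ((x, v1 - vf_rep c X x), (v2, v12 - D c (vf_rep c X) x v2))"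
      "section_action h' c ((x, v1), (v2, v12)) = ((x, v1), (v2 - vf_rep c Y x, v12 - D c (vf_rep c Y) x v1))"
      "section_action e c ((x, v1), (v2, v12)) =
        ((x, v1), (v2, v12 + (D c (vf_rep c X) x (vf_rep c Y x) - D c (vf_rep c Y) x (vf_rep c X x))))"
    if c: "c \<in> atlas M" and x: "x \<in> chart_img c" for c x v1 v2 v12
  proof -
    have y: "fst (fst ((x, v1), (v2, v12))) \<in> chart_img c"
      using x by simp
    note DX = D_uminus[OF c smooth_in_vf_rep[OF X c] x] and DY = D_uminus[OF c smooth_in_vf_rep[OF Y c] x]
    show "section_action g c ((x, v1), (v2, v12)) = ((x, v1 + vf_rep c X x), (v2, v12 + D c (vf_rep c X) x v2))"
      "section_action h c ((x, v1), (v2, v12)) = ((x, v1), (v2 + vf_rep c Y x, v12 + D c (vf_rep c Y) x v1))"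
      "section_action g' c ((x, v1), (v2, v12)) = ((x, v1 - vf_rep c X x), (v2, v12 - D c (vf_rep c X) x v2))"
      "section_action h' c ((x, v1), (v2, v12)) = ((x, v1), (v2 - vf_rep c Y x, v12 - D c (vf_rep c Y) x v1))"
      "section_action e c ((x, v1), (v2, v12)) =
        ((x, v1), (v2, v12 + (D c (vf_rep c X) x (vf_rep c Y x) - D c (vf_rep c Y) x (vf_rep c X x))))"
      unfolding g_def h_def e_def g'_def h'_def eps1_def eps2_def eps12_def
        local_action_section2_of[OF data(1) c y] local_action_section2_of[OF data(7) c y] local_action_section2_of[OF data(13) c y]
        local_action_section2_of[OF data(4) c y] local_action_section2_of[OF data(10) c y]
      by (simp_all add: local_action_def D_0[OF c x] DX DY L(2)[OF c x])
  qed
  have inv: "inv\<^bsub>X2 s M\<^esub> g = g'" "inv\<^bsub>DiffTT\<^esub> (?t g) = ?t g'"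
    by (rule inverse_pair[OF sec(1,4)]; force simp: form)+
  have inv': "inv\<^bsub>X2 s M\<^esub> h = h'" "inv\<^bsub>DiffTT\<^esub> (?t h) = ?t h'"
    by (rule inverse_pair[OF sec(2,5)]; force simp: form)+
  define k where "k = g \<otimes>\<^bsub>X2 s M\<^esub> h \<otimes>\<^bsub>X2 s M\<^esub> g' \<otimes>\<^bsub>X2 s M\<^esub> h'"
  have gh: "g \<otimes>\<^bsub>X2 s M\<^esub> h \<in> sections2 s M" and ghg: "g \<otimes>\<^bsub>X2 s M\<^esub> h \<otimes>\<^bsub>X2 s M\<^esub> g' \<in> sections2 s M"
    and k: "k \<in> sections2 s M"
    unfolding k_def by (intro X2_closed sec)+
  have tk: "?t k = ?t g \<otimes>\<^bsub>DiffTT\<^esub> ?t h \<otimes>\<^bsub>DiffTT\<^esub> ?t g' \<otimes>\<^bsub>DiffTT\<^esub> ?t h'"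
    unfolding k_def by (simp only: tilde_mult(2) sec gh ghg)
  have tgh: "?t (g \<otimes>\<^bsub>X2 s M\<^esub> h) = ?t g \<otimes>\<^bsub>DiffTT\<^esub> ?t h"
    and tghg: "?t (g \<otimes>\<^bsub>X2 s M\<^esub> h \<otimes>\<^bsub>X2 s M\<^esub> g') = ?t g \<otimes>\<^bsub>DiffTT\<^esub> ?t h \<otimes>\<^bsub>DiffTT\<^esub> ?t g'"
    by (simp_all only: tilde_mult(2) sec gh)
  \<comment> \<open>The commutator is evaluated in \<open>Diff\<close> first and then pulled back along \<open>tilde\<close>.\<close>
  have form_k: "chart_form (?t k) (\<lambda>c y. section_action g c (section_action h c (section_action g' c (section_action h' c y))))"
    unfolding tk
    by (intro chart_form_mult tilde_Diff chart_form_tilde sec tilde_Diff[OF gh, unfolded tgh]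
        tilde_Diff[OF ghg, unfolded tghg])
  have tke: "?t k = ?t e"
  proof (rule chart_form_unique[OF _ _ form_k chart_form_tilde[OF sec(3)]])
    show "?t k \<in> extensional TTV" "?t e \<in> extensional TTV"
      by (intro Bij_imp_extensional Diff_Bij tilde_Diff k sec)+
    fix c and y :: "('v \<times> 'v) \<times> ('v \<times> 'v)"
    assume c: "c \<in> atlas M" and y: "fst (fst y) \<in> chart_img c"
    obtain x v1 v2 v12 where y_eq: "y = ((x, v1), (v2, v12))"
      by (metis prod.collapse)
    have x: "x \<in> chart_img c"
      using y by (simp add: y_eq)
    have D_diff: "D c (vf_rep c Z) x (v - w) = D c (vf_rep c Z) x v - D c (vf_rep c Z) x w"
      if Z: "Z \<in> vector_fields s M" for Z v w
      using D_linear(1)[OF c smooth_in_vf_rep[OF Z c] x, of v "- w"]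
        D_linear(2)[OF c smooth_in_vf_rep[OF Z c] x, of w] by simp
    show "section_action g c (section_action h c (section_action g' c (section_action h' c y))) = section_action e c y"
      by (simp add: y_eq form[OF c x] D_diff[OF X] D_diff[OF Y])
  qed
  have ke: "k = e"
    by (rule tilde_inject[OF k sec(3) tke])
  show "group_commutator (X2 s M) (eps1 s M X) (eps2 s M Y) = eps12 s M (lie_bracket s M X Y)"
    using ke by (simp add: group_commutator_def inv inv' k_def flip: g_def h_def e_def)
  show "group_commutator DiffTT (?t (eps1 s M X)) (?t (eps2 s M Y)) = ?t (eps12 s M (lie_bracket s M X Y))"
    using tke by (simp add: group_commutator_def inv inv' tk flip: g_def h_def e_def)
qed

end

theorem theorem14p4:
  fixes s :: "'k::dense_unit_ring \<Rightarrow> 'v::{topological_ab_group_add,t2_space} \<Rightarrow> 'v"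
    and M :: "('m, 'v) mfd"
  assumes "topological_module s"
    and "smooth_manifold s M"
  shows "(\<forall>X\<in>vector_fields s M. \<forall>Y\<in>vector_fields s M.
            group_commutator (X2 s M) (eps1 s M X) (eps2 s M Y)
              = eps12 s M (lie_bracket s M X Y)) \<and>
         (\<forall>X\<in>vector_fields s M. \<forall>Y\<in>vector_fields s M.
            group_commutator (Diff (ttscale s) (TTM s M))
                (tilde s M (eps1 s M X)) (tilde s M (eps2 s M Y))
              = tilde s M (eps12 s M (lie_bracket s M X Y)))"
proof -
  interpret smooth_mfd s M
    using assms by (rule smooth_mfd.intro)
  show ?thesis
    using commutators by blast
qed

end
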